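(* Let $n\ge2$ be even. The semi-simplification of $D\mathcal{K}_n$-mod is not modular.
   Context: $D\mathcal{K}_n$ (Drinfeld double of the Nichols Hopf algebra $\mathcal{K}_n$) is the $2^{2n+2}$-dimensional complex Hopf algebra with generators $K,\bar K,\xi_i,\bar\xi_i$ ($1\le i\le n$) and relations $K^2=\bar K^2=(K\bar K)^2=1$, $\xi_i^2=\bar\xi_i^2=0$; $K$ and $\bar K$ each anticommute with every $\xi_i$ and $\bar\xi_i$; $\xi_i\xi_j=-\xi_j\xi_i$, $\bar\xi_i\bar\xi_j=-\bar\xi_j\bar\xi_i$; $\xi_i\bar\xi_j=-\bar\xi_j\xi_i$ for $i\ne j$; $\xi_i\bar\xi_i=1-K\bar K-\bar\xi_i\xi_i$; $\Delta(K)=K\otimes K$, $\Delta(\bar K)=\bar K\otimes\bar K$, $\Delta(\xi_i)=K\otimes\xi_i+\xi_i\otimes1$, $\Delta(\bar\xi_i)=\bar K\otimes\bar\xi_i+\bar\xi_i\otimes1$, $S(K)=K$, $S(\bar K)=\bar K$, $S(\xi_i)=-K\xi_i$, $S(\bar\xi_i)=-\bar K\bar\xi_i$. Let $W$ be the set of words $w=\xi_{i_1}\cdots\xi_{i_k}$, $i_1<\dots<i_k$, $k\ge0$; $|w|=k$, $\bar w=\bar\xi_{i_1}\cdots\bar\xi_{i_k}$. For $n$ even, $\mathcal{B}=D\mathcal{K}_n$-mod (finite-dimensional left modules) is a non-semisimple modular category (non-degenerate ribbon finite tensor category) via $R=\sum_{w\in W}(-1)^{\lfloor|w|/2\rfloor}(w\otimes\bar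 w\bar K^{|w|})\cdot\frac12(1\otimes1+K\otimes1+1\otimes\bar K-K\otimes\bar K)$ and ribbon element $\nu=(1+K-\bar K+K\bar K)\sum_{w\in W}\frac{(-1)^{\lfloor(|w|+1)/2\rfloor}}{2}w\bar w$. A morphism $f:X\to Y$ in $\mathcal{B}$ is negligible if the (quantum) trace $\mathrm{tr}(fg)=0$ for every $g:Y\to X$. An object $X$ is quasi-dominated by simple objects if there are finitely many simple objects $X_i$ and morphisms $\alpha_{i,m}:X_i\to X$, $\beta_{i,m}:X\to X_i$ such that $\mathrm{id}_X-\sum_{i,m}\alpha_{i,m}\beta_{i,m}$ is negligible; $\mathcal{B}_{QD}$ is the full subcategory of such objects. The semi-simplification $\overline{\mathcal{B}}$ has the same objects as $\mathcal{B}_{QD}$, and morphism spaces $\mathrm{Hom}_{\mathcal{B}}(X,Y)$ modulo negligible morphisms. "Modular" means that the resulting semisimple ribbon category is non-degenerate, i.e. its $S$-matrix (the matrix of Hopf link invariants of pairs of simple objects) is invertible. *)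

theory Defs
  imports
    "Jordan_Normal_Form.Matrix"
    "HOL-Library.Poly_Mapping"
    "HOL-Library.Product_Plus"
begin

section \<open>Ribbon categories over the complex numbers\<close>

text \<open>
  The data of a complex-linear ribbon category with objects of type \<open>'o\<close> and morphisms of type
  \<open>'m\<close>; associators and unitors are omitted, as quantum traces of endomorphisms of an object and
  Hopf link invariants do not involve them. A morphism need not
  determine its source and target, so the operations take the objects involved as arguments:
  \<open>Comp C X Y Z g f\<close> is the composite of \<open>f : X \<rightarrow> Y\<close> and \<open>g : Y \<rightarrow> Z\<close>, and
  \<open>TensM C X X' Y Y' f g\<close> is \<open>f \<otimes> g : X \<otimes> Y \<rightarrow> X' \<otimes> Y'\<close> for \<open>f : X \<rightarrow> X'\<close>, \<open>g : Y \<rightarrow> Y'\<close>.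
  Duals are left duals, \<open>Ev C X : X\<^sup>* \<otimes> X \<rightarrow> 1\<close> and \<open>Coev C X : 1 \<rightarrow> X \<otimes> X\<^sup>*\<close>;
  \<open>Braid C X Y : X \<otimes> Y \<rightarrow> Y \<otimes> X\<close>. Only data are recorded, no axioms.
\<close>

record ('o, 'm) ribbon_cat =
  Obj :: "'o set"
  Hom :: "'o \<Rightarrow> 'o \<Rightarrow> 'm set"
  Id :: "'o \<Rightarrow> 'm"
  Comp :: "'o \<Rightarrow> 'o \<Rightarrow> 'o \<Rightarrow> 'm \<Rightarrow> 'm \<Rightarrow> 'm"
  Zero :: "'o \<Rightarrow> 'o \<Rightarrow> 'm"
  Add :: "'o \<Rightarrow> 'o \<Rightarrow> 'm \<Rightarrow> 'm \<Rightarrow> 'm"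
  Scale :: "'o \<Rightarrow> 'o \<Rightarrow> complex \<Rightarrow> 'm \<Rightarrow> 'm"
  Unit :: "'o"
  Tens :: "'o \<Rightarrow> 'o \<Rightarrow> 'o"
  TensM :: "'o \<Rightarrow> 'o \<Rightarrow> 'o \<Rightarrow> 'o \<Rightarrow> 'm \<Rightarrow> 'm \<Rightarrow> 'm"
  Dual :: "'o \<Rightarrow> 'o"
  Ev :: "'o \<Rightarrow> 'm"
  Coev :: "'o \<Rightarrow> 'm"
  Braid :: "'o \<Rightarrow> 'o \<Rightarrow> 'm"
  Twist :: "'o \<Rightarrow> 'm"

definition Diff :: "('o, 'm) ribbon_cat \<Rightarrow> 'o \<Rightarrow> 'o \<Rightarrow> 'm \<Rightarrow> 'm \<Rightarrow> 'm" where
  "Diff C X Y f g = Add C X Y f (Scale C X Y (-1) g)"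

definition is_iso :: "('o, 'm) ribbon_cat \<Rightarrow> 'o \<Rightarrow> 'o \<Rightarrow> 'm \<Rightarrow> bool" where
  "is_iso C X Y f \<longleftrightarrow> f \<in> Hom C X Y \<and>
     (\<exists>g\<in>Hom C Y X. Comp C X Y X g f = Id C X \<and> Comp C Y X Y f g = Id C Y)"

definition isomorphic :: "('o, 'm) ribbon_cat \<Rightarrow> 'o \<Rightarrow> 'o \<Rightarrow> bool" where
  "isomorphic C X Y \<longleftrightarrow> (\<exists>f. is_iso C X Y f)"

definition is_mono :: "('o, 'm) ribbon_cat \<Rightarrow> 'o \<Rightarrow> 'o \<Rightarrow> 'm \<Rightarrow> bool" where
  "is_mono C X Y f \<longleftrightarrow> f \<in> Hom C X Y \<and>
     (\<forall>Z\<in>Obj C. \<forall>g\<in>Hom C Z X. \<forall>h\<in>Hom C Z X.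
        Comp C Z X Y f g = Comp C Z X Y f h \<longrightarrow> g = h)"

definition simple_obj :: "('o, 'm) ribbon_cat \<Rightarrow> 'o \<Rightarrow> bool" where
  "simple_obj C X \<longleftrightarrow> X \<in> Obj C \<and> Id C X \<noteq> Zero C X X \<and>
     (\<forall>Y\<in>Obj C. \<forall>f. is_mono C Y X f \<longrightarrow> f = Zero C Y X \<or> is_iso C Y X f)"

text \<open>The quantum trace of \<open>f : X \<rightarrow> X\<close>, an endomorphism of the unit object:
  \<open>ev \<circ> c \<circ> (\<theta> f \<otimes> id) \<circ> coev\<close>.\<close>

definition qtrace :: "('o, 'm) ribbon_cat \<Rightarrow> 'o \<Rightarrow> 'm \<Rightarrow> 'm" where
  "qtrace C X f =
     (let I = Unit C; D = Dual C X; P = Tens C X D; Q = Tens C D X in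
      Comp C I Q I (Ev C X)
        (Comp C I P Q (Braid C X D)
          (Comp C I P P (TensM C X X D D (Comp C X X X (Twist C X) f) (Id C D))
            (Coev C X))))"

text \<open>The scalar represented by an endomorphism of the unit object.\<close>

definition scalar_of :: "('o, 'm) ribbon_cat \<Rightarrow> 'm \<Rightarrow> complex" where
  "scalar_of C f = (THE c. f = Scale C (Unit C) (Unit C) c (Id C (Unit C)))"

definition negligible :: "('o, 'm) ribbon_cat \<Rightarrow> 'o \<Rightarrow> 'o \<Rightarrow> 'm \<Rightarrow> bool" where
  "negligible C X Y f \<longleftrightarrow> f \<in> Hom C X Y \<and>
     (\<forall>g\<in>Hom C Y X. qtrace C Y (Comp C Y X Y f g) = Zero C (Unit C) (Unit C))"

text \<open>The entries \<open>(S, \<alpha>, \<beta>)\<close> of the list are the simple objects \<open>S\<close> (repetitions allowed) with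
  \<open>\<alpha> : S \<rightarrow> X\<close> and \<open>\<beta> : X \<rightarrow> S\<close>.\<close>

definition quasi_dominated :: "('o, 'm) ribbon_cat \<Rightarrow> 'o \<Rightarrow> bool" where
  "quasi_dominated C X \<longleftrightarrow> (\<exists>L :: ('o \<times> 'm \<times> 'm) list.
     (\<forall>(S, \<alpha>, \<beta>) \<in> set L. simple_obj C S \<and> \<alpha> \<in> Hom C S X \<and> \<beta> \<in> Hom C X S) \<and>
     negligible C X X
       (Diff C X X (Id C X)
         (foldr (\<lambda>(S, \<alpha>, \<beta>). Add C X X (Comp C X S X \<alpha> \<beta>)) L (Zero C X X))))"

definition neg_class :: "('o, 'm) ribbon_cat \<Rightarrow> 'o \<Rightarrow> 'o \<Rightarrow> 'm \<Rightarrow> 'm set" where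
  "neg_class C X Y f = {g \<in> Hom C X Y. negligible C X Y (Diff C X Y g f)}"

text \<open>All structure is induced from \<open>C\<close>. An operation on classes is the union of the classes of the
  results over all representatives, which is a single class when the operation descends.\<close>

definition semisimplification :: "('o, 'm) ribbon_cat \<Rightarrow> ('o, 'm set) ribbon_cat" where
  "semisimplification C = \<lparr>
     Obj = {X \<in> Obj C. quasi_dominated C X},
     Hom = (\<lambda>X Y. neg_class C X Y ` Hom C X Y),
     Id = (\<lambda>X. neg_class C X X (Id C X)),
     Comp = (\<lambda>X Y Z G F. \<Union>g\<in>G. \<Union>f\<in>F. neg_class C X Z (Comp C X Y Z g f)),
     Zero = (\<lambda>X Y. neg_class C X Y (Zero C X Y)),
     Add = (\<lambda>X Y F G. \<Union>f\<in>F. \<Union>g\<in>G. neg_class C X Y (Add C X Y f g)),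
     Scale = (\<lambda>X Y c F. \<Union>f\<in>F. neg_class C X Y (Scale C X Y c f)),
     Unit = Unit C,
     Tens = Tens C,
     TensM = (\<lambda>X X' Y Y' F G. \<Union>f\<in>F. \<Union>g\<in>G.
        neg_class C (Tens C X Y) (Tens C X' Y') (TensM C X X' Y Y' f g)),
     Dual = Dual C,
     Ev = (\<lambda>X. neg_class C (Tens C (Dual C X) X) (Unit C) (Ev C X)),
     Coev = (\<lambda>X. neg_class C (Unit C) (Tens C X (Dual C X)) (Coev C X)),
     Braid = (\<lambda>X Y. neg_class C (Tens C X Y) (Tens C Y X) (Braid C X Y)),
     Twist = (\<lambda>X. neg_class C X X (Twist C X)) \<rparr>"

definition simple_representatives :: "('o, 'm) ribbon_cat \<Rightarrow> 'o list \<Rightarrow> bool" where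
  "simple_representatives C Xs \<longleftrightarrow>
     (\<forall>X\<in>set Xs. simple_obj C X) \<and>
     (\<forall>i<length Xs. \<forall>j<length Xs. isomorphic C (Xs ! i) (Xs ! j) \<longrightarrow> i = j) \<and>
     (\<forall>X. simple_obj C X \<longrightarrow> (\<exists>Y\<in>set Xs. isomorphic C X Y))"

text \<open>Invariant of the Hopf link coloured by \<open>X\<close> and \<open>Y\<close>: the trace of the double braiding.\<close>

definition hopf_link :: "('o, 'm) ribbon_cat \<Rightarrow> 'o \<Rightarrow> 'o \<Rightarrow> complex" where
  "hopf_link C X Y = scalar_of C (qtrace C (Tens C X Y)
     (Comp C (Tens C X Y) (Tens C Y X) (Tens C X Y) (Braid C Y X) (Braid C X Y)))"

definition S_matrix :: "('o, 'm) ribbon_cat \<Rightarrow> 'o list \<Rightarrow> complex mat" where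
  "S_matrix C Xs = mat (length Xs) (length Xs) (\<lambda>(i, j). hopf_link C (Xs ! i) (Xs ! j))"

definition modular :: "('o, 'm) ribbon_cat \<Rightarrow> bool" where
  "modular C \<longleftrightarrow> (\<exists>Xs. simple_representatives C Xs \<and> invertible_mat (S_matrix C Xs))"


section \<open>The Hopf algebra as a presented algebra\<close>

text \<open>The free algebra on the generators is the monoid algebra of the free monoid of words; the
  tensor square of the free algebra is the monoid algebra of pairs of words.\<close>

datatype gen = GK | GKbar | GXi nat | GXibar nat

datatype gen_word = Word (letters: "gen list")

instantiation gen_word :: monoid_add
begin

definition zero_gen_word :: gen_word where
  "zero_gen_word = Word []"

definition plus_gen_word :: "gen_word \<Rightarrow> gen_word \<Rightarrow> gen_word" where
  "plus_gen_word u v = Word (letters u @ letters v)"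

instance
  by standard (simp_all add: zero_gen_word_def plus_gen_word_def)

end

type_synonym free_alg = "gen_word \<Rightarrow>\<^sub>0 complex"
type_synonym free_alg2 = "(gen_word \<times> gen_word) \<Rightarrow>\<^sub>0 complex"

definition gen :: "gen \<Rightarrow> free_alg" where
  "gen g = Poly_Mapping.single (Word [g]) 1"

abbreviation "K \<equiv> gen GK"
abbreviation "Kbar \<equiv> gen GKbar"
abbreviation "\<xi> i \<equiv> gen (GXi i)"
abbreviation "\<xi>bar i \<equiv> gen (GXibar i)"

definition tens :: "free_alg \<Rightarrow> free_alg \<Rightarrow> free_alg2" where
  "tens p q = (\<Sum>u\<in>Poly_Mapping.keys p. \<Sum>v\<in>Poly_Mapping.keys q.
     Poly_Mapping.single (u, v) (Poly_Mapping.lookup p u * Poly_Mapping.lookup q v))"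

definition gens :: "nat \<Rightarrow> gen set" where
  "gens n = {GK, GKbar} \<union> GXi ` {1..n} \<union> GXibar ` {1..n}"

text \<open>The defining relations, as elements of the free algebra that are set to zero.\<close>

definition relations :: "nat \<Rightarrow> free_alg set" where
  "relations n =
     {K ^ 2 - 1, Kbar ^ 2 - 1, (K * Kbar) ^ 2 - 1} \<union>
     {\<xi> i ^ 2 | i. i \<in> {1..n}} \<union>
     {\<xi>bar i ^ 2 | i. i \<in> {1..n}} \<union>
     {K * \<xi> i + \<xi> i * K | i. i \<in> {1..n}} \<union>
     {K * \<xi>bar i + \<xi>bar i * K | i. i \<in> {1..n}} \<union>
     {Kbar * \<xi> i + \<xi> i * Kbar | i. i \<in> {1..n}} \<union>
     {Kbar * \<xi>bar i + \<xi>bar i * Kbar | i. i \<in> {1..n}} \<union>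
     {\<xi> i * \<xi> j + \<xi> j * \<xi> i | i j. i \<in> {1..n} \<and> j \<in> {1..n}} \<union>
     {\<xi>bar i * \<xi>bar j + \<xi>bar j * \<xi>bar i | i j. i \<in> {1..n} \<and> j \<in> {1..n}} \<union>
     {\<xi> i * \<xi>bar j + \<xi>bar j * \<xi> i | i j. i \<in> {1..n} \<and> j \<in> {1..n} \<and> i \<noteq> j} \<union>
     {\<xi> i * \<xi>bar i - (1 - K * Kbar - \<xi>bar i * \<xi> i) | i. i \<in> {1..n}}"

fun coproduct :: "gen \<Rightarrow> free_alg2" where
  "coproduct GK = tens K K"
| "coproduct GKbar = tens Kbar Kbar"
| "coproduct (GXi i) = tens K (\<xi> i) + tens (\<xi> i) 1"
| "coproduct (GXibar i) = tens Kbar (\<xi>bar i) + tens (\<xi>bar i) 1"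

fun counit :: "gen \<Rightarrow> complex" where
  "counit GK = 1"
| "counit GKbar = 1"
| "counit (GXi i) = 0"
| "counit (GXibar i) = 0"

fun antipode :: "gen \<Rightarrow> free_alg" where
  "antipode GK = K"
| "antipode GKbar = Kbar"
| "antipode (GXi i) = - (K * \<xi> i)"
| "antipode (GXibar i) = - (Kbar * \<xi>bar i)"

text \<open>The word \<open>w = \<xi>\<^sub>i\<^sub>1 \<cdots> \<xi>\<^sub>i\<^sub>k\<close> with \<open>i\<^sub>1 < \<dots> < i\<^sub>k\<close> is indexed by the set of its
  indices.\<close>

definition xi_word :: "nat set \<Rightarrow> free_alg" where
  "xi_word A = prod_list (map (\<lambda>i. \<xi> i) (sorted_list_of_set A))"

definition xibar_word :: "nat set \<Rightarrow> free_alg" where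
  "xibar_word A = prod_list (map (\<lambda>i. \<xi>bar i) (sorted_list_of_set A))"

definition R_matrix :: "nat \<Rightarrow> free_alg2" where
  "R_matrix n =
     (\<Sum>A\<in>Pow {1..n}. (- 1) ^ (card A div 2) * tens (xi_word A) (xibar_word A * Kbar ^ card A)) *
     (Poly_Mapping.single 0 (1 / 2) * (tens 1 1 + tens K 1 + tens 1 Kbar - tens K Kbar))"

definition ribbon_element :: "nat \<Rightarrow> free_alg" where
  "ribbon_element n =
     (1 + K - Kbar + K * Kbar) *
     (\<Sum>A\<in>Pow {1..n}. Poly_Mapping.single 0 ((- 1) ^ ((card A + 1) div 2) / 2) *
        (xi_word A * xibar_word A))"


section \<open>Finite-dimensional modules\<close>

text \<open>A \<open>d\<close>-dimensional left module, on the space of column vectors of length \<open>d\<close>, is given by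
  \<open>d \<times> d\<close> matrices for the generators on which all defining relations vanish.\<close>

datatype mrep = Rep (rdim: nat) (rgen: "gen \<Rightarrow> complex mat")

definition word_act :: "mrep \<Rightarrow> gen_word \<Rightarrow> complex mat" where
  "word_act X w = foldr (\<lambda>g M. rgen X g * M) (letters w) (1\<^sub>m (rdim X))"

definition act :: "mrep \<Rightarrow> free_alg \<Rightarrow> complex mat" where
  "act X p = mat (rdim X) (rdim X) (\<lambda>(i, j).
     \<Sum>w\<in>Poly_Mapping.keys p. Poly_Mapping.lookup p w * word_act X w $$ (i, j))"

definition is_module :: "nat \<Rightarrow> mrep \<Rightarrow> bool" where
  "is_module n X \<longleftrightarrow>
     (\<forall>g\<in>gens n. rgen X g \<in> carrier_mat (rdim X) (rdim X)) \<and>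
     (\<forall>r\<in>relations n. act X r = 0\<^sub>m (rdim X) (rdim X))"

definition module_hom :: "nat \<Rightarrow> mrep \<Rightarrow> mrep \<Rightarrow> complex mat set" where
  "module_hom n X Y = {f \<in> carrier_mat (rdim Y) (rdim X). \<forall>g\<in>gens n. f * rgen X g = rgen Y g * f}"

text \<open>Kronecker product; the basis vector \<open>e\<^sub>i \<otimes> e\<^sub>j\<close> of \<open>V \<otimes> W\<close> has index \<open>i * dim W + j\<close>.\<close>

definition kron :: "complex mat \<Rightarrow> complex mat \<Rightarrow> complex mat" where
  "kron A B = mat (dim_row A * dim_row B) (dim_col A * dim_col B) (\<lambda>(i, j).
     A $$ (i div dim_row B, j div dim_col B) * B $$ (i mod dim_row B, j mod dim_col B))"

text \<open>The flip \<open>V \<otimes> W \<rightarrow> W \<otimes> V\<close> for \<open>dim V = p\<close> and \<open>dim W = q\<close>.\<close>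

definition flip_mat :: "nat \<Rightarrow> nat \<Rightarrow> complex mat" where
  "flip_mat p q = mat (q * p) (p * q) (\<lambda>(i, j).
     if i div p = j mod q \<and> i mod p = j div q then 1 else 0)"

definition act2 :: "mrep \<Rightarrow> mrep \<Rightarrow> free_alg2 \<Rightarrow> complex mat" where
  "act2 X Y P = mat (rdim X * rdim Y) (rdim X * rdim Y) (\<lambda>(i, j).
     \<Sum>(u, v)\<in>Poly_Mapping.keys P.
       Poly_Mapping.lookup P (u, v) * kron (word_act X u) (word_act Y v) $$ (i, j))"

definition unit_mod :: mrep where
  "unit_mod = Rep 1 (\<lambda>g. mat 1 1 (\<lambda>_. counit g))"

definition tensor_mod :: "mrep \<Rightarrow> mrep \<Rightarrow> mrep" where
  "tensor_mod X Y = Rep (rdim X * rdim Y) (\<lambda>g. act2 X Y (coproduct g))"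

definition dual_mod :: "mrep \<Rightarrow> mrep" where
  "dual_mod X = Rep (rdim X) (\<lambda>g. transpose_mat (act X (antipode g)))"

text \<open>The braiding is the action of the R-matrix followed by the flip. The ribbon element used here
  satisfies \<open>\<Delta>(\<nu>) = R\<^sub>2\<^sub>1 R (\<nu> \<otimes> \<nu>)\<close>, so the twist is the action of \<open>\<nu>\<close> itself (in the other
  common convention for ribbon elements, the twist is the action of the inverse).\<close>

definition DK_mod :: "nat \<Rightarrow> (mrep, complex mat) ribbon_cat" where
  "DK_mod n = \<lparr>
     Obj = {X. is_module n X},
     Hom = module_hom n,
     Id = (\<lambda>X. 1\<^sub>m (rdim X)),
     Comp = (\<lambda>X Y Z g f. g * f),
     Zero = (\<lambda>X Y. 0\<^sub>m (rdim Y) (rdim X)),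
     Add = (\<lambda>X Y f g. f + g),
     Scale = (\<lambda>X Y c f. c \<cdot>\<^sub>m f),
     Unit = unit_mod,
     Tens = tensor_mod,
     TensM = (\<lambda>X X' Y Y' f g. kron f g),
     Dual = dual_mod,
     Ev = (\<lambda>X. mat 1 (rdim X * rdim X) (\<lambda>(_, j). if j div rdim X = j mod rdim X then 1 else 0)),
     Coev = (\<lambda>X. mat (rdim X * rdim X) 1 (\<lambda>(i, _). if i div rdim X = i mod rdim X then 1 else 0)),
     Braid = (\<lambda>X Y. flip_mat (rdim X) (rdim Y) * act2 X Y (R_matrix n)),
     Twist = (\<lambda>X. act X (ribbon_element n)) \<rparr>"

end

(*
  Write 1 for the unit and P for the one-dimensional module on which K = Kbar = -1 and all xi_i,
  xibar_i vanish. The double braiding of P with any module Z is the action of K Kbar on Z. For even n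
  the quantum trace of f is Tr(K f): the closure of the braiding gives the Drinfeld element
  prod_i (1 - xibar_i xi_i), the ribbon element contains prod_i (1 - xi_i xibar_i), and the product of
  these is (K Kbar)^n = 1, so that only the Cartan parts survive and combine to K. Hence the Hopf link of
  1 and Z is Tr(K), that of P and Z is - Tr(Kbar), and
  Tr(K - Kbar) = Tr(K (xi_1 xibar_1 + xibar_1 xi_1)) = 0 because K anticommutes with xi_1. So the rows of
  the S-matrix that belong to 1 and P are opposite. That Hopf links may be computed before passing to
  the quotient follows from the negligible morphisms forming a tensor ideal: traces against K are cyclic,
  and partial traces against K of module endomorphisms are again module endomorphisms.
*)
theory Submission
  imports Defs
begin

text \<open>The representatives of the simple objects form an arbitrary list whose members are
  isomorphic to 1 and P only in the quotient. There an isomorphism and its inverse compose to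
  identities up to negligible morphisms, so invariance of the Hopf link combines naturality of the
  double braiding with the ideal property. Simplicity is defined by monomorphisms. In the module
  category a monomorphism is tested against two maps out of a tensor product; in the quotient a
  nonzero map to a one-dimensional module has a section, because the pairing that defines
  negligibility does not vanish on it. Identities between Hopf algebra elements are proved in their
  action on each module. The sums over words in R and \<nu> become ordered products with one factor
  per index, and these are compared one factor at a time, so that each identity reduces to a
  computation with a single pair \<xi>_i, \<xi>bar_i. The factors 1/2 in R and \<nu> stay outside as
  scalar matrices; together they cancel the 4 in (1 + K + Kbar - K Kbar)(1 + K - Kbar + K Kbar) = 4
  K.\<close>

declare One_nat_def [simp del]

text \<open>With a square factor the intermediate dimension is determined, so these carrier
  conditions can be discharged by rewriting.\<close>

lemma square_mat_simps [simp]: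
  fixes A B :: "'a::semiring_1 mat"
  assumes "A \<in> carrier_mat d d"
  shows "B \<in> carrier_mat d b \<Longrightarrow> A * B \<in> carrier_mat d b" "B \<in> carrier_mat b d \<Longrightarrow> B * A \<in> carrier_mat b d"
    "1\<^sub>m d * A = A" "A * 1\<^sub>m d = A" "0\<^sub>m b d * A = 0\<^sub>m b d" "A * 0\<^sub>m d b = 0\<^sub>m d b"
  using assms by auto

lemmas square_mult_carrier = square_mat_simps(1)

section \<open>An overring of the matrix rings\<close>

text \<open>Additive self-maps of an abelian group form a ring, which is all the computations ask
  for. Complex scalars enter later as images of scalar matrices.\<close>

typedef endo = "{f :: (nat \<Rightarrow> complex) \<Rightarrow> nat \<Rightarrow> complex.
    \<forall>v w. f (\<lambda>i. v i + w i) = (\<lambda>i. f v i + f w i)}"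
  morphisms endo_apply Endo
  by (rule exI[of _ "\<lambda>v. v"]) simp

setup_lifting type_definition_endo

instantiation endo :: ring_1
begin

lift_definition zero_endo :: endo is "\<lambda>v i. 0" by simp
lift_definition one_endo :: endo is "\<lambda>v. v" by simp
lift_definition plus_endo :: "endo \<Rightarrow> endo \<Rightarrow> endo" is "\<lambda>f g v i. f v i + g v i"
  by (simp add: fun_eq_iff algebra_simps)
lift_definition uminus_endo :: "endo \<Rightarrow> endo" is "\<lambda>f v i. - f v i"
  by (simp add: fun_eq_iff)
lift_definition minus_endo :: "endo \<Rightarrow> endo \<Rightarrow> endo" is "\<lambda>f g v i. f v i - g v i"
  by (simp add: fun_eq_iff algebra_simps)
lift_definition times_endo :: "endo \<Rightarrow> endo \<Rightarrow> endo" is "\<lambda>f g v. f (g v)"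
  by simp

instance
proof
  show "(0::endo) \<noteq> 1"
    by transfer (auto simp: fun_eq_iff intro!: exI[of _ "\<lambda>_. 1"])
qed (transfer; simp add: fun_eq_iff algebra_simps)+

end

text \<open>A matrix acts as \<open>A \<otimes> 1\<close> on \<open>\<complex>\<^sup>d \<otimes> \<complex>\<^sup>\<infinity>\<close>; for \<open>d > 0\<close> this is a unital embedding. It moves
  identities between square matrices of any size into one type of class \<open>ring_1\<close>, where
  noncommutative rewriting needs no side conditions on dimensions.\<close>

lift_definition emb :: "nat \<Rightarrow> complex mat \<Rightarrow> endo" is
  "\<lambda>d A v i. \<Sum>j<d. A $$ (i mod d, j) * v (i div d * d + j)"
  by (simp add: algebra_simps sum.distrib)

locale matrix_hom =
  fixes d :: nat and \<psi> :: "complex mat \<Rightarrow> endo"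
  assumes hom_add: "A \<in> carrier_mat d d \<Longrightarrow> B \<in> carrier_mat d d \<Longrightarrow> \<psi> (A + B) = \<psi> A + \<psi> B"
    and hom_mult: "A \<in> carrier_mat d d \<Longrightarrow> B \<in> carrier_mat d d \<Longrightarrow> \<psi> (A * B) = \<psi> A * \<psi> B"
    and hom_one: "\<psi> (1\<^sub>m d) = 1"

lemma emb_hom:
  assumes "d > 0"
  shows "matrix_hom d (emb d)"
proof
  fix A B :: "complex mat" assume A: "A \<in> carrier_mat d d" and B: "B \<in> carrier_mat d d"
  show "emb d (A + B) = emb d A + emb d B"
    using A B assms by transfer (auto simp: fun_eq_iff algebra_simps sum.distrib)
  show "emb d (A * B) = emb d A * emb d B"
    using A B assms
  proof (transfer, intro ext)
    fix d and A B :: "complex mat" and v :: "nat \<Rightarrow> complex" and i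
    assume A: "A \<in> carrier_mat d d" and B: "B \<in> carrier_mat d d" and d: "0 < (d::nat)"
    have "(\<Sum>k<d. (A * B) $$ (i mod d, k) * v (i div d * d + k)) =
      (\<Sum>k<d. \<Sum>j<d. A $$ (i mod d, j) * B $$ (j, k) * v (i div d * d + k))"
      using A B d by (auto simp: scalar_prod_def sum_distrib_right atLeast0LessThan intro!: sum.cong)
    also have "\<dots> = (\<Sum>j<d. \<Sum>k<d. A $$ (i mod d, j) * B $$ (j, k) * v (i div d * d + k))"
      by (rule sum.swap)
    also have "\<dots> = (\<Sum>j<d. A $$ (i mod d, j) *
        (\<Sum>k<d. B $$ ((i div d * d + j) mod d, k) * v ((i div d * d + j) div d * d + k)))"
      using d by (auto simp: sum_distrib_left mult.assoc intro!: sum.cong)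
    finally show "(\<Sum>k<d. (A * B) $$ (i mod d, k) * v (i div d * d + k)) =
      (\<Sum>j<d. A $$ (i mod d, j) *
        (\<Sum>k<d. B $$ ((i div d * d + j) mod d, k) * v ((i div d * d + j) div d * d + k)))" .
  qed
next
  show "emb d (1\<^sub>m d) = 1"
    using assms
  proof (transfer, intro ext)
    fix d :: nat and v :: "nat \<Rightarrow> complex" and i assume d: "0 < d"
    have "(\<Sum>j<d. 1\<^sub>m d $$ (i mod d, j) * v (i div d * d + j)) =
      (\<Sum>j<d. if i mod d = j then v (i div d * d + j) else 0)"
      using d by (intro sum.cong) auto
    also have "\<dots> = v i" using d by simp
    finally show "(\<Sum>j<d. 1\<^sub>m d $$ (i mod d, j) * v (i div d * d + j)) = v i" .
  qed
qed

text \<open>In dimension 0 all matrices agree, so the hypothesis is restricted to d > 0, where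
  \<open>emb\<close> is a unital homomorphism. Evaluation at the j-th basis vector recovers column
  j.\<close>

lemma emb_inj:
  assumes "A \<in> carrier_mat d d" "B \<in> carrier_mat d d" "d > 0 \<Longrightarrow> emb d A = emb d B"
  shows "A = B"
proof (rule eq_matI)
  fix i j assume "i < dim_row B" "j < dim_col B"
  with assms(2) have ij: "i < d" "j < d" by auto
  have *: "(\<Sum>k<d. M $$ (i mod d, k) * (if i div d * d + k = j then 1 else 0)) = M $$ (i, j)"
    for M :: "complex mat"
    using ij by (simp add: if_distrib cong: if_cong)
  have "endo_apply (emb d A) (\<lambda>k. if k = j then 1 else 0) i =
    endo_apply (emb d B) (\<lambda>k. if k = j then 1 else 0) i"
    using assms(3) ij by simp
  then show "A $$ (i, j) = B $$ (i, j)"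
    unfolding emb.rep_eq * .
qed (use assms in auto)

context matrix_hom
begin

lemma hom_zero: "\<psi> (0\<^sub>m d d) = 0"
  using hom_add[of "0\<^sub>m d d" "0\<^sub>m d d"] by simp

lemma hom_uminus: "A \<in> carrier_mat d d \<Longrightarrow> \<psi> (- A) = - \<psi> A"
  using hom_add[of A "- A"] hom_zero
  by (metis add_eq_0_iff uminus_carrier_iff_mat minus_r_inv_mat add_uminus_minus_mat)

lemma hom_minus: "A \<in> carrier_mat d d \<Longrightarrow> B \<in> carrier_mat d d \<Longrightarrow> \<psi> (A - B) = \<psi> A - \<psi> B"
  using hom_add[of A "- B"] hom_uminus[of B] by (simp add: add_uminus_minus_mat)

text \<open>The target ring carries no complex scaling, so a scalar is represented by the image of a
  scalar matrix, which commutes with the image of every matrix.\<close>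

lemma hom_smult: "A \<in> carrier_mat d d \<Longrightarrow> \<psi> (c \<cdot>\<^sub>m A) = \<psi> (c \<cdot>\<^sub>m 1\<^sub>m d) * \<psi> A"
  by (metis hom_mult left_mult_one_mat mult_smult_assoc_mat one_carrier_mat smult_carrier_mat)

lemma hom_scalar_commutes: "A \<in> carrier_mat d d \<Longrightarrow> \<psi> (c \<cdot>\<^sub>m 1\<^sub>m d) * \<psi> A = \<psi> A * \<psi> (c \<cdot>\<^sub>m 1\<^sub>m d)"
  by (metis hom_mult hom_smult mult_smult_distrib one_carrier_mat right_mult_one_mat smult_carrier_mat)

end


section \<open>The relations in a ring\<close>

text \<open>Given K^2 = Kbar^2 = 1, the relation (K Kbar)^2 = 1 says that K and Kbar commute. All
  relations are written without minus signs, so homomorphisms and transposition carry them over term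
  by term.\<close>

definition dk_rel :: "nat \<Rightarrow> 'a::ring_1 \<Rightarrow> 'a \<Rightarrow> (nat \<Rightarrow> 'a) \<Rightarrow> (nat \<Rightarrow> 'a) \<Rightarrow> bool" where
  "dk_rel n k kb x xb \<longleftrightarrow> k * k = 1 \<and> kb * kb = 1 \<and> kb * k = k * kb \<and>
    (\<forall>i\<in>{1..n}. k * x i + x i * k = 0 \<and> k * xb i + xb i * k = 0 \<and>
      kb * x i + x i * kb = 0 \<and> kb * xb i + xb i * kb = 0 \<and>
      x i * x i = 0 \<and> xb i * xb i = 0 \<and> x i * xb i + xb i * x i + k * kb = 1) \<and>
    (\<forall>i\<in>{1..n}. \<forall>j\<in>{1..n}. x i * x j + x j * x i = 0 \<and> xb i * xb j + xb j * xb i = 0) \<and>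
    (\<forall>i\<in>{1..n}. \<forall>j\<in>{1..n}. i \<noteq> j \<longrightarrow> x i * xb j + xb j * x i = 0)"

definition dk_mat :: "nat \<Rightarrow> nat \<Rightarrow> complex mat \<Rightarrow> complex mat \<Rightarrow> (nat \<Rightarrow> complex mat) \<Rightarrow>
    (nat \<Rightarrow> complex mat) \<Rightarrow> bool" where
  "dk_mat n d k kb x xb \<longleftrightarrow> 
    k \<in> carrier_mat d d \<and> kb \<in> carrier_mat d d \<and>
    (\<forall>i\<in>{1..n}. x i \<in> carrier_mat d d \<and> xb i \<in> carrier_mat d d) \<and>
    k * k = 1\<^sub>m d \<and> kb * kb = 1\<^sub>m d \<and> kb * k = k * kb \<and>
    (\<forall>i\<in>{1..n}. k * x i + x i * k = 0\<^sub>m d d \<and> k * xb i + xb i * k = 0\<^sub>m d d \<and>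
      kb * x i + x i * kb = 0\<^sub>m d d \<and> kb * xb i + xb i * kb = 0\<^sub>m d d \<and>
      x i * x i = 0\<^sub>m d d \<and> xb i * xb i = 0\<^sub>m d d \<and> x i * xb i + xb i * x i + k * kb = 1\<^sub>m d) \<and>
    (\<forall>i\<in>{1..n}. \<forall>j\<in>{1..n}. x i * x j + x j * x i = 0\<^sub>m d d \<and> xb i * xb j + xb j * xb i = 0\<^sub>m d d) \<and>
    (\<forall>i\<in>{1..n}. \<forall>j\<in>{1..n}. i \<noteq> j \<longrightarrow> x i * xb j + xb j * x i = 0\<^sub>m d d)"

lemma (in matrix_hom) dk_mat_imp_rel:
  assumes "dk_mat n d k kb x xb"
  shows "dk_rel n (\<psi> k) (\<psi> kb) (\<lambda>i. \<psi> (x i)) (\<lambda>i. \<psi> (xb i))"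
  using assms unfolding dk_mat_def dk_rel_def
  by (auto simp flip: hom_mult hom_add hom_one hom_zero)

lemma dk_mat_emb:
  assumes "k \<in> carrier_mat d d" "kb \<in> carrier_mat d d"
    and "\<And>i. i \<in> {1..n} \<Longrightarrow> x i \<in> carrier_mat d d \<and> xb i \<in> carrier_mat d d"
    and rel: "d > 0 \<Longrightarrow> dk_rel n (emb d k) (emb d kb) (\<lambda>i. emb d (x i)) (\<lambda>i. emb d (xb i))"
  shows "dk_mat n d k kb x xb"
proof -
  have inj: "A = B" if "d > 0 \<Longrightarrow> emb d A = emb d B" "A \<in> carrier_mat d d" "B \<in> carrier_mat d d"
    for A B
    using emb_inj that by blast
  note h = emb_hom[THEN matrix_hom.hom_mult] emb_hom[THEN matrix_hom.hom_add]
    emb_hom[THEN matrix_hom.hom_one] emb_hom[THEN matrix_hom.hom_zero]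
  show ?thesis
    unfolding dk_mat_def
    apply (intro conjI ballI impI)
    using assms(1-3) apply simp_all
    by ((rule inj, use rel in \<open>simp add: h assms(1-3) dk_rel_def\<close>); use assms(1-3) in simp)+
qed

text \<open>Transposition reverses products, and the list of relations is invariant under reversal
  of all products.\<close>

lemma dk_mat_transpose:
  assumes "dk_mat n d k kb x xb"
  shows "dk_mat n d k\<^sup>T kb\<^sup>T (\<lambda>i. (x i)\<^sup>T) (\<lambda>i. (xb i)\<^sup>T)"
proof -
  have t: "A\<^sup>T * B\<^sup>T = (B * A)\<^sup>T" if "A \<in> carrier_mat d d" "B \<in> carrier_mat d d" for A B :: "complex mat"
    using that by (simp add: transpose_mult)
  have p: "A\<^sup>T + B\<^sup>T = (B + A)\<^sup>T" if "A \<in> carrier_mat d d" "B \<in> carrier_mat d d" for A B :: "complex mat"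
    using that by (simp add: transpose_add comm_add_mat[of B d d])
  show ?thesis
    using assms unfolding dk_mat_def
    by (auto simp: t p simp del: transpose_add transpose_mult)
      (auto simp: p t comm_add_mat[of "k * kb" d d])
qed

text \<open>Completes a rewrite rule for a b so that it also applies inside right-associated
  products.\<close>

lemma mult_left_rewrite:
  fixes a b c z :: "'a::ring_1"
  shows "a * b = c \<Longrightarrow> a * (b * z) = c * z"
  by (simp flip: mult.assoc)

locale dk_ring =
  fixes n :: nat and k kb :: "'a::ring_1" and x xb :: "nat \<Rightarrow> 'a"
  assumes rel: "dk_rel n k kb x xb"
begin

lemma group_rules: "k * k = 1" "kb * kb = 1" "kb * k = k * kb"
  using rel by (auto simp: dk_rel_def)

text \<open>Oriented towards a normal form: group-like elements to the left, k before kb, and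
  \<xi>_i before \<xi>bar_i.\<close>

lemma skew_rules:
  assumes "i \<in> {1..n}"
  shows "x i * k = - (k * x i)" "xb i * k = - (k * xb i)" "x i * kb = - (kb * x i)"
    "xb i * kb = - (kb * xb i)" "x i * x i = 0" "xb i * xb i = 0"
    "xb i * x i = 1 - k * kb - x i * xb i"
proof -
  from rel assms have "x i * xb i + xb i * x i + k * kb = 1"
    by (simp add: dk_rel_def)
  then show "xb i * x i = 1 - k * kb - x i * xb i"
    by (simp add: algebra_simps)
qed (use rel assms in \<open>auto simp: dk_rel_def eq_neg_iff_add_eq_0 add.commute\<close>)

text \<open>Both sides have the same shape up to the sign, so as rewrite rules these are used with
  at least one index fixed.\<close>

lemma anticommute_rules:
  assumes "i \<in> {1..n}" "j \<in> {1..n}"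
  shows "x i * x j = - (x j * x i)" "xb i * xb j = - (xb j * xb i)"
  using rel assms by (auto simp: dk_rel_def eq_neg_iff_add_eq_0)

lemma mixed_rules:
  assumes "i \<in> {1..n}" "j \<in> {1..n}" "i \<noteq> j"
  shows "xb i * x j = - (x j * xb i)"
  using rel assms by (auto simp: dk_rel_def eq_neg_iff_add_eq_0 add.commute)

lemmas group_rules' = group_rules group_rules[THEN mult_left_rewrite]
lemmas skew_rules' = skew_rules skew_rules[THEN mult_left_rewrite]
lemmas mixed_rules' = mixed_rules mixed_rules[THEN mult_left_rewrite]
lemmas anticommute_rules' = anticommute_rules anticommute_rules[THEN mult_left_rewrite]

end

text \<open>Two elementwise commuting copies of the relations model the tensor square: unprimed
  elements stand for a \<otimes> 1, primed ones for 1 \<otimes> a.\<close>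

locale dk_ring_pair = l: dk_ring n k kb x xb + r: dk_ring n k' kb' x' xb'
  for n :: nat and k kb :: "'a::ring_1" and x xb and k' kb' x' xb' +
  assumes commute: "\<And>a b. a \<in> {k, kb} \<union> x ` {1..n} \<union> xb ` {1..n} \<Longrightarrow>
    b \<in> {k', kb'} \<union> x' ` {1..n} \<union> xb' ` {1..n} \<Longrightarrow> b * a = a * b"
begin

lemma commute_rules:
  "k' * k = k * k'" "k' * kb = kb * k'" "kb' * k = k * kb'" "kb' * kb = kb * kb'"
  by (auto intro!: commute)

lemma commute_rules1:
  assumes "i \<in> {1..n}"
  shows "k' * x i = x i * k'" "k' * xb i = xb i * k'" "kb' * x i = x i * kb'" "kb' * xb i = xb i * kb'"
    "x' i * k = k * x' i" "xb' i * k = k * xb' i" "x' i * kb = kb * x' i" "xb' i * kb = kb * xb' i"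
  using assms by (auto intro!: commute)

lemma commute_rules2:
  assumes "i \<in> {1..n}" "j \<in> {1..n}"
  shows "x' i * x j = x j * x' i" "x' i * xb j = xb j * x' i" "xb' i * x j = x j * xb' i"
    "xb' i * xb j = xb j * xb' i"
  using assms by (auto intro!: commute)

lemmas commute_rules' = commute_rules commute_rules[THEN mult_left_rewrite]
  commute_rules1 commute_rules1[THEN mult_left_rewrite]
  commute_rules2 commute_rules2[THEN mult_left_rewrite]

lemmas rules = l.group_rules' r.group_rules' l.skew_rules' r.skew_rules' commute_rules'
  l.mixed_rules' r.mixed_rules'

text \<open>The elements are \<Delta> of the generators, so \<Delta> respects the relations. Cross
  terms cancel because group-likes anticommute with \<xi>_j and \<xi>bar_j; for \<xi>_i and
  \<xi>bar_i the rest is k kb (1 - k' kb') + (1 - k kb), which telescopes.\<close>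

lemma coproduct_rel:
  "dk_rel n (k * k') (kb * kb') (\<lambda>i. k * x' i + x i) (\<lambda>i. kb * xb' i + xb i)"
proof -
  have 1: "(k * x' i + x i) * (k * x' j + x j) + (k * x' j + x j) * (k * x' i + x i) = 0"
    "(kb * xb' i + xb i) * (kb * xb' j + xb j) + (kb * xb' j + xb j) * (kb * xb' i + xb i) = 0"
    if "i \<in> {1..n}" "j \<in> {1..n}" for i j
    using that l.anticommute_rules[OF that(2,1)] r.anticommute_rules[OF that(2,1)]
    by (simp_all add: algebra_simps rules)
  show ?thesis
    unfolding dk_rel_def
    by (intro conjI ballI impI; (rule 1; assumption)?) (simp_all add: algebra_simps rules)
qed

end

section \<open>Ordered products over the indices and words indexed by subsets\<close>

fun iprod :: "(nat \<Rightarrow> 'a::ring_1) \<Rightarrow> nat \<Rightarrow> 'a" where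
  "iprod f 0 = 1"
| "iprod f (Suc m) = iprod f m * (1 + f (Suc m))"

lemma iprod_commute:
  assumes "\<And>i. i \<in> {1..m} \<Longrightarrow> f i * y = y * f i"
  shows "iprod f m * y = y * iprod f m"
  using assms
proof (induction m)
  case (Suc m)
  have "iprod f (Suc m) * y = iprod f m * (y + f (Suc m) * y)"
    by (simp add: algebra_simps)
  also have "\<dots> = iprod f m * y * (1 + f (Suc m))"
    using Suc.prems[of "Suc m"] by (simp add: algebra_simps)
  also have "\<dots> = y * iprod f (Suc m)"
    using Suc by (simp add: algebra_simps)
  finally show ?case .
qed simp

text \<open>All factors but the j-th commute with y and z, so y becomes z exactly when it passes the
  j-th factor.\<close>

lemma iprod_intertwine:
  assumes "\<And>i. i \<in> {1..m} \<Longrightarrow> i \<noteq> j \<Longrightarrow> f i * y = y * f i \<and> f i * z = z * f i"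
    and "(1 + f j) * y = z * (1 + f j)" and "j \<in> {1..m}"
  shows "iprod f m * y = z * iprod f m"
  using assms(1,3)
proof (induction m)
  case (Suc m)
  show ?case
  proof (cases "j = Suc m")
    case True
    have "iprod f m * z = z * iprod f m"
      using Suc.prems True by (intro iprod_commute) auto
    then show ?thesis
      using assms(2) True by (simp add: mult.assoc) (simp flip: mult.assoc)
  next
    case False
    then have IH: "iprod f m * y = z * iprod f m"
      using Suc by auto
    have "f (Suc m) * y = y * f (Suc m)"
      using Suc.prems(1)[of "Suc m"] False by auto
    then have "iprod f (Suc m) * y = iprod f m * y * (1 + f (Suc m))"
      by (simp add: algebra_simps)
    then show ?thesis using IH by (simp add: mult.assoc)
  qed
qed simp

definition wd :: "(nat \<Rightarrow> 'a::ring_1) \<Rightarrow> nat set \<Rightarrow> 'a" where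
  "wd f A = prod_list (map f (sorted_list_of_set A))"

lemma wd_empty [simp]: "wd f {} = 1"
  by (simp add: wd_def)

lemma wd_insert:
  assumes "A \<subseteq> {1..m}"
  shows "wd f (insert (Suc m) A) = wd f A * f (Suc m)"
proof -
  have "finite A" using assms finite_subset by blast
  have "Suc m \<notin> A" "\<forall>i\<in>A. i \<le> Suc m" using assms by auto
  then have "sorted_list_of_set (insert (Suc m) A) = sorted_list_of_set A @ [Suc m]"
    using \<open>finite A\<close> by (simp add: sorted_insort_is_snoc)
  then show ?thesis by (simp add: wd_def)
qed

lemma wd_skew:
  assumes "finite A" "\<And>i. i \<in> A \<Longrightarrow> y * f i = - (f i * y)"
  shows "y * wd f A = (-1) ^ card A * wd f A * y"
proof -
  have "y * prod_list (map f l) = (-1) ^ length l * prod_list (map f l) * y"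
    if "\<And>i. i \<in> set l \<Longrightarrow> y * f i = - (f i * y)" for l
    using that
  proof (induction l)
    case (Cons a l)
    have "y * (f a * P) = - (f a * (y * P))" for P
      using Cons.prems[of a] by (simp flip: mult.assoc)
    moreover have "f a * ((-1) ^ length l * Q) = (-1) ^ length l * (f a * Q)" for Q
      by (cases "even (length l)") auto
    ultimately show ?case
      using Cons by (simp add: mult.assoc)
  qed simp
  from this[of "sorted_list_of_set A"] show ?thesis
    using assms by (simp add: wd_def)
qed

lemma sum_Pow_Suc:
  fixes g :: "nat set \<Rightarrow> 'b::comm_monoid_add"
  shows "(\<Sum>A\<in>Pow {1..Suc m}. g A) = (\<Sum>A\<in>Pow {1..m}. g A) + (\<Sum>A\<in>Pow {1..m}. g (insert (Suc m) A))"
proof -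
  have "Pow {1..Suc m} = Pow {1..m} \<union> insert (Suc m) ` Pow {1..m}"
    by (simp add: atLeastAtMostSuc_conv Pow_insert)
  moreover have "inj_on (insert (Suc m)) (Pow {1..m})"
    by (rule inj_onI) (auto simp: set_eq_iff subset_iff; metis Suc_n_not_le_n)
  moreover have "Pow {1..m} \<inter> insert (Suc m) ` Pow {1..m} = {}"
    by auto
  ultimately show ?thesis
    by (simp add: sum.union_disjoint sum.reindex)
qed

section \<open>The R-matrix in two commuting copies\<close>

context dk_ring_pair
begin

text \<open>Twice the group-like factor of R, since a general ring has no 1/2.\<close>

definition cartan :: 'a where
  "cartan = 1 + k + kb' - k * kb'"

definition rprod :: "nat \<Rightarrow> 'a" where
  "rprod = iprod (\<lambda>i. x i * (xb' i * kb'))"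

text \<open>Appending the index m + 1 to a word A moves \<xi>bar_(m+1) past Kbar^|A|, which costs
  (-1)^|A|. This is the ratio of the signs prescribed for |A| + 1 and |A|, so the sum over words
  factors into one factor per index.\<close>

lemma rprod_sum:
  assumes "m \<le> n"
  shows "(\<Sum>A\<in>Pow {1..m}. (-1) ^ (card A div 2) * (wd x A * (wd xb' A * kb' ^ card A))) = rprod m"
  using assms
proof (induction m)
  case 0
  show ?case by (simp add: rprod_def)
next
  case (Suc m)
  have "(-1) ^ (card (insert (Suc m) A) div 2) *
      (wd x (insert (Suc m) A) * (wd xb' (insert (Suc m) A) * kb' ^ card (insert (Suc m) A))) =
      (-1) ^ (card A div 2) * (wd x A * (wd xb' A * kb' ^ card A)) * (x (Suc m) * (xb' (Suc m) * kb'))"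
    if "A \<in> Pow {1..m}" for A
  proof -
    have A: "A \<subseteq> {1..m}" "finite A" using that finite_subset by auto
    then have c: "card (insert (Suc m) A) = Suc (card A)" by (auto simp: card_insert_if)
    have m: "Suc m \<in> {1..n}" using Suc.prems by auto
    have 1: "wd xb' A * x (Suc m) = x (Suc m) * wd xb' A"
    proof -
      have *: "prod_list (map xb' l) * x (Suc m) = x (Suc m) * prod_list (map xb' l)" if "set l \<subseteq> {1..n}" for l
        using that m
        by (induction l) (auto simp: mult.assoc commute_rules')
      from *[of "sorted_list_of_set A"] order_trans[OF A(1), of "{1..n}"] show ?thesis
        using A(2) Suc.prems by (auto simp: wd_def)
    qed
    have 2: "kb' ^ c * x (Suc m) = x (Suc m) * kb' ^ c" for c
      using m by (induction c) (auto simp: mult.assoc commute_rules')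
    have 3: "kb' ^ c * xb' (Suc m) = (-1) ^ c * (xb' (Suc m) * kb' ^ c)" for c
    proof (induction c)
      case (Suc c)
      have "kb' ^ Suc c * xb' (Suc m) = kb' * (kb' ^ c * xb' (Suc m))" by (simp add: mult.assoc)
      also have "\<dots> = (-1) ^ c * (kb' * xb' (Suc m) * kb' ^ c)"
        unfolding Suc by (cases "even c") (auto simp: mult.assoc)
      also have "kb' * xb' (Suc m) = - (xb' (Suc m) * kb')"
        using r.skew_rules(4)[OF m] by simp
      finally show ?case by (simp add: mult.assoc)
    qed simp
    from 1 2 3 have "wd x A * (wd xb' A * kb' ^ card A) * (x (Suc m) * (xb' (Suc m) * kb')) =
      (-1) ^ card A * (wd x A * x (Suc m) * (wd xb' A * xb' (Suc m) * kb' ^ Suc (card A)))"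
      by (cases "even (card A)") (auto simp: mult.assoc power_commutes mult_left_rewrite[OF 1] mult_left_rewrite[OF 2]
          mult_left_rewrite[OF 3])
    moreover have "(-1) ^ (Suc (card A) div 2) = (-1) ^ (card A div 2) * ((-1) ^ card A :: 'a)"
      by (cases "even (card A)") (auto elim!: evenE oddE)
    ultimately show ?thesis
      unfolding c wd_insert[OF A(1)] by (simp only: mult.assoc)
  qed
  then have "(\<Sum>A\<in>Pow {1..Suc m}. (-1) ^ (card A div 2) * (wd x A * (wd xb' A * kb' ^ card A))) =
      rprod m + rprod m * (x (Suc m) * (xb' (Suc m) * kb'))"
    using Suc by (simp add: sum_Pow_Suc flip: sum_distrib_right)
  then show ?case
    by (simp add: rprod_def algebra_simps)
qed

text \<open>The element x'_j + x_j kb' is what the Cartan factor makes of \<Delta>(\<xi>_j). The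
  ordered product turns it into the opposite coproduct, which completes the passage of
  \<Delta>(\<xi>_j) through R.\<close>

lemma rprod_intertwine_x:
  assumes "j \<in> {1..n}"
  shows "rprod n * (x' j + x j * kb') = (x j * k' + x' j) * rprod n"
  unfolding rprod_def
proof (rule iprod_intertwine)
  \<comment> \<open>The quadratic terms differ by -x_j (x'_j xb'_j + xb'_j x'_j) kb' = x_j k' - x_j
    kb', which compensates the difference of the linear terms; terms containing x_j twice
    vanish.\<close>
  show "(1 + x j * (xb' j * kb')) * (x' j + x j * kb') = (x j * k' + x' j) * (1 + x j * (xb' j * kb'))"
    using assms by (simp add: algebra_simps rules)
  show "x i * (xb' i * kb') * (x' j + x j * kb') = (x' j + x j * kb') * (x i * (xb' i * kb')) \<and>
      x i * (xb' i * kb') * (x j * k' + x' j) = (x j * k' + x' j) * (x i * (xb' i * kb'))"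
    if "i \<in> {1..n}" "i \<noteq> j" for i
    using assms that
    by (simp add: algebra_simps rules l.anticommute_rules'[of i j] r.mixed_rules'[of i j])
qed (rule assms)

lemma rprod_intertwine_xb:
  assumes "j \<in> {1..n}"
  shows "rprod n * (k * kb * xb' j + xb j * kb') = (xb j * kb' + xb' j) * rprod n"
  unfolding rprod_def
proof (rule iprod_intertwine)
  show "(1 + x j * (xb' j * kb')) * (k * kb * xb' j + xb j * kb') =
      (xb j * kb' + xb' j) * (1 + x j * (xb' j * kb'))"
    using assms by (simp add: algebra_simps rules)
  show "x i * (xb' i * kb') * (k * kb * xb' j + xb j * kb') =
      (k * kb * xb' j + xb j * kb') * (x i * (xb' i * kb')) \<and>
      x i * (xb' i * kb') * (xb j * kb' + xb' j) = (xb j * kb' + xb' j) * (x i * (xb' i * kb'))"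
    if "i \<in> {1..n}" "i \<noteq> j" for i
    using assms that
    by (simp add: algebra_simps rules l.mixed_rules'[of j i] r.anticommute_rules'[of i j])
qed (rule assms)

lemma rprod_commute_group:
  "rprod n * (k * k') = k * k' * rprod n" "rprod n * (kb * kb') = kb * kb' * rprod n"
  unfolding rprod_def by (rule iprod_commute; simp add: rules mult.assoc)+

text \<open>On joint eigenvectors with k = (-1)^a and kb' = (-1)^b the element \<open>cartan\<close>
  is 2 (-1)^(a b). Hence moving it past an element that anticommutes with k alone yields a factor
  kb', and past one that anticommutes with kb' alone a factor k.\<close>

lemma cartan_intertwine:
  assumes "j \<in> {1..n}"
  shows "cartan * (k * x' j + x j) = (x' j + x j * kb') * cartan"
    and "cartan * (kb * xb' j + xb j) = (k * kb * xb' j + xb j * kb') * cartan"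
  using assms by (simp_all add: cartan_def algebra_simps rules)

lemma cartan_commute_group: "cartan * (k * k') = k * k' * cartan" "cartan * (kb * kb') = kb * kb' * cartan"
  by (simp_all add: cartan_def algebra_simps rules)

text \<open>This is R \<Delta>(h) = \<Delta>op(h) R on generators, up to the factor 1/2; it makes
  the braiding a module morphism.\<close>

lemma R_intertwine:
  "rprod n * cartan * (k * k') = k' * k * (rprod n * cartan)"
  "rprod n * cartan * (kb * kb') = kb' * kb * (rprod n * cartan)"
  "j \<in> {1..n} \<Longrightarrow> rprod n * cartan * (k * x' j + x j) = (k' * x j + x' j) * (rprod n * cartan)"
  "j \<in> {1..n} \<Longrightarrow> rprod n * cartan * (kb * xb' j + xb j) = (kb' * xb j + xb' j) * (rprod n * cartan)"
proof -
  have *: "r * c * y = w * (r * c)" if "c * y = z * c" "r * z = w * r" for r c y z w :: 'a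
    using that by (metis mult.assoc)
  show "rprod n * cartan * (k * k') = k' * k * (rprod n * cartan)"
    "rprod n * cartan * (kb * kb') = kb' * kb * (rprod n * cartan)"
    using *[OF cartan_commute_group(1) rprod_commute_group(1)] 
      *[OF cartan_commute_group(2) rprod_commute_group(2)] by (simp_all add: commute_rules)
  show "rprod n * cartan * (k * x' j + x j) = (k' * x j + x' j) * (rprod n * cartan)"
    "rprod n * cartan * (kb * xb' j + xb j) = (kb' * xb j + xb' j) * (rprod n * cartan)"
    if j: "j \<in> {1..n}"
    using *[OF cartan_intertwine(1)[OF j] rprod_intertwine_x[OF j]]
      *[OF cartan_intertwine(2)[OF j] rprod_intertwine_xb[OF j]] j
    by (simp_all add: commute_rules1)
qed

end

section \<open>The ribbon element, the Drinfeld element and their product\<close>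

context dk_ring
begin

definition twist_cartan :: 'a where
  "twist_cartan = 1 + k - kb + k * kb"

definition twist_prod :: "nat \<Rightarrow> 'a" where
  "twist_prod = iprod (\<lambda>i. - (x i * xb i))"

definition drinfeld_prod :: "nat \<Rightarrow> 'a" where
  "drinfeld_prod = iprod (\<lambda>i. - (xb i * x i))"

text \<open>As for R, the sign pattern is absorbed by reordering: moving \<xi>_(m+1) past the barred
  word of A costs (-1)^|A|.\<close>

lemma twist_prod_sum:
  assumes "m \<le> n"
  shows "(\<Sum>A\<in>Pow {1..m}. (-1) ^ ((card A + 1) div 2) * (wd x A * wd xb A)) = twist_prod m"
  using assms
proof (induction m)
  case 0
  show ?case by (simp add: twist_prod_def)
next
  case (Suc m)
  have "(-1) ^ ((card (insert (Suc m) A) + 1) div 2) *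
      (wd x (insert (Suc m) A) * wd xb (insert (Suc m) A)) =
      (-1) ^ ((card A + 1) div 2) * (wd x A * wd xb A) * - (x (Suc m) * xb (Suc m))"
    if "A \<in> Pow {1..m}" for A
  proof -
    have A: "A \<subseteq> {1..m}" "finite A" using that finite_subset by auto
    then have c: "card (insert (Suc m) A) = Suc (card A)" by (auto simp: card_insert_if)
    have "x (Suc m) * wd xb A = (-1) ^ card A * wd xb A * x (Suc m)"
      using A Suc.prems by (intro wd_skew) (auto simp: mixed_rules)
    then have "(-1) ^ card A * (x (Suc m) * wd xb A) = wd xb A * x (Suc m)"
      by (cases "even (card A)") auto
    then have "wd x A * wd xb A * - (x (Suc m) * xb (Suc m)) =
      - (wd x A * ((-1) ^ card A * (x (Suc m) * wd xb A)) * xb (Suc m))"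
      by (simp add: mult.assoc)
    also have "\<dots> = - ((-1) ^ card A) * (wd x A * x (Suc m) * (wd xb A * xb (Suc m)))"
      by (cases "even (card A)") (auto simp: mult.assoc)
    finally have "wd x A * wd xb A * - (x (Suc m) * xb (Suc m)) = \<dots>" .
    moreover have "(-1) ^ ((Suc (card A) + 1) div 2) = (-1) ^ ((card A + 1) div 2) * - ((-1) ^ card A :: 'a)"
      by (cases "even (card A)") (auto elim!: evenE oddE)
    ultimately show ?thesis
      unfolding c wd_insert[OF A(1)] by (simp only: mult.assoc)
  qed
  then have "(\<Sum>A\<in>Pow {1..Suc m}. (-1) ^ ((card A + 1) div 2) * (wd x A * wd xb A)) =
      twist_prod m + twist_prod m * - (x (Suc m) * xb (Suc m))"
    using Suc by (simp add: sum_Pow_Suc flip: sum_distrib_right del: mult_minus_right)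
  then show ?case
    by (simp add: twist_prod_def algebra_simps)
qed

lemma twist_prod_commute_group:
  assumes "m \<le> n"
  shows "twist_prod m * k = k * twist_prod m" "twist_prod m * kb = kb * twist_prod m"
  using assms unfolding twist_prod_def by (intro iprod_commute; simp add: skew_rules' mult.assoc)+

lemma drinfeld_prod_commute_group:
  assumes "m \<le> n"
  shows "drinfeld_prod m * k = k * drinfeld_prod m" "drinfeld_prod m * kb = kb * drinfeld_prod m"
  using assms unfolding drinfeld_prod_def
  by (intro iprod_commute; simp add: group_rules' skew_rules' algebra_simps)+

text \<open>From x_j xb_j x_j = x_j (1 - k kb) the j-th factor 1 - x_j xb_j sends x_j to k kb x_j.
  The Cartan part of \<nu> undoes this, because it becomes k kb times itself when the signs of k and
  kb are both reversed; so \<nu> is central.\<close>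

lemma twist_prod_intertwine:
  assumes "j \<in> {1..n}"
  shows "twist_prod n * x j = k * kb * x j * twist_prod n"
    and "twist_prod n * xb j = k * kb * xb j * twist_prod n"
proof -
  note r = group_rules' skew_rules'
  show "twist_prod n * x j = k * kb * x j * twist_prod n"
    unfolding twist_prod_def
    using assms
    by (intro iprod_intertwine[where j = j])
      (simp_all add: algebra_simps r mixed_rules' anticommute_rules'[of _ j])
  show "twist_prod n * xb j = k * kb * xb j * twist_prod n"
    unfolding twist_prod_def
    using assms
    by (intro iprod_intertwine[where j = j])
      (simp_all add: algebra_simps r mixed_rules'[of j] anticommute_rules'[of _ j])
qed

lemma twist_cartan_intertwine:
  assumes "j \<in> {1..n}"
  shows "twist_cartan * (k * kb * x j) = x j * twist_cartan"
    and "twist_cartan * (k * kb * xb j) = xb j * twist_cartan"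
  using assms by (simp_all add: twist_cartan_def algebra_simps group_rules' skew_rules')

lemma twist_central:
  "twist_cartan * twist_prod n * k = k * (twist_cartan * twist_prod n)"
  "twist_cartan * twist_prod n * kb = kb * (twist_cartan * twist_prod n)"
  "j \<in> {1..n} \<Longrightarrow> twist_cartan * twist_prod n * x j = x j * (twist_cartan * twist_prod n)"
  "j \<in> {1..n} \<Longrightarrow> twist_cartan * twist_prod n * xb j = xb j * (twist_cartan * twist_prod n)"
proof -
  have *: "r * c * y = w * (r * c)" if "c * y = z * c" "r * z = w * r" for r c y z w :: 'a
    using that by (metis mult.assoc)
  show "twist_cartan * twist_prod n * k = k * (twist_cartan * twist_prod n)"
    "twist_cartan * twist_prod n * kb = kb * (twist_cartan * twist_prod n)"
    by (rule *[OF twist_prod_commute_group(1)] *[OF twist_prod_commute_group(2)];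
        simp add: twist_cartan_def algebra_simps group_rules')+
  show "twist_cartan * twist_prod n * x j = x j * (twist_cartan * twist_prod n)"
    "twist_cartan * twist_prod n * xb j = xb j * (twist_cartan * twist_prod n)"
    if j: "j \<in> {1..n}"
    using *[OF twist_prod_intertwine(1)[OF j] twist_cartan_intertwine(1)[OF j]]
      *[OF twist_prod_intertwine(2)[OF j] twist_cartan_intertwine(2)[OF j]] .
qed

text \<open>The nested form is the recursion that arises when the R-matrix is closed up one factor
  at a time.\<close>

lemma drinfeld_prod_Suc:
  assumes "Suc m \<le> n"
  shows "drinfeld_prod (Suc m) = drinfeld_prod m - xb (Suc m) * drinfeld_prod m * x (Suc m)"
proof -
  have "drinfeld_prod m * xb (Suc m) = xb (Suc m) * drinfeld_prod m"
    unfolding drinfeld_prod_def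
  proof (rule iprod_commute)
    fix i assume "i \<in> {1..m}"
    then have "i \<in> {1..n}" "Suc m \<in> {1..n}" "Suc m \<noteq> i" using assms by auto
    then show "- (xb i * x i) * xb (Suc m) = xb (Suc m) * - (xb i * x i)"
      by (simp add: algebra_simps skew_rules' group_rules' mixed_rules'[of "Suc m" i]
          anticommute_rules'[of "Suc m" i])
  qed
  from this mult_left_rewrite[OF this] show ?thesis
    by (simp add: drinfeld_prod_def algebra_simps)
qed

text \<open>For one index, (1 - xb_i x_i)(1 - x_i xb_i) = 1 - (x_i xb_i + xb_i x_i) = k kb, because
  x_i^2 = 0. The last Drinfeld factor commutes with the earlier twist factors, so the two ordered
  products can be interleaved.\<close>

lemma drinfeld_twist_prod:
  assumes "m \<le> n"
  shows "drinfeld_prod m * twist_prod m = (k * kb) ^ m"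
  using assms
proof (induction m)
  case (Suc m)
  let ?p = "x (Suc m) * xb (Suc m)" and ?q = "xb (Suc m) * x (Suc m)"
  have m: "Suc m \<in> {1..n}" using Suc.prems by auto
  have "twist_prod m * (1 - ?q) = (1 - ?q) * twist_prod m"
    unfolding twist_prod_def
  proof (rule iprod_commute)
    fix i assume i: "i \<in> {1..m}"
    then have "i \<in> {1..n}" "i \<noteq> Suc m" "Suc m \<noteq> i" using m by auto
    then show "- (x i * xb i) * (1 - ?q) = (1 - ?q) * - (x i * xb i)"
      using m by (simp add: algebra_simps skew_rules' group_rules' mixed_rules'[of i "Suc m"]
          mixed_rules'[of "Suc m" i] anticommute_rules'[of "Suc m" i])
  qed
  then have "drinfeld_prod m * (1 - ?q) * (twist_prod m * (1 - ?p)) =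
      drinfeld_prod m * twist_prod m * ((1 - ?q) * (1 - ?p))"
    by (metis mult.assoc)
  then have "drinfeld_prod (Suc m) * twist_prod (Suc m) =
      drinfeld_prod m * twist_prod m * ((1 - ?q) * (1 - ?p))"
    by (simp add: drinfeld_prod_def twist_prod_def)
  also have "(1 - ?q) * (1 - ?p) = k * kb"
    using m by (simp add: algebra_simps skew_rules' group_rules')
  finally show ?case using Suc by (simp add: power_commutes)
qed (simp add: drinfeld_prod_def twist_prod_def)

text \<open>The first bracket is the closure of the Cartan part of R around the Drinfeld product.
  Both products commute with k and kb and multiply to 1, which leaves (1 + k + kb - k kb)(1 + k - kb
  + k kb) = (1 + k)^2 - (1 - k)^2 = 4 k.\<close>

lemma pivotal:
  assumes "even n"
  shows "(drinfeld_prod n + drinfeld_prod n * k + kb * drinfeld_prod n - kb * drinfeld_prod n * k) *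
    (twist_cartan * twist_prod n) = 4 * k"
proof -
  have c: "drinfeld_prod n * k = k * drinfeld_prod n" "drinfeld_prod n * kb = kb * drinfeld_prod n"
    using drinfeld_prod_commute_group by auto
  have "(k * kb) ^ n = 1"
    using assms by (auto elim!: evenE simp: power_mult power2_eq_square group_rules' mult.assoc)
  then have "drinfeld_prod n * twist_prod n = 1"
    using drinfeld_twist_prod by auto
  note c' = c c[THEN mult_left_rewrite] this this[THEN mult_left_rewrite]
  have "4 * k = k + (k + (k + k))"
    using distrib_right[of 2 2 k] by (simp add: mult_2 add.assoc)
  then show ?thesis
    by (simp add: twist_cartan_def algebra_simps group_rules' c')
qed

end

section \<open>Linear extension of matrix-valued functions\<close>

definition mat_ext :: "nat \<Rightarrow> ('b \<Rightarrow> complex mat) \<Rightarrow> ('b \<Rightarrow>\<^sub>0 complex) \<Rightarrow> complex mat" where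
  "mat_ext d F p = mat d d (\<lambda>(i, j). \<Sum>w\<in>Poly_Mapping.keys p. Poly_Mapping.lookup p w * F w $$ (i, j))"

lemma mat_ext_carrier [simp]: "mat_ext d F p \<in> carrier_mat d d"
  by (simp add: mat_ext_def)

lemma mat_ext_superset:
  assumes "finite T" "Poly_Mapping.keys p \<subseteq> T"
  shows "mat_ext d F p = mat d d (\<lambda>(i, j). \<Sum>w\<in>T. Poly_Mapping.lookup p w * F w $$ (i, j))"
  unfolding mat_ext_def using assms
  by (intro cong_mat refl) (auto intro!: sum.mono_neutral_left simp: in_keys_iff)

lemma mat_ext_add: "mat_ext d F (p + q) = mat_ext d F p + mat_ext d F q"
proof -
  let ?T = "Poly_Mapping.keys p \<union> Poly_Mapping.keys q"
  have "Poly_Mapping.keys (p + q) \<subseteq> ?T" by (rule Poly_Mapping.keys_add)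
  then show ?thesis
    using mat_ext_superset[of ?T "p + q" d F] mat_ext_superset[of ?T p d F] mat_ext_superset[of ?T q d F]
    by (auto simp: lookup_add algebra_simps sum.distrib intro!: eq_matI)
qed

lemma mat_ext_uminus: "mat_ext d F (- p) = - mat_ext d F p"
  by (auto simp: mat_ext_def sum_negf in_keys_iff keys.rep_eq intro!: eq_matI)

lemma mat_ext_diff: "mat_ext d F (p - q) = mat_ext d F p - mat_ext d F q"
  using mat_ext_add[of d F p "- q"] 
  by (simp add: mat_ext_uminus add_uminus_minus_mat[OF mat_ext_carrier mat_ext_carrier])

lemma mat_ext_single:
  assumes "F w \<in> carrier_mat d d"
  shows "mat_ext d F (Poly_Mapping.single w c) = c \<cdot>\<^sub>m F w"
  using assms by (auto simp: mat_ext_def intro!: eq_matI)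

lemma one_smult_mat: "(1::complex) \<cdot>\<^sub>m A = A"
  by (auto intro!: eq_matI)

lemma mat_ext_zero: "mat_ext d F 0 = 0\<^sub>m d d"
  by (auto simp: mat_ext_def)

text \<open>Multiplicativity is asked on \<open>S\<close> only: at generators with an index outside
  {1..n} a module may carry matrices of any shape. On the span of \<open>S\<close>, which is
  \<open>alg\<close>, linear extension is an algebra homomorphism.\<close>

locale mat_rep =
  fixes d :: nat and F :: "'b::monoid_add \<Rightarrow> complex mat" and S :: "'b set"
  assumes S_zero: "0 \<in> S" and S_add: "u \<in> S \<Longrightarrow> v \<in> S \<Longrightarrow> u + v \<in> S"
    and F_carrier: "u \<in> S \<Longrightarrow> F u \<in> carrier_mat d d"
    and F_zero: "F 0 = 1\<^sub>m d"
    and F_add: "u \<in> S \<Longrightarrow> v \<in> S \<Longrightarrow> F (u + v) = F u * F v"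
begin

definition alg :: "('b \<Rightarrow>\<^sub>0 complex) set" where
  "alg = {p. Poly_Mapping.keys p \<subseteq> S}"

lemma alg_add: "p \<in> alg \<Longrightarrow> q \<in> alg \<Longrightarrow> p + q \<in> alg"
  using Poly_Mapping.keys_add[of p q] by (auto simp: alg_def)

lemma alg_uminus: "p \<in> alg \<Longrightarrow> - p \<in> alg"
  by (auto simp: alg_def in_keys_iff)

lemma alg_diff: "p \<in> alg \<Longrightarrow> q \<in> alg \<Longrightarrow> p - q \<in> alg"
  using alg_add[of p "- q"] alg_uminus by simp

lemma alg_mult: "p \<in> alg \<Longrightarrow> q \<in> alg \<Longrightarrow> p * q \<in> alg"
  using keys_mult[of p q] S_add by (fastforce simp: alg_def)

lemma alg_single: "w \<in> S \<Longrightarrow> Poly_Mapping.single w c \<in> alg"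
  by (auto simp: alg_def)

lemma alg_one: "1 \<in> alg"
  using alg_single[OF S_zero, of 1] by simp

lemma alg_zero: "0 \<in> alg"
  by (auto simp: alg_def)

lemma alg_power: "p \<in> alg \<Longrightarrow> p ^ m \<in> alg"
  by (induction m) (auto intro: alg_one alg_mult)

lemma alg_sum: "(\<And>a. a \<in> A \<Longrightarrow> f a \<in> alg) \<Longrightarrow> sum f A \<in> alg"
  by (induction A rule: infinite_finite_induct) (auto intro: alg_zero alg_add)

lemma alg_prod_list: "(\<And>a. a \<in> set l \<Longrightarrow> a \<in> alg) \<Longrightarrow> prod_list l \<in> alg"
  by (induction l) (auto intro: alg_one alg_mult)

lemmas alg_rules = alg_add alg_uminus alg_diff alg_mult alg_single alg_one alg_zero alg_power

lemma ext_one: "mat_ext d F 1 = 1\<^sub>m d"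
proof -
  have "mat_ext d F (Poly_Mapping.single 0 1) = 1 \<cdot>\<^sub>m F 0"
    by (rule mat_ext_single) (simp add: F_zero)
  then show ?thesis by (simp add: F_zero one_smult_mat)
qed

lemma ext_scalar: "mat_ext d F (Poly_Mapping.single 0 c) = c \<cdot>\<^sub>m 1\<^sub>m d"
  by (simp add: mat_ext_single F_zero)

lemma ext_mult:
  assumes p: "p \<in> alg" and q: "q \<in> alg"
  shows "mat_ext d F (p * q) = mat_ext d F p * mat_ext d F q"
proof -
  let ?P = "Poly_Mapping.keys p" and ?Q = "Poly_Mapping.keys q"
  let ?p = "Poly_Mapping.lookup p" and ?q = "Poly_Mapping.lookup q"
  have P: "u \<in> S" if "u \<in> ?P" for u using p that by (auto simp: alg_def)
  have Q: "v \<in> S" if "v \<in> ?Q" for v using q that by (auto simp: alg_def)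
  have dec: "f = (\<Sum>w\<in>Poly_Mapping.keys f. Poly_Mapping.single w (Poly_Mapping.lookup f w))"
    for f :: "'b \<Rightarrow>\<^sub>0 complex"
    by (rule poly_mapping_eqI) (auto simp: lookup_sum lookup_single when_def in_keys_iff)
  have ext_sum: "mat_ext d F (\<Sum>a\<in>A. f a) $$ (i, j) = (\<Sum>a\<in>A. mat_ext d F (f a) $$ (i, j))"
    if "i < d" "j < d" "finite A" for f :: "'c \<Rightarrow> _" and A i j
    using that(3)
  proof (induction A rule: finite_induct)
    case empty
    then show ?case using that by (simp add: mat_ext_zero)
  next
    case (insert a A)
    then show ?case using that mat_ext_carrier[of d F "\<Sum>a\<in>A. f a"] mat_ext_carrier[of d F "f a"]
      by (simp add: mat_ext_add del: mat_ext_carrier)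
  qed
  have "p * q = (\<Sum>u\<in>?P. \<Sum>v\<in>?Q. Poly_Mapping.single (u + v) (?p u * ?q v))"
    by (subst dec[of p], subst dec[of q]) (simp add: sum_product mult_single)
  then have "mat_ext d F (p * q) = mat_ext d F (\<Sum>u\<in>?P. \<Sum>v\<in>?Q. Poly_Mapping.single (u + v) (?p u * ?q v))"
    by simp
  also have "\<dots> = mat_ext d F p * mat_ext d F q"
  proof (rule eq_matI, goal_cases)
    case (1 i j)
    then have ij: "i < d" "j < d" by (auto simp: mat_ext_def)
    have c: "(F u * F v) $$ (i, j) = (\<Sum>k<d. F u $$ (i, k) * F v $$ (k, j))" if "u \<in> ?P" "v \<in> ?Q" for u v
      using F_carrier[OF P[OF that(1)]] F_carrier[OF Q[OF that(2)]] ij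
      by (simp add: scalar_prod_def atLeast0LessThan)
    have single: "mat_ext d F (Poly_Mapping.single (u + v) a) $$ (i, j) =
        a * (\<Sum>k<d. F u $$ (i, k) * F v $$ (k, j))" if "u \<in> ?P" "v \<in> ?Q" for u v a
    proof -
      have "mat_ext d F (Poly_Mapping.single (u + v) a) = a \<cdot>\<^sub>m F (u + v)"
        using that P Q by (intro mat_ext_single F_carrier S_add)
      moreover have "F (u + v) \<in> carrier_mat d d" using that P Q by (intro F_carrier S_add)
      ultimately show ?thesis
        using ij c[OF that] F_add[OF P[OF that(1)] Q[OF that(2)]]
          F_carrier[OF P[OF that(1)]] F_carrier[OF Q[OF that(2)]] by simp
    qed
    have "mat_ext d F (\<Sum>u\<in>?P. \<Sum>v\<in>?Q. Poly_Mapping.single (u + v) (?p u * ?q v)) $$ (i, j) =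
      (\<Sum>u\<in>?P. \<Sum>v\<in>?Q. ?p u * ?q v * (\<Sum>k<d. F u $$ (i, k) * F v $$ (k, j)))"
      using ij by (simp add: ext_sum single)
    also have "\<dots> = (\<Sum>u\<in>?P. \<Sum>v\<in>?Q. \<Sum>k<d. (?p u * F u $$ (i, k)) * (?q v * F v $$ (k, j)))"
      by (simp add: sum_distrib_left algebra_simps)
    also have "\<dots> = (\<Sum>u\<in>?P. \<Sum>k<d. \<Sum>v\<in>?Q. (?p u * F u $$ (i, k)) * (?q v * F v $$ (k, j)))"
      by (intro sum.cong refl sum.swap)
    also have "\<dots> = (\<Sum>k<d. \<Sum>u\<in>?P. \<Sum>v\<in>?Q. (?p u * F u $$ (i, k)) * (?q v * F v $$ (k, j)))"
      by (rule sum.swap)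
    also have "\<dots> = (mat_ext d F p * mat_ext d F q) $$ (i, j)"
      using ij by (simp add: mat_ext_def scalar_prod_def sum_product atLeast0LessThan)
    finally show ?case .
  qed (simp_all add: mat_ext_def)
  finally show ?thesis .
qed

end

locale mat_rep_hom = mat_rep d F S + matrix_hom d \<psi>
  for d :: nat and F :: "'b::monoid_add \<Rightarrow> complex mat" and S :: "'b set" and \<psi>
begin

definition ev :: "('b \<Rightarrow>\<^sub>0 complex) \<Rightarrow> endo" where
  "ev p = \<psi> (mat_ext d F p)"

lemma ev_add: "ev (p + q) = ev p + ev q"
  by (simp add: ev_def mat_ext_add hom_add)

lemma ev_uminus: "ev (- p) = - ev p"
  by (simp add: ev_def mat_ext_uminus hom_uminus)

lemma ev_diff: "ev (p - q) = ev p - ev q"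
  by (simp add: ev_def mat_ext_diff hom_minus)

lemma ev_zero: "ev 0 = 0"
  by (simp add: ev_def mat_ext_zero hom_zero)

lemma ev_one: "ev 1 = 1"
  by (simp add: ev_def ext_one hom_one)

lemma ev_mult: "p \<in> alg \<Longrightarrow> q \<in> alg \<Longrightarrow> ev (p * q) = ev p * ev q"
  by (simp add: ev_def ext_mult hom_mult)

lemma ev_power: "p \<in> alg \<Longrightarrow> ev (p ^ m) = ev p ^ m"
  by (induction m) (simp_all add: ev_one ev_mult alg_power)

lemma ev_sum: "ev (sum f A) = (\<Sum>a\<in>A. ev (f a))"
  by (induction A rule: infinite_finite_induct) (simp_all add: ev_zero ev_add)

lemma ev_prod_list: "(\<And>a. a \<in> set l \<Longrightarrow> a \<in> alg) \<Longrightarrow> ev (prod_list l) = prod_list (map ev l)"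
  by (induction l) (simp_all add: ev_one ev_mult alg_prod_list)

lemma ev_scalar: "ev (Poly_Mapping.single 0 c) = \<psi> (c \<cdot>\<^sub>m 1\<^sub>m d)"
  by (simp add: ev_def ext_scalar)

lemma ev_minus_one_power: "ev ((-1) ^ m * p) = (-1) ^ m * ev p"
  by (cases "even m") (simp_all add: ev_uminus)

lemmas ev_rules = ev_add ev_uminus ev_diff ev_zero ev_one ev_mult ev_power

end


section \<open>Modules\<close>

definition words :: "nat \<Rightarrow> gen_word set" where
  "words n = {w. set (letters w) \<subseteq> gens n}"

lemma act_eq_mat_ext: "act X = mat_ext (rdim X) (word_act X)"
  by (simp add: fun_eq_iff act_def mat_ext_def)

locale carrier_rep =
  fixes n :: nat and X :: mrep
  assumes rgen_carrier: "g \<in> gens n \<Longrightarrow> rgen X g \<in> carrier_mat (rdim X) (rdim X)"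
begin

lemma word_act_carrier: "w \<in> words n \<Longrightarrow> word_act X w \<in> carrier_mat (rdim X) (rdim X)"
proof -
  have "foldr (\<lambda>g M. rgen X g * M) l (1\<^sub>m (rdim X)) \<in> carrier_mat (rdim X) (rdim X)"
    if "set l \<subseteq> gens n" for l
    using that by (induction l) (auto intro: rgen_carrier mult_carrier_mat)
  then show "w \<in> words n \<Longrightarrow> ?thesis" by (simp add: words_def word_act_def)
qed

sublocale act: mat_rep "rdim X" "word_act X" "words n"
proof
  fix u v assume uv: "u \<in> words n" "v \<in> words n"
  show "u + v \<in> words n" using uv by (simp add: words_def plus_gen_word_def)
  show "word_act X u \<in> carrier_mat (rdim X) (rdim X)" using uv word_act_carrier by blast
  have "foldr (\<lambda>g M. rgen X g * M) l (word_act X v) =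
      foldr (\<lambda>g M. rgen X g * M) l (1\<^sub>m (rdim X)) * word_act X v" if "set l \<subseteq> gens n" for l
    using that
  proof (induction l)
    case (Cons g l)
    then have "foldr (\<lambda>g M. rgen X g * M) l (1\<^sub>m (rdim X)) \<in> carrier_mat (rdim X) (rdim X)"
      using word_act_carrier[of "Word l"] by (simp add: words_def word_act_def)
    with Cons show ?case
      using rgen_carrier[of g] word_act_carrier[OF uv(2)] by (simp add: assoc_mult_mat)
  qed (use word_act_carrier[OF uv(2)] in simp)
  then show "word_act X (u + v) = word_act X u * word_act X v"
    using uv by (simp add: words_def word_act_def[of X "u + v"] plus_gen_word_def)
      (simp add: word_act_def)
qed (simp_all add: words_def word_act_def zero_gen_word_def)

lemma gen_alg: "g \<in> gens n \<Longrightarrow> gen g \<in> act.alg"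
  unfolding gen_def by (rule act.alg_single) (simp add: words_def)

lemma act_gen: "g \<in> gens n \<Longrightarrow> act X (gen g) = rgen X g"
  using rgen_carrier[of g]
  by (simp add: gen_def act_eq_mat_ext mat_ext_single words_def word_act_def one_smult_mat)

lemmas act_rules = mat_ext_add[of "rdim X" "word_act X", folded act_eq_mat_ext]
  mat_ext_diff[of "rdim X" "word_act X", folded act_eq_mat_ext]
  mat_ext_uminus[of "rdim X" "word_act X", folded act_eq_mat_ext]
  act.ext_one[folded act_eq_mat_ext] act.ext_mult[folded act_eq_mat_ext] act_gen gen_alg

lemmas act_carrier = mat_ext_carrier[of "rdim X" "word_act X", folded act_eq_mat_ext]

lemma xi_word_alg:
  assumes "A \<subseteq> {1..n}"
  shows "xi_word A \<in> act.alg" "xibar_word A \<in> act.alg"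
  unfolding xi_word_def xibar_word_def using assms finite_subset[OF assms]
  by (auto simp: subset_iff gens_def intro!: act.alg_prod_list gen_alg)

lemma hom_xi_word:
  assumes \<psi>: "matrix_hom (rdim X) \<psi>" and A: "A \<subseteq> {1..n}"
  shows "\<psi> (act X (xi_word A)) = wd (\<lambda>i. \<psi> (rgen X (GXi i))) A"
    and "\<psi> (act X (xibar_word A)) = wd (\<lambda>i. \<psi> (rgen X (GXibar i))) A"
proof -
  interpret matrix_hom "rdim X" \<psi> by (rule \<psi>)
  interpret mat_rep_hom "rdim X" "word_act X" "words n" \<psi> ..
  have fin: "finite A" using finite_subset[OF A] by auto
  have *: "\<psi> (act X (prod_list (map gen l))) = prod_list (map (\<lambda>g. \<psi> (rgen X g)) l)" if l: "set l \<subseteq> gens n" for l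
  proof -
    have "ev (prod_list (map gen l)) = prod_list (map ev (map gen l))"
      by (rule ev_prod_list) (use l gen_alg in auto)
    also have "map ev (map gen l) = map (\<lambda>g. \<psi> (rgen X g)) l"
      using l by (auto simp: ev_def act_gen simp flip: act_eq_mat_ext)
    finally show ?thesis by (simp add: ev_def act_eq_mat_ext)
  qed
  have "GXi ` A \<subseteq> gens n" "GXibar ` A \<subseteq> gens n" using A by (auto simp: gens_def)
  then show "\<psi> (act X (xi_word A)) = wd (\<lambda>i. \<psi> (rgen X (GXi i))) A"
    "\<psi> (act X (xibar_word A)) = wd (\<lambda>i. \<psi> (rgen X (GXibar i))) A"
    using fin *[of "map GXi (sorted_list_of_set A)"] *[of "map GXibar (sorted_list_of_set A)"]
    by (simp_all add: xi_word_def xibar_word_def wd_def comp_def)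
qed

end

lemma gens_simps [simp]: "GK \<in> gens n" "GKbar \<in> gens n" "GXi i \<in> gens n \<longleftrightarrow> i \<in> {1..n}"
  "GXibar i \<in> gens n \<longleftrightarrow> i \<in> {1..n}"
  by (auto simp: gens_def)

abbreviation dk_rep :: "nat \<Rightarrow> mrep \<Rightarrow> bool" where
  "dk_rep n X \<equiv> dk_mat n (rdim X) (rgen X GK) (rgen X GKbar) (\<lambda>i. rgen X (GXi i)) (\<lambda>i. rgen X (GXibar i))"

text \<open>Translates relators acting as zero in the free algebra into equations between the
  generator matrices. Dimension 0 is treated apart, since \<open>emb\<close> is a ring homomorphism
  only in positive dimension; there both sides hold for any matrices of the right shape.\<close>

lemma is_module_iff: "is_module n X \<longleftrightarrow> dk_rep n X"
proof -
  let ?d = "rdim X"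
  have gens: "(\<forall>g\<in>gens n. rgen X g \<in> carrier_mat ?d ?d) \<longleftrightarrow> rgen X GK \<in> carrier_mat ?d ?d \<and>
    rgen X GKbar \<in> carrier_mat ?d ?d \<and>
    (\<forall>i\<in>{1..n}. rgen X (GXi i) \<in> carrier_mat ?d ?d \<and> rgen X (GXibar i) \<in> carrier_mat ?d ?d)"
    unfolding gens_def by blast
  show ?thesis
  proof (cases "carrier_rep n X")
    case False
    then show ?thesis
      using gens unfolding is_module_def dk_mat_def carrier_rep_def by blast
  next
    case True
    then interpret carrier_rep n X .
    show ?thesis
    proof (cases "?d > 0")
      case False
      have "A = 0\<^sub>m ?d ?d" if "A \<in> carrier_mat ?d ?d" for A :: "complex mat"
        using False that by (intro eq_matI) auto
      then have "is_module n X"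
        unfolding is_module_def by (auto intro: rgen_carrier act_carrier)
      moreover have "dk_rep n X"
        using gens rgen_carrier False by (intro dk_mat_emb) auto
      ultimately show ?thesis by simp
    next
      case pos: True
      interpret matrix_hom ?d "emb ?d" by (rule emb_hom[OF pos])
      interpret mat_rep_hom ?d "word_act X" "words n" "emb ?d" ..
      have ev_gen: "ev (gen g) = emb ?d (rgen X g)" if "g \<in> gens n" for g
        using act_gen[OF that] by (simp add: ev_def act_eq_mat_ext)
      have 1: "(\<forall>r\<in>relations n. act X r = 0\<^sub>m ?d ?d) \<longleftrightarrow> (\<forall>r\<in>relations n. ev r = 0)"
        using act_carrier emb_inj hom_zero ev_def by (metis act_eq_mat_ext zero_carrier_mat)
      have group: "(a * b) * (a * b) = 1 \<longleftrightarrow> b * a = a * b" if "a * a = 1" "b * b = 1" for a b :: endo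
      proof
        assume "(a * b) * (a * b) = 1"
        then have "a * ((a * b) * (a * b)) * b = a * 1 * b" by simp
        moreover have "a * ((a * b) * (a * b)) * b = (a * a) * (b * a) * (b * b)" by (simp only: mult.assoc)
        ultimately show "b * a = a * b" using that by simp
      next
        assume "b * a = a * b"
        then have "(a * b) * (a * b) = (a * a) * (b * b)" by (metis mult.assoc)
        then show "(a * b) * (a * b) = 1" using that by simp
      qed
      have 2: "(\<forall>r\<in>relations n. ev r = 0) \<longleftrightarrow>
        dk_rel n (ev K) (ev Kbar) (\<lambda>i. ev (\<xi> i)) (\<lambda>i. ev (\<xi>bar i))" (is "?L \<longleftrightarrow> ?R")
      proof -
        have ball1: "(\<forall>r\<in>{f i |i. P i}. Q r) \<longleftrightarrow> (\<forall>i. P i \<longrightarrow> Q (f i))" for f P Q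
          by blast
        have ball2: "(\<forall>r\<in>{f i j |i j. P i j}. Q r) \<longleftrightarrow> (\<forall>i j. P i j \<longrightarrow> Q (f i j))" for f P Q
          by blast
        note r = ev_rules act.alg_rules gen_alg power2_eq_square
        have "?L \<longleftrightarrow> ?R"
          unfolding relations_def ball_Un ball1 ball2 ball_simps(5,7) dk_rel_def
          using group[of "ev K" "ev Kbar"]
          by (simp add: r Ball_def imp_conjL conj_assoc cong: conj_cong imp_cong) (auto simp: algebra_simps)
        then show ?thesis .
      qed
      have 3: "dk_rel n (ev K) (ev Kbar) (\<lambda>i. ev (\<xi> i)) (\<lambda>i. ev (\<xi>bar i)) \<longleftrightarrow>
        dk_rel n (emb ?d (rgen X GK)) (emb ?d (rgen X GKbar)) (\<lambda>i. emb ?d (rgen X (GXi i)))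
          (\<lambda>i. emb ?d (rgen X (GXibar i)))"
        by (auto simp: dk_rel_def ev_gen)
      have "dk_rel n (ev K) (ev Kbar) (\<lambda>i. ev (\<xi> i)) (\<lambda>i. ev (\<xi>bar i)) \<longleftrightarrow> dk_rep n X"
        unfolding 3 using dk_mat_imp_rel dk_mat_emb rgen_carrier by (auto intro!: dk_mat_emb)
      then show ?thesis
        using rgen_carrier 1 2 unfolding is_module_def by blast
    qed
  qed
qed


section \<open>Kronecker products\<close>

lemma kron_dim [simp]: "dim_row (kron A B) = dim_row A * dim_row B" "dim_col (kron A B) = dim_col A * dim_col B"
  by (simp_all add: kron_def)

lemma kron_carrier [simp]:
  "A \<in> carrier_mat a b \<Longrightarrow> B \<in> carrier_mat c d \<Longrightarrow> kron A B \<in> carrier_mat (a * c) (b * d)"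
  by (simp add: kron_def)

lemma div_mod_less:
  assumes "i < p * (q::nat)"
  shows "i div q < p" "i mod q < q"
proof -
  have "q > 0" using assms by (cases q) auto
  then show "i div q < p" "i mod q < q" using assms by (auto simp: less_mult_imp_div_less)
qed

lemma pair_less: "a < p \<Longrightarrow> b < q \<Longrightarrow> a * q + b < p * (q::nat)"
proof -
  assume "a < p" "b < q"
  then have "a * q + b < Suc a * q" by simp
  also have "\<dots> \<le> p * q" using \<open>a < p\<close> by (intro mult_le_mono1) simp
  finally show ?thesis .
qed

lemma sum_pairs:
  fixes f :: "nat \<Rightarrow> nat \<Rightarrow> 'b::comm_monoid_add"
  shows "(\<Sum>k<p * q. f (k div q) (k mod q)) = (\<Sum>a<p. \<Sum>b<q. f a b)"
proof (cases "q = 0")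
  case False
  have "(\<Sum>k<p * q. f (k div q) (k mod q)) = (\<Sum>(a, b)\<in>{..<p} \<times> {..<q}. f a b)"
    using False
    by (intro sum.reindex_bij_witness[where i = "\<lambda>(a, b). a * q + b" and j = "\<lambda>k. (k div q, k mod q)"])
      (auto simp: div_mod_less pair_less)
  then show ?thesis by (simp add: sum.cartesian_product)
qed simp

lemma kron_index:
  "i < dim_row A * dim_row B \<Longrightarrow> j < dim_col A * dim_col B \<Longrightarrow>
    kron A B $$ (i, j) = A $$ (i div dim_row B, j div dim_col B) * B $$ (i mod dim_row B, j mod dim_col B)"
  by (simp add: kron_def)

lemma kron_mult:
  assumes "A \<in> carrier_mat a b" "B \<in> carrier_mat c d" "A' \<in> carrier_mat b e" "B' \<in> carrier_mat d f"
  shows "kron A B * kron A' B' = kron (A * A') (B * B')"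
proof (rule eq_matI, goal_cases)
  case (1 i j)
  then have ij: "i < a * c" "j < e * f" using assms by auto
  note dm = div_mod_less[OF ij(1)] div_mod_less[OF ij(2)]
  have "(kron A B * kron A' B') $$ (i, j) = (\<Sum>k<b * d. (\<lambda>p q. A $$ (i div c, p) * B $$ (i mod c, q) *
      (A' $$ (p, j div f) * B' $$ (q, j mod f))) (k div d) (k mod d))"
    using assms ij by (auto simp: scalar_prod_def kron_index atLeast0LessThan intro!: sum.cong)
  also have "\<dots> = (\<Sum>p<b. \<Sum>q<d. A $$ (i div c, p) * B $$ (i mod c, q) *
      (A' $$ (p, j div f) * B' $$ (q, j mod f)))"
    by (rule sum_pairs)
  also have "\<dots> = (\<Sum>p<b. A $$ (i div c, p) * A' $$ (p, j div f)) *
      (\<Sum>q<d. B $$ (i mod c, q) * B' $$ (q, j mod f))"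
    by (simp add: sum_product algebra_simps)
  also have "\<dots> = kron (A * A') (B * B') $$ (i, j)"
    using assms ij dm by (auto simp: kron_index scalar_prod_def atLeast0LessThan)
  finally show ?case .
qed (use assms in auto)

lemma kron_add_left: 
  assumes "A \<in> carrier_mat a b" "A' \<in> carrier_mat a b"
  shows "kron (A + A') B = kron A B + kron A' B"
  using assms by (auto simp: kron_def algebra_simps div_mod_less intro!: eq_matI)

lemma kron_add_right: 
  assumes "B \<in> carrier_mat a b" "B' \<in> carrier_mat a b"
  shows "kron A (B + B') = kron A B + kron A B'"
  using assms by (auto simp: kron_def algebra_simps div_mod_less intro!: eq_matI)

lemma kron_smult_left: "kron (c \<cdot>\<^sub>m A) B = c \<cdot>\<^sub>m kron A B"
  by (auto simp: kron_def div_mod_less intro!: eq_matI)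

lemma kron_smult_right: "kron A (c \<cdot>\<^sub>m B) = c \<cdot>\<^sub>m kron A B"
  by (auto simp: kron_def div_mod_less intro!: eq_matI)

lemma kron_zero_left: "kron (0\<^sub>m a b) B = 0\<^sub>m (a * dim_row B) (b * dim_col B)"
  by (auto simp: kron_def div_mod_less intro!: eq_matI)

lemma kron_zero_right: "kron A (0\<^sub>m a b) = 0\<^sub>m (dim_row A * a) (dim_col A * b)"
  by (auto simp: kron_def div_mod_less intro!: eq_matI)

lemma kron_one: "kron (1\<^sub>m a) (1\<^sub>m b) = 1\<^sub>m (a * b)"
proof (rule eq_matI, goal_cases)
  case (1 i j)
  then have "i div b < a" "i mod b < b" "j div b < a" "j mod b < b"
    using div_mod_less by auto
  moreover have "i = j" if "i div b = j div b" "i mod b = j mod b"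
    using that by (metis div_mult_mod_eq)
  ultimately show ?case using 1 by (auto simp: kron_index)
qed auto

lemma flip_dim [simp]: "dim_row (flip_mat p q) = q * p" "dim_col (flip_mat p q) = p * q"
  by (simp_all add: flip_mat_def)

lemma flip_carrier [simp]: "flip_mat p q \<in> carrier_mat (q * p) (p * q)"
  by (simp add: flip_mat_def)

lemma flip_mult_index:
  assumes M: "M \<in> carrier_mat (p * q) m" and "i < q * p" "j < m"
  shows "(flip_mat p q * M) $$ (i, j) = M $$ (i mod p * q + i div p, j)"
proof -
  note dm = div_mod_less[OF assms(2)]
  have "(flip_mat p q * M) $$ (i, j) =
    (\<Sum>k<p * q. (\<lambda>a b. if i div p = b \<and> i mod p = a then M $$ (a * q + b, j) else 0) (k div q) (k mod q))"
    using assms by (auto simp: scalar_prod_def atLeast0LessThan flip_mat_def intro!: sum.cong)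
  also have "\<dots> = (\<Sum>a<p. \<Sum>b<q. if i div p = b \<and> i mod p = a then M $$ (a * q + b, j) else 0)"
    by (rule sum_pairs)
  also have "\<dots> = (\<Sum>a<p. if a = i mod p then (\<Sum>b<q. if b = i div p then M $$ (a * q + b, j) else 0) else 0)"
    by (intro sum.cong refl) (auto intro!: sum.cong sum.neutral)
  also have "\<dots> = M $$ (i mod p * q + i div p, j)"
    using dm by simp
  finally show ?thesis .
qed

lemma mult_flip_index:
  assumes M: "M \<in> carrier_mat m (q * p)" and "i < m" "j < p * q"
  shows "(M * flip_mat p q) $$ (i, j) = M $$ (i, j mod q * p + j div q)"
proof -
  note dm = div_mod_less[OF assms(3)]
  have "(M * flip_mat p q) $$ (i, j) =
    (\<Sum>k<q * p. (\<lambda>b a. if b = j mod q \<and> a = j div q then M $$ (i, b * p + a) else 0) (k div p) (k mod p))"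
    using assms by (auto simp: scalar_prod_def atLeast0LessThan flip_mat_def intro!: sum.cong)
      (metis div_mult_mod_eq)
  also have "\<dots> = (\<Sum>b<q. \<Sum>a<p. if b = j mod q \<and> a = j div q then M $$ (i, b * p + a) else 0)"
    by (rule sum_pairs)
  also have "\<dots> = (\<Sum>b<q. if b = j mod q then (\<Sum>a<p. if a = j div q then M $$ (i, b * p + a) else 0) else 0)"
    by (intro sum.cong refl) (auto intro!: sum.cong sum.neutral)
  also have "\<dots> = M $$ (i, j mod q * p + j div q)"
    using dm by simp
  finally show ?thesis .
qed

lemma flip_kron:
  assumes "A \<in> carrier_mat a b" "B \<in> carrier_mat c d"
  shows "flip_mat a c * kron A B = kron B A * flip_mat b d"
proof (rule eq_matI, goal_cases)
  case (1 i j)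
  then have ij: "i < c * a" "j < b * d" using assms by auto
  note dm = div_mod_less[OF ij(1)] div_mod_less[OF ij(2)]
  have l: "i mod a * c + i div a < a * c" "j mod d * b + j div d < d * b"
    using dm by (auto intro: pair_less)
  have "(flip_mat a c * kron A B) $$ (i, j) = kron A B $$ (i mod a * c + i div a, j)"
    using assms ij by (intro flip_mult_index) auto
  moreover have "(kron B A * flip_mat b d) $$ (i, j) = kron B A $$ (i, j mod d * b + j div d)"
    using assms ij by (intro mult_flip_index) auto
  ultimately show ?case
    using l ij assms dm by (simp add: kron_index)
qed (use assms in auto)


section \<open>The action of the tensor square\<close>

definition word_act2 :: "mrep \<Rightarrow> mrep \<Rightarrow> gen_word \<times> gen_word \<Rightarrow> complex mat" where
  "word_act2 X Y = (\<lambda>(u, v). kron (word_act X u) (word_act Y v))"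

lemma act2_eq_mat_ext: "act2 X Y = mat_ext (rdim X * rdim Y) (word_act2 X Y)"
  by (auto simp: fun_eq_iff act2_def mat_ext_def word_act2_def case_prod_unfold)

locale carrier_rep_pair = l: carrier_rep n X + r: carrier_rep n Y for n X Y
begin

sublocale act2: mat_rep "rdim X * rdim Y" "word_act2 X Y" "words n \<times> words n"
proof
  show "word_act2 X Y 0 = 1\<^sub>m (rdim X * rdim Y)"
    using l.act.F_zero r.act.F_zero by (simp add: word_act2_def zero_prod_def kron_one)
  show "word_act2 X Y (u + v) = word_act2 X Y u * word_act2 X Y v"
    if "u \<in> words n \<times> words n" "v \<in> words n \<times> words n" for u v
    using that
    by (auto simp: word_act2_def plus_prod_def l.act.F_add r.act.F_add
        kron_mult[OF l.word_act_carrier r.word_act_carrier l.word_act_carrier r.word_act_carrier])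
qed (auto simp: word_act2_def zero_prod_def l.act.S_zero r.act.S_zero l.act.S_add r.act.S_add
    l.word_act_carrier r.word_act_carrier)

lemma tens_alg:
  assumes "p \<in> l.act.alg" "q \<in> r.act.alg"
  shows "tens p q \<in> act2.alg"
  unfolding tens_def using assms
  by (intro act2.alg_sum act2.alg_single) (auto simp: l.act.alg_def r.act.alg_def)

lemma act2_tens:
  assumes "p \<in> l.act.alg" "q \<in> r.act.alg"
  shows "act2 X Y (tens p q) = kron (act X p) (act Y q)"
proof (rule eq_matI, goal_cases)
  case (1 i j)
  let ?p = "Poly_Mapping.lookup p" and ?q = "Poly_Mapping.lookup q"
  let ?P = "Poly_Mapping.keys p" and ?Q = "Poly_Mapping.keys q"
  from 1 have ij: "i < rdim X * rdim Y" "j < rdim X * rdim Y" by (auto simp: act_def)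
  note dm = div_mod_less[OF ij(1)] div_mod_less[OF ij(2)]
  have t: "Poly_Mapping.lookup (tens p q) w = ?p (fst w) * ?q (snd w)" for w
  proof -
    have "Poly_Mapping.lookup (tens p q) w =
      (\<Sum>u\<in>?P. if u = fst w then (\<Sum>v\<in>?Q. if v = snd w then ?p u * ?q v else 0) else 0)"
      unfolding tens_def lookup_sum lookup_single when_def
      by (intro sum.cong refl) (auto simp: prod_eq_iff intro!: sum.cong sum.neutral)
    then show ?thesis by (simp add: in_keys_iff)
  qed
  have "act2 X Y (tens p q) $$ (i, j) = (\<Sum>w\<in>?P \<times> ?Q. ?p (fst w) * ?q (snd w) * word_act2 X Y w $$ (i, j))"
    unfolding act2_eq_mat_ext
    by (subst mat_ext_superset[of "?P \<times> ?Q"]) (use ij in \<open>auto simp: t in_keys_iff\<close>)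
  also have "\<dots> = (\<Sum>u\<in>?P. \<Sum>v\<in>?Q. (?p u * word_act X u $$ (i div rdim Y, j div rdim Y)) *
      (?q v * word_act Y v $$ (i mod rdim Y, j mod rdim Y)))"
    unfolding sum.cartesian_product
  proof (intro sum.cong refl, clarify)
    fix u v assume "u \<in> ?P" "v \<in> ?Q"
    then have "word_act X u \<in> carrier_mat (rdim X) (rdim X)" "word_act Y v \<in> carrier_mat (rdim Y) (rdim Y)"
      using assms l.word_act_carrier r.word_act_carrier by (auto simp: l.act.alg_def r.act.alg_def)
    then show "?p (fst (u, v)) * ?q (snd (u, v)) * word_act2 X Y (u, v) $$ (i, j) =
      ?p u * word_act X u $$ (i div rdim Y, j div rdim Y) *
      (?q v * word_act Y v $$ (i mod rdim Y, j mod rdim Y))"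
      using ij by (simp add: word_act2_def kron_index)
  qed
  also have "\<dots> = kron (act X p) (act Y q) $$ (i, j)"
    using ij dm by (simp add: kron_index act_def sum_product)
  finally show ?case .
qed (auto simp: act2_def act_def)

end

section \<open>Dual modules and tensor products of modules\<close>

lemma dk_rep_imp_carrier_rep: "dk_rep n X \<Longrightarrow> carrier_rep n X"
  by unfold_locales (auto simp: dk_mat_def gens_def)

locale dk_module = carrier_rep n X for n X +
  assumes dk_rep: "dk_rep n X"

lemma dk_module_iff: "dk_module n X \<longleftrightarrow> is_module n X"
  using dk_rep_imp_carrier_rep is_module_iff by (auto simp: dk_module_def dk_module_axioms_def)

context carrier_rep
begin

lemma rgen_carriers [simp]:
  "rgen X GK \<in> carrier_mat (rdim X) (rdim X)"
  "rgen X GKbar \<in> carrier_mat (rdim X) (rdim X)"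
  "i \<in> {1..n} \<Longrightarrow> rgen X (GXi i) \<in> carrier_mat (rdim X) (rdim X)"
  "i \<in> {1..n} \<Longrightarrow> rgen X (GXibar i) \<in> carrier_mat (rdim X) (rdim X)"
  by (auto intro: rgen_carrier)

lemma rgen_dual:
  "rgen (dual_mod X) GK = (rgen X GK)\<^sup>T"
  "rgen (dual_mod X) GKbar = (rgen X GKbar)\<^sup>T"
  "i \<in> {1..n} \<Longrightarrow> rgen (dual_mod X) (GXi i) = - ((rgen X (GXi i))\<^sup>T * (rgen X GK)\<^sup>T)"
  "i \<in> {1..n} \<Longrightarrow> rgen (dual_mod X) (GXibar i) = - ((rgen X (GXibar i))\<^sup>T * (rgen X GKbar)\<^sup>T)"
  by (simp_all add: dual_mod_def act_rules act.alg_rules transpose_uminus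
      transpose_mult[of _ "rdim X" "rdim X" _ "rdim X"])

end

lemma dual_dim [simp]: "rdim (dual_mod X) = rdim X"
  by (simp add: dual_mod_def)

lemma tensor_dim [simp]: "rdim (tensor_mod X Y) = rdim X * rdim Y"
  by (simp add: tensor_mod_def)

text \<open>Meant for the ring of transposed matrices, where the action of S(\<xi>_i) = -K \<xi>_i
  reads -(x_i k) in reversed order. Together with the invariance of the relations under
  transposition this yields the dual module.\<close>

lemma (in dk_ring) antipode_rel: "dk_rel n k kb (\<lambda>i. - (x i * k)) (\<lambda>i. - (xb i * kb))"
proof -
  note r = group_rules' skew_rules'
  have 1: "- (x i * k) * - (x j * k) + - (x j * k) * - (x i * k) = 0"
    "- (xb i * kb) * - (xb j * kb) + - (xb j * kb) * - (xb i * kb) = 0"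
    if "i \<in> {1..n}" "j \<in> {1..n}" for i j
    using that anticommute_rules[OF that(2,1)] by (simp_all add: algebra_simps r)
  have 2: "- (x i * k) * - (xb j * kb) + - (xb j * kb) * - (x i * k) = 0"
    if "i \<in> {1..n}" "j \<in> {1..n}" "i \<noteq> j" for i j
    using that mixed_rules[OF that(2,1)] by (simp add: algebra_simps r)
  show ?thesis
    unfolding dk_rel_def
    by (intro conjI ballI impI; (rule 1 2; assumption)?) (simp_all add: algebra_simps r)
qed

context dk_module
begin

lemma dual_module: "dk_module n (dual_mod X)"
proof -
  have "dk_rep n (dual_mod X)"
  proof (rule dk_mat_emb)
    assume d: "0 < rdim (dual_mod X)"
    then interpret matrix_hom "rdim X" "emb (rdim X)" by (simp add: emb_hom)
    interpret dk_ring n "emb (rdim X) (rgen X GK)\<^sup>T" "emb (rdim X) (rgen X GKbar)\<^sup>T"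
      "\<lambda>i. emb (rdim X) (rgen X (GXi i))\<^sup>T" "\<lambda>i. emb (rdim X) (rgen X (GXibar i))\<^sup>T"
      by unfold_locales (rule dk_mat_imp_rel[OF dk_mat_transpose[OF dk_rep]])
    have "emb (rdim X) (rgen (dual_mod X) (GXi i)) =
        - (emb (rdim X) (rgen X (GXi i))\<^sup>T * emb (rdim X) (rgen X GK)\<^sup>T)"
      "emb (rdim X) (rgen (dual_mod X) (GXibar i)) =
        - (emb (rdim X) (rgen X (GXibar i))\<^sup>T * emb (rdim X) (rgen X GKbar)\<^sup>T)"
      if "i \<in> {1..n}" for i
      using that by (simp_all add: rgen_dual hom_uminus hom_mult)
    then show "dk_rel n (emb (rdim (dual_mod X)) (rgen (dual_mod X) GK))
     (emb (rdim (dual_mod X)) (rgen (dual_mod X) GKbar))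
     (\<lambda>i. emb (rdim (dual_mod X)) (rgen (dual_mod X) (GXi i)))
     (\<lambda>i. emb (rdim (dual_mod X)) (rgen (dual_mod X) (GXibar i)))"
      using antipode_rel by (simp add: dk_rel_def rgen_dual)
  qed (auto simp: rgen_dual intro!: square_mult_carrier)
  then show ?thesis
    using dk_rep_imp_carrier_rep by (auto simp: dk_module_def dk_module_axioms_def)
qed

end

locale dk_module_pair = l: dk_module n X + r: dk_module n Y for n X Y
begin

sublocale carrier_rep_pair n X Y ..

lemma act2_add: "act2 X Y (P + Q) = act2 X Y P + act2 X Y Q"
  by (simp add: act2_eq_mat_ext mat_ext_add)

lemma rgen_tensor:
  "rgen (tensor_mod X Y) GK = kron (rgen X GK) (rgen Y GK)"
  "rgen (tensor_mod X Y) GKbar = kron (rgen X GKbar) (rgen Y GKbar)"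
  "i \<in> {1..n} \<Longrightarrow> rgen (tensor_mod X Y) (GXi i) =
    kron (rgen X GK) (rgen Y (GXi i)) + kron (rgen X (GXi i)) (1\<^sub>m (rdim Y))"
  "i \<in> {1..n} \<Longrightarrow> rgen (tensor_mod X Y) (GXibar i) =
    kron (rgen X GKbar) (rgen Y (GXibar i)) + kron (rgen X (GXibar i)) (1\<^sub>m (rdim Y))"
  by (simp_all add: tensor_mod_def act2_tens l.act_rules r.act_rules r.act.alg_rules l.act.alg_rules
      act2_add)

text \<open>The maps A to A \<otimes> 1 and B to 1 \<otimes> B land in one ring and commute there,
  so a pair of modules becomes an instance of \<open>dk_ring_pair\<close>.\<close>

definition emb_left :: "complex mat \<Rightarrow> endo" where
  "emb_left A = emb (rdim X * rdim Y) (kron A (1\<^sub>m (rdim Y)))"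

definition emb_right :: "complex mat \<Rightarrow> endo" where
  "emb_right B = emb (rdim X * rdim Y) (kron (1\<^sub>m (rdim X)) B)"

end

locale pos_dk_module_pair = dk_module_pair +
  assumes pos: "rdim X > 0" "rdim Y > 0"
begin

lemma emb_left_hom: "matrix_hom (rdim X) emb_left"
  and emb_right_hom: "matrix_hom (rdim Y) emb_right"
proof -
  interpret matrix_hom "rdim X * rdim Y" "emb (rdim X * rdim Y)" using pos by (intro emb_hom) simp
  show "matrix_hom (rdim X) emb_left"
  proof
    fix A B :: "complex mat" assume A: "A \<in> carrier_mat (rdim X) (rdim X)" "B \<in> carrier_mat (rdim X) (rdim X)"
    then show "emb_left (A + B) = emb_left A + emb_left B"
      unfolding emb_left_def by (subst hom_add[symmetric]) (simp_all add: kron_add_left[of _ "rdim X" "rdim X"])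
    show "emb_left (A * B) = emb_left A * emb_left B"
      unfolding emb_left_def using A by (subst hom_mult[symmetric])
        (simp_all add: kron_mult[of _ "rdim X" "rdim X" _ "rdim Y" "rdim Y" _ "rdim X" _ "rdim Y"])
  qed (simp add: emb_left_def kron_one hom_one)
  show "matrix_hom (rdim Y) emb_right"
  proof
    fix A B :: "complex mat" assume A: "A \<in> carrier_mat (rdim Y) (rdim Y)" "B \<in> carrier_mat (rdim Y) (rdim Y)"
    then show "emb_right (A + B) = emb_right A + emb_right B"
      unfolding emb_right_def by (subst hom_add[symmetric]) (simp_all add: kron_add_right[of _ "rdim Y" "rdim Y"])
    show "emb_right (A * B) = emb_right A * emb_right B"
      unfolding emb_right_def using A by (subst hom_mult[symmetric])
        (simp_all add: kron_mult[of _ "rdim X" "rdim X" _ "rdim Y" "rdim Y" _ "rdim X" _ "rdim Y"])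
  qed (simp add: emb_right_def kron_one hom_one)
qed

sublocale e: matrix_hom "rdim X * rdim Y" "emb (rdim X * rdim Y)"
  using pos by (intro emb_hom) simp

sublocale el: matrix_hom "rdim X" emb_left by (rule emb_left_hom)
sublocale er: matrix_hom "rdim Y" emb_right by (rule emb_right_hom)

lemma emb_kron:
  assumes "A \<in> carrier_mat (rdim X) (rdim X)" "B \<in> carrier_mat (rdim Y) (rdim Y)"
  shows "emb (rdim X * rdim Y) (kron A B) = emb_left A * emb_right B"
    and "emb (rdim X * rdim Y) (kron A B) = emb_right B * emb_left A"
  using assms
  by (simp_all add: emb_left_def emb_right_def
      kron_mult[of _ "rdim X" "rdim X" _ "rdim Y" "rdim Y" _ "rdim X" _ "rdim Y"] flip: e.hom_mult)

sublocale ring: dk_ring_pair n "emb_left (rgen X GK)" "emb_left (rgen X GKbar)"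
  "\<lambda>i. emb_left (rgen X (GXi i))" "\<lambda>i. emb_left (rgen X (GXibar i))"
  "emb_right (rgen Y GK)" "emb_right (rgen Y GKbar)"
  "\<lambda>i. emb_right (rgen Y (GXi i))" "\<lambda>i. emb_right (rgen Y (GXibar i))"
proof
  show "dk_rel n (emb_left (rgen X GK)) (emb_left (rgen X GKbar))
     (\<lambda>i. emb_left (rgen X (GXi i))) (\<lambda>i. emb_left (rgen X (GXibar i)))"
    by (rule el.dk_mat_imp_rel[OF l.dk_rep])
  show "dk_rel n (emb_right (rgen Y GK)) (emb_right (rgen Y GKbar))
     (\<lambda>i. emb_right (rgen Y (GXi i))) (\<lambda>i. emb_right (rgen Y (GXibar i)))"
    by (rule er.dk_mat_imp_rel[OF r.dk_rep])
  have *: "emb_right B * emb_left A = emb_left A * emb_right B"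
    if "A \<in> carrier_mat (rdim X) (rdim X)" "B \<in> carrier_mat (rdim Y) (rdim Y)" for A B
    using emb_kron[OF that] by simp
  fix a b
  assume "a \<in> {emb_left (rgen X GK), emb_left (rgen X GKbar)} \<union>
      (\<lambda>i. emb_left (rgen X (GXi i))) ` {1..n} \<union> (\<lambda>i. emb_left (rgen X (GXibar i))) ` {1..n}"
    "b \<in> {emb_right (rgen Y GK), emb_right (rgen Y GKbar)} \<union>
      (\<lambda>i. emb_right (rgen Y (GXi i))) ` {1..n} \<union> (\<lambda>i. emb_right (rgen Y (GXibar i))) ` {1..n}"
  then obtain A B where "a = emb_left A" "b = emb_right B"
    "A \<in> carrier_mat (rdim X) (rdim X)" "B \<in> carrier_mat (rdim Y) (rdim Y)"
    using l.rgen_carriers r.rgen_carriers by auto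
  then show "b * a = a * b" using * by simp
qed

lemma emb_tensor:
  "emb (rdim X * rdim Y) (rgen (tensor_mod X Y) GK) = emb_left (rgen X GK) * emb_right (rgen Y GK)"
  "emb (rdim X * rdim Y) (rgen (tensor_mod X Y) GKbar) = emb_left (rgen X GKbar) * emb_right (rgen Y GKbar)"
  "i \<in> {1..n} \<Longrightarrow> emb (rdim X * rdim Y) (rgen (tensor_mod X Y) (GXi i)) =
    emb_left (rgen X GK) * emb_right (rgen Y (GXi i)) + emb_left (rgen X (GXi i))"
  "i \<in> {1..n} \<Longrightarrow> emb (rdim X * rdim Y) (rgen (tensor_mod X Y) (GXibar i)) =
    emb_left (rgen X GKbar) * emb_right (rgen Y (GXibar i)) + emb_left (rgen X (GXibar i))"
  by (simp_all add: rgen_tensor e.hom_add emb_kron(1) er.hom_one)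

end

context dk_module_pair
begin

lemma tensor_module: "dk_module n (tensor_mod X Y)"
proof -
  have "dk_rep n (tensor_mod X Y)"
  proof (rule dk_mat_emb)
    assume "0 < rdim (tensor_mod X Y)"
    then interpret pos_dk_module_pair n X Y by unfold_locales auto
    show "dk_rel n (emb (rdim (tensor_mod X Y)) (rgen (tensor_mod X Y) GK))
     (emb (rdim (tensor_mod X Y)) (rgen (tensor_mod X Y) GKbar))
     (\<lambda>i. emb (rdim (tensor_mod X Y)) (rgen (tensor_mod X Y) (GXi i)))
     (\<lambda>i. emb (rdim (tensor_mod X Y)) (rgen (tensor_mod X Y) (GXibar i)))"
      using ring.coproduct_rel by (simp add: dk_rel_def emb_tensor)
  qed (auto simp: rgen_tensor)
  then show ?thesis
    using dk_rep_imp_carrier_rep by (auto simp: dk_module_def dk_module_axioms_def)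
qed

end


section \<open>The actions of the R-matrix and of the ribbon element\<close>

text \<open>The factorised R-matrix is kept as a matrix too, because closing it up and its
  naturality between modules of different dimensions are statements about matrices, not about one
  fixed ring.\<close>

fun rmat_prod :: "mrep \<Rightarrow> mrep \<Rightarrow> nat \<Rightarrow> complex mat" where
  "rmat_prod X Y 0 = 1\<^sub>m (rdim X * rdim Y)"
| "rmat_prod X Y (Suc m) = rmat_prod X Y m +
    rmat_prod X Y m * kron (rgen X (GXi (Suc m))) (rgen Y (GXibar (Suc m)) * rgen Y GKbar)"

definition rmat_cartan :: "mrep \<Rightarrow> mrep \<Rightarrow> complex mat" where
  "rmat_cartan X Y = kron (1\<^sub>m (rdim X)) (1\<^sub>m (rdim Y)) + kron (rgen X GK) (1\<^sub>m (rdim Y)) +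
    kron (1\<^sub>m (rdim X)) (rgen Y GKbar) - kron (rgen X GK) (rgen Y GKbar)"

context dk_module_pair
begin

lemma rmat_prod_carrier: "m \<le> n \<Longrightarrow> rmat_prod X Y m \<in> carrier_mat (rdim X * rdim Y) (rdim X * rdim Y)"
  by (induction m) (auto intro!: add_carrier_mat square_mult_carrier
      kron_carrier square_mult_carrier)

lemma rmat_cartan_carrier: "rmat_cartan X Y \<in> carrier_mat (rdim X * rdim Y) (rdim X * rdim Y)"
  by (auto simp: rmat_cartan_def intro!: minus_carrier_mat add_carrier_mat kron_carrier)

end

lemma (in pos_dk_module_pair) emb_rmat_prod:
  "m \<le> n \<Longrightarrow> emb (rdim X * rdim Y) (rmat_prod X Y m) = ring.rprod m"
proof (induction m)
  case 0
  show ?case by (simp add: ring.rprod_def e.hom_one)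
next
  case (Suc m)
  have "Suc m \<in> {1..n}" using Suc.prems by auto
  then show ?case
    using Suc rmat_prod_carrier[of m]
    by (simp add: e.hom_add e.hom_mult emb_kron(1)
        er.hom_mult ring.rprod_def algebra_simps)
qed

lemma (in pos_dk_module_pair) emb_rmat_cartan:
  "emb (rdim X * rdim Y) (rmat_cartan X Y) = ring.cartan"
  unfolding rmat_cartan_def ring.cartan_def
  by (simp add: e.hom_add e.hom_minus emb_kron(1) el.hom_one er.hom_one)

text \<open>Both sides are compared in the ring, where the sum over words has already been turned
  into a product; the scalar 1/2 commutes with that product. All later arguments about R start from
  this factorisation.\<close>

lemma (in dk_module_pair) act2_R_matrix:
  "act2 X Y (R_matrix n) = (1 / 2) \<cdot>\<^sub>m (rmat_prod X Y n * rmat_cartan X Y)"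
proof (rule emb_inj)
  assume "rdim X * rdim Y > 0"
  then interpret pos_dk_module_pair n X Y by unfold_locales auto
  interpret mat_rep_hom "rdim X * rdim Y" "word_act2 X Y" "words n \<times> words n" "emb (rdim X * rdim Y)" ..
  let ?s = "emb (rdim X * rdim Y) ((1 / 2) \<cdot>\<^sub>m 1\<^sub>m (rdim X * rdim Y))"
  have ev_tens: "ev (tens p q) = emb_left (act X p) * emb_right (act Y q)"
    if "p \<in> l.act.alg" "q \<in> r.act.alg" for p q
    unfolding ev_def act2_eq_mat_ext[symmetric] act2_tens[OF that]
    by (rule emb_kron(1)) (simp_all add: l.act_carrier r.act_carrier)
  note xi_alg = l.xi_word_alg(1) r.xi_word_alg(2)
  interpret hr: mat_rep_hom "rdim Y" "word_act Y" "words n" emb_right ..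
  note xw = l.hom_xi_word(1)[OF emb_left_hom] r.hom_xi_word(2)[OF emb_right_hom]
  have k: "emb_right (act Y (Kbar ^ c)) = emb_right (rgen Y GKbar) ^ c" for c
    using hr.ev_power[OF r.gen_alg[of GKbar], of c]
    by (simp add: hr.ev_def r.act_gen flip: act_eq_mat_ext)
  have term_alg: "tens (xi_word A) (xibar_word A * Kbar ^ card A) \<in> act2.alg" if "A \<subseteq> {1..n}" for A
    using xi_alg[OF that] by (intro tens_alg) (auto intro!: r.act.alg_rules r.gen_alg)
  have sign_alg: "(-1) ^ c * p \<in> act2.alg" if "p \<in> act2.alg" for c p
    using that by (cases "even c") (auto intro: act2.alg_rules)
  let ?sum = "\<Sum>A\<in>Pow {1..n}. (- 1) ^ (card A div 2) * tens (xi_word A) (xibar_word A * Kbar ^ card A)"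
  have "ev ?sum = (\<Sum>A\<in>Pow {1..n}. (- 1) ^ (card A div 2) * (wd (\<lambda>i. emb_left (rgen X (GXi i))) A *
      (wd (\<lambda>i. emb_right (rgen Y (GXibar i))) A * emb_right (rgen Y GKbar) ^ card A)))"
    unfolding ev_sum
  proof (intro sum.cong refl)
    fix A assume "A \<in> Pow {1..n}"
    then have A: "A \<subseteq> {1..n}" by simp
    have Kalg: "Kbar ^ card A \<in> r.act.alg" by (intro r.act.alg_power r.gen_alg) simp
    have "ev (tens (xi_word A) (xibar_word A * Kbar ^ card A)) =
        emb_left (act X (xi_word A)) * emb_right (act Y (xibar_word A * Kbar ^ card A))"
      using xi_alg[OF A] Kalg by (intro ev_tens r.act.alg_mult)
    also have "act Y (xibar_word A * Kbar ^ card A) = act Y (xibar_word A) * act Y (Kbar ^ card A)"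
      using xi_alg[OF A] Kalg by (simp add: r.act_rules)
    finally show "ev ((- 1) ^ (card A div 2) * tens (xi_word A) (xibar_word A * Kbar ^ card A)) =
        (- 1) ^ (card A div 2) * (wd (\<lambda>i. emb_left (rgen X (GXi i))) A *
      (wd (\<lambda>i. emb_right (rgen Y (GXibar i))) A * emb_right (rgen Y GKbar) ^ card A))"
      by (simp add: ev_minus_one_power er.hom_mult r.act_carrier xw[OF A] k)
  qed
  also have "\<dots> = ring.rprod n" by (rule ring.rprod_sum) simp
  finally have sum: "ev ?sum = ring.rprod n" .
  have cartan: "ev (tens 1 1 + tens K 1 + tens 1 Kbar - tens K Kbar) = ring.cartan"
    by (simp add: ev_rules ev_tens l.act.alg_rules r.act.alg_rules l.gen_alg r.gen_alg l.act_rules r.act_rules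
        el.hom_one er.hom_one ring.cartan_def)
  have "ev (R_matrix n) = ev ?sum * (ev (Poly_Mapping.single 0 (1 / 2)) *
      ev (tens 1 1 + tens K 1 + tens 1 Kbar - tens K Kbar))"
    unfolding R_matrix_def
  proof (subst ev_mult)
    show "?sum \<in> act2.alg"
      by (intro act2.alg_sum sign_alg term_alg) auto
    have "tens 1 1 + tens K 1 + tens 1 Kbar - tens K Kbar \<in> act2.alg"
      by (intro act2.alg_rules tens_alg l.gen_alg r.gen_alg l.act.alg_one r.act.alg_one gens_simps)
    moreover have "Poly_Mapping.single 0 (1 / 2) \<in> act2.alg"
      by (rule act2.alg_single[OF act2.S_zero])
    ultimately show "Poly_Mapping.single 0 (1 / 2) * (tens 1 1 + tens K 1 + tens 1 Kbar - tens K Kbar) \<in> act2.alg"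
      "ev ?sum * ev (Poly_Mapping.single 0 (1 / 2) * (tens 1 1 + tens K 1 + tens 1 Kbar - tens K Kbar)) =
       ev ?sum * (ev (Poly_Mapping.single 0 (1 / 2)) * ev (tens 1 1 + tens K 1 + tens 1 Kbar - tens K Kbar))"
      by (simp_all add: ev_mult act2.alg_mult)
  qed
  also have "\<dots> = ring.rprod n * (?s * ring.cartan)"
    by (simp only: sum cartan ev_scalar)
  also have "\<dots> = ring.rprod n * ?s * ring.cartan" by (simp add: mult.assoc)
  also have "ring.rprod n * ?s = ?s * ring.rprod n"
    using e.hom_scalar_commutes[OF rmat_prod_carrier, of n "1 / 2"] by (simp add: emb_rmat_prod)
  also have "?s * ring.rprod n * ring.cartan = emb (rdim X * rdim Y) ((1 / 2) \<cdot>\<^sub>m (rmat_prod X Y n * rmat_cartan X Y))"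
    using rmat_prod_carrier[of n] rmat_cartan_carrier
    by (subst e.hom_smult) (simp_all add: e.hom_mult emb_rmat_prod emb_rmat_cartan mult.assoc mult_carrier_mat)
  finally show "emb (rdim X * rdim Y) (act2 X Y (R_matrix n)) =
      emb (rdim X * rdim Y) ((1 / 2) \<cdot>\<^sub>m (rmat_prod X Y n * rmat_cartan X Y))"
    by (simp add: ev_def act2_eq_mat_ext)
qed (use rmat_prod_carrier[of n] rmat_cartan_carrier in \<open>auto simp: act2_eq_mat_ext\<close>)

lemma commute_mult:
  fixes a b c :: "'a::semigroup_mult"
  shows "b * c = c * b \<Longrightarrow> a * c = c * a \<Longrightarrow> a * b * c = c * (a * b)"
  by (metis mult.assoc)

locale pos_dk_module = dk_module +
  assumes pos: "rdim X > 0"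
begin

sublocale e: matrix_hom "rdim X" "emb (rdim X)"
  by (rule emb_hom[OF pos])

sublocale ring: dk_ring n "emb (rdim X) (rgen X GK)" "emb (rdim X) (rgen X GKbar)"
  "\<lambda>i. emb (rdim X) (rgen X (GXi i))" "\<lambda>i. emb (rdim X) (rgen X (GXibar i))"
  by unfold_locales (rule e.dk_mat_imp_rel[OF dk_rep])

lemma emb_ribbon_element:
  "emb (rdim X) (act X (ribbon_element n)) =
    emb (rdim X) ((1 / 2) \<cdot>\<^sub>m 1\<^sub>m (rdim X)) * (ring.twist_cartan * ring.twist_prod n)"
proof -
  interpret mat_rep_hom "rdim X" "word_act X" "words n" "emb (rdim X)" ..
  let ?s = "emb (rdim X) ((1 / 2) \<cdot>\<^sub>m 1\<^sub>m (rdim X))"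
  have ev_gen: "ev (gen g) = emb (rdim X) (rgen X g)" if "g \<in> gens n" for g
    using act_gen[OF that] by (simp add: ev_def act_eq_mat_ext)
  have scalar_alg: "Poly_Mapping.single 0 c \<in> act.alg" for c
    by (rule act.alg_single[OF act.S_zero])
  have xw: "ev (xi_word A) = wd (\<lambda>i. emb (rdim X) (rgen X (GXi i))) A"
    "ev (xibar_word A) = wd (\<lambda>i. emb (rdim X) (rgen X (GXibar i))) A" if "A \<subseteq> {1..n}" for A
    using hom_xi_word[OF e.matrix_hom_axioms that] by (simp_all add: ev_def act_eq_mat_ext)
  \<comment> \<open>The ribbon element carries sign and 1/2 in a single coefficient; the resummation
    needs the sign as a ring element.\<close>
  have sign: "emb (rdim X) (((-1) ^ c / 2) \<cdot>\<^sub>m 1\<^sub>m (rdim X)) = ?s * (-1) ^ c" for c :: nat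
  proof (cases "even c")
    case False
    then have "((- 1) ^ c / 2 :: complex) \<cdot>\<^sub>m 1\<^sub>m (rdim X) = - ((1 / 2) \<cdot>\<^sub>m 1\<^sub>m (rdim X))"
      by (auto intro!: eq_matI)
    then show ?thesis using False by (simp only: e.hom_uminus smult_carrier_mat one_carrier_mat) simp
  qed simp
  let ?sum = "\<Sum>A\<in>Pow {1..n}. Poly_Mapping.single 0 ((- 1) ^ ((card A + 1) div 2) / 2) *
    (xi_word A * xibar_word A)"
  have "ev ?sum = (\<Sum>A\<in>Pow {1..n}. ?s * ((- 1) ^ ((card A + 1) div 2) *
     (wd (\<lambda>i. emb (rdim X) (rgen X (GXi i))) A * wd (\<lambda>i. emb (rdim X) (rgen X (GXibar i))) A)))"
    unfolding ev_sum
    by (intro sum.cong refl) (simp add: ev_mult xi_word_alg scalar_alg act.alg_mult ev_scalar sign xw mult.assoc)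
  also have "\<dots> = ?s * ring.twist_prod n"
    by (simp add: ring.twist_prod_sum flip: sum_distrib_left)
  finally have sum: "ev ?sum = ?s * ring.twist_prod n" .
  have sum_alg: "?sum \<in> act.alg"
    by (intro act.alg_sum act.alg_mult scalar_alg xi_word_alg) auto
  have "ev (ribbon_element n) = ring.twist_cartan * (?s * ring.twist_prod n)"
    unfolding ribbon_element_def
    by (subst ev_mult) (use sum_alg in \<open>simp_all add: sum ev_rules act.alg_rules gen_alg ev_gen ring.twist_cartan_def\<close>)
  also have "ring.twist_cartan = emb (rdim X) (1\<^sub>m (rdim X) + rgen X GK - rgen X GKbar + rgen X GK * rgen X GKbar)"
    by (simp add: ring.twist_cartan_def e.hom_add e.hom_minus e.hom_mult e.hom_one
        minus_carrier_mat)
  also have "\<dots> * (?s * ring.twist_prod n) = ?s * (\<dots> * ring.twist_prod n)"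
    using e.hom_scalar_commutes[of "1\<^sub>m (rdim X) + rgen X GK - rgen X GKbar + rgen X GK * rgen X GKbar" "1 / 2"]
    by (simp flip: mult.assoc)
  also have "emb (rdim X) (1\<^sub>m (rdim X) + rgen X GK - rgen X GKbar + rgen X GK * rgen X GKbar) = ring.twist_cartan"
    by (simp add: ring.twist_cartan_def e.hom_add e.hom_minus e.hom_mult e.hom_one
        minus_carrier_mat)
  finally show ?thesis
    by (simp add: ev_def act_eq_mat_ext)
qed

end

lemma gens_cases:
  assumes "g \<in> gens n"
  obtains "g = GK" | "g = GKbar" | i where "i \<in> {1..n}" "g = GXi i" | i where "i \<in> {1..n}" "g = GXibar i"
  using assms by (auto simp: gens_def)

lemma (in dk_module) twist_hom: "act X (ribbon_element n) \<in> module_hom n X X"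
proof -
  have "act X (ribbon_element n) * rgen X g = rgen X g * act X (ribbon_element n)" if g: "g \<in> gens n" for g
  proof (rule emb_inj[of _ "rdim X"])
    assume "rdim X > 0"
    then interpret pos_dk_module n X by unfold_locales
    let ?s = "emb (rdim X) ((1 / 2) \<cdot>\<^sub>m 1\<^sub>m (rdim X))" and ?g = "emb (rdim X) (rgen X g)"
    have "ring.twist_cartan * ring.twist_prod n * ?g = ?g * (ring.twist_cartan * ring.twist_prod n)"
      using g by (cases rule: gens_cases) (simp_all only: ring.twist_central)
    moreover have "?s * ?g = ?g * ?s"
      using e.hom_scalar_commutes[OF rgen_carrier[OF g]] .
    ultimately have "?s * (ring.twist_cartan * ring.twist_prod n) * ?g =
        ?g * (?s * (ring.twist_cartan * ring.twist_prod n))"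
      by (rule commute_mult)
    then show "emb (rdim X) (act X (ribbon_element n) * rgen X g) =
      emb (rdim X) (rgen X g * act X (ribbon_element n))"
      using rgen_carrier[OF g] act_carrier by (simp add: e.hom_mult emb_ribbon_element)
  qed (use rgen_carrier[OF g] act_carrier in \<open>auto intro!: square_mult_carrier\<close>)
  then show ?thesis
    using act_carrier by (auto simp: module_hom_def)
qed

context pos_dk_module_pair
begin

lemma emb_R: "emb (rdim X * rdim Y) (rmat_prod X Y n * rmat_cartan X Y) = ring.rprod n * ring.cartan"
  using rmat_prod_carrier[of n] rmat_cartan_carrier by (simp add: e.hom_mult emb_rmat_prod emb_rmat_cartan)

lemma emb_sum:
  assumes "A \<in> carrier_mat (rdim X) (rdim X)" "B \<in> carrier_mat (rdim Y) (rdim Y)" "C \<in> carrier_mat (rdim Y) (rdim Y)"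
  shows "emb (rdim X * rdim Y) (kron A B + kron (1\<^sub>m (rdim X)) C) = emb_right B * emb_left A + emb_right C"
  using assms by (simp add: e.hom_add emb_kron(2) el.hom_one)

lemmas R_intertwine = ring.R_intertwine

end

lemma (in dk_module_pair) braid_hom:
  "flip_mat (rdim X) (rdim Y) * act2 X Y (R_matrix n) \<in> module_hom n (tensor_mod X Y) (tensor_mod Y X)"
proof -
  interpret s: dk_module_pair n Y X ..
  let ?D = "rdim X * rdim Y" and ?d = "rdim X" and ?e = "rdim Y"
  let ?R = "act2 X Y (R_matrix n)"
  have R: "?R \<in> carrier_mat ?D ?D" by (simp add: act2_eq_mat_ext)
  let ?Q = "rmat_prod X Y n * rmat_cartan X Y"
  have Q: "?Q \<in> carrier_mat ?D ?D"
    using rmat_prod_carrier[of n] rmat_cartan_carrier by (rule mult_carrier_mat) simp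
  have "flip_mat ?d ?e * ?R * rgen (tensor_mod X Y) g = rgen (tensor_mod Y X) g * (flip_mat ?d ?e * ?R)"
    if g: "g \<in> gens n" for g
  proof -
    let ?T = "rgen (tensor_mod X Y) g"
    have T: "?T \<in> carrier_mat ?D ?D" "rgen (tensor_mod Y X) g \<in> carrier_mat (?e * ?d) (?e * ?d)"
      using carrier_rep.rgen_carrier[OF dk_module.axioms(1)[OF tensor_module] g]
        carrier_rep.rgen_carrier[OF dk_module.axioms(1)[OF s.tensor_module] g] by auto
    \<comment> \<open>M is the action of the opposite coproduct of g on X \<otimes> Y. The flip
      carries it to the action of g on Y \<otimes> X, and R carries the action of g on X \<otimes> Y
      to it.\<close>
    obtain M where M: "M \<in> carrier_mat ?D ?D" "rgen (tensor_mod Y X) g * flip_mat ?d ?e = flip_mat ?d ?e * M"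
      "pos_dk_module_pair n X Y \<Longrightarrow> emb ?D ?Q * emb ?D ?T = emb ?D M * emb ?D ?Q"
      using g
    proof (cases rule: gens_cases)
      case 1
      show thesis
        by (rule that[of "kron (rgen X GK) (rgen Y GK)"])
          (simp_all add: 1 s.rgen_tensor flip_kron[of _ ?d ?d _ ?e ?e] pos_dk_module_pair.emb_R
            pos_dk_module_pair.emb_tensor pos_dk_module_pair.emb_kron(2) pos_dk_module_pair.R_intertwine)
    next
      case 2
      show thesis
        by (rule that[of "kron (rgen X GKbar) (rgen Y GKbar)"])
          (simp_all add: 2 s.rgen_tensor flip_kron[of _ ?d ?d _ ?e ?e] pos_dk_module_pair.emb_R
            pos_dk_module_pair.emb_tensor pos_dk_module_pair.emb_kron(2) pos_dk_module_pair.R_intertwine)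
    next
      case (3 i)
      show thesis
        by (rule that[of "kron (rgen X (GXi i)) (rgen Y GK) + kron (1\<^sub>m ?d) (rgen Y (GXi i))"]; use 3(1) in
          \<open>simp add: 3(2) s.rgen_tensor flip_kron[of _ ?d ?d _ ?e ?e] pos_dk_module_pair.emb_R
            add_mult_distrib_mat[of _ "?e * ?d" "?e * ?d" _ _ ?D] mult_add_distrib_mat[of _ "?e * ?d" ?D _ ?D]
            pos_dk_module_pair.emb_tensor pos_dk_module_pair.emb_sum pos_dk_module_pair.R_intertwine\<close>)
    next
      case (4 i)
      show thesis
        by (rule that[of "kron (rgen X (GXibar i)) (rgen Y GKbar) + kron (1\<^sub>m ?d) (rgen Y (GXibar i))"]; use 4(1) in
          \<open>simp add: 4(2) s.rgen_tensor flip_kron[of _ ?d ?d _ ?e ?e] pos_dk_module_pair.emb_R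
            add_mult_distrib_mat[of _ "?e * ?d" "?e * ?d" _ _ ?D] mult_add_distrib_mat[of _ "?e * ?d" ?D _ ?D]
            pos_dk_module_pair.emb_tensor pos_dk_module_pair.emb_sum pos_dk_module_pair.R_intertwine\<close>)
    qed
    have "?Q * ?T = M * ?Q"
    proof (rule emb_inj)
      assume "?D > 0"
      then interpret pos_dk_module_pair n X Y by unfold_locales auto
      show "emb ?D (?Q * ?T) = emb ?D (M * ?Q)"
        using M(3) M(1) Q T pos_dk_module_pair_axioms by (simp add: e.hom_mult)
    qed (use M(1) Q T in \<open>auto intro!: square_mult_carrier\<close>)
    then have M3: "?R * ?T = M * ?R"
      using M(1) Q T unfolding act2_R_matrix
      by (simp add: mult_smult_assoc_mat[of _ ?D ?D _ ?D] mult_smult_distrib[of _ ?D ?D _ ?D])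
    have "flip_mat ?d ?e * ?R * rgen (tensor_mod X Y) g = flip_mat ?d ?e * (M * ?R)"
      using R T M(1) M3 by (simp add: assoc_mult_mat[of _ "?e * ?d" ?D _ ?D _ ?D])
    also have "\<dots> = rgen (tensor_mod Y X) g * flip_mat ?d ?e * ?R"
      unfolding M(2) using R M(1) by (simp add: assoc_mult_mat[of _ "?e * ?d" ?D _ ?D _ ?D])
    also have "\<dots> = rgen (tensor_mod Y X) g * (flip_mat ?d ?e * ?R)"
      using R T by (simp add: assoc_mult_mat[of _ "?e * ?d" "?e * ?d" _ ?D _ ?D])
    finally show ?thesis .
  qed
  then show ?thesis
    using R by (auto simp: module_hom_def intro!: mult_carrier_mat[of _ _ ?D])
qed


section \<open>Traces\<close>

definition mtrace :: "complex mat \<Rightarrow> complex" where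
  "mtrace A = (\<Sum>i<dim_row A. A $$ (i, i))"

lemma mtrace_mult_commute:
  assumes "A \<in> carrier_mat a b" "B \<in> carrier_mat b a"
  shows "mtrace (A * B) = mtrace (B * A)"
proof -
  have "mtrace (A * B) = (\<Sum>i<a. \<Sum>j<b. A $$ (i, j) * B $$ (j, i))"
    using assms by (simp add: mtrace_def scalar_prod_def atLeast0LessThan)
  also have "\<dots> = (\<Sum>j<b. \<Sum>i<a. A $$ (i, j) * B $$ (j, i))" by (rule sum.swap)
  also have "\<dots> = mtrace (B * A)"
    using assms by (simp add: mtrace_def scalar_prod_def atLeast0LessThan mult.commute)
  finally show ?thesis .
qed

lemma mtrace_add: "A \<in> carrier_mat d d \<Longrightarrow> B \<in> carrier_mat d d \<Longrightarrow> mtrace (A + B) = mtrace A + mtrace B"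
  by (simp add: mtrace_def sum.distrib)

lemma mtrace_smult: "A \<in> carrier_mat d d \<Longrightarrow> mtrace (c \<cdot>\<^sub>m A) = c * mtrace A"
  by (simp add: mtrace_def sum_distrib_left)

lemma mult_kron_index:
  assumes "M \<in> carrier_mat m (p * q)" "A \<in> carrier_mat p p'" "B \<in> carrier_mat q q'" "i < m" "j < p' * q'"
  shows "(M * kron A B) $$ (i, j) =
    (\<Sum>a<p. \<Sum>b<q. M $$ (i, a * q + b) * (A $$ (a, j div q') * B $$ (b, j mod q')))"
proof -
  have "(M * kron A B) $$ (i, j) =
    (\<Sum>k<p * q. (\<lambda>a b. M $$ (i, a * q + b) * (A $$ (a, j div q') * B $$ (b, j mod q'))) (k div q) (k mod q))"
    using assms by (auto simp: scalar_prod_def atLeast0LessThan kron_index intro!: sum.cong)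
  also have "\<dots> = (\<Sum>a<p. \<Sum>b<q. M $$ (i, a * q + b) * (A $$ (a, j div q') * B $$ (b, j mod q')))"
    by (rule sum_pairs)
  finally show ?thesis .
qed

lemma kron_mult_index:
  assumes "M \<in> carrier_mat (p * q) m" "A \<in> carrier_mat p' p" "B \<in> carrier_mat q' q" "i < p' * q'" "j < m"
  shows "(kron A B * M) $$ (i, j) =
    (\<Sum>a<p. \<Sum>b<q. A $$ (i div q', a) * B $$ (i mod q', b) * M $$ (a * q + b, j))"
proof -
  have "(kron A B * M) $$ (i, j) =
    (\<Sum>k<p * q. (\<lambda>a b. A $$ (i div q', a) * B $$ (i mod q', b) * M $$ (a * q + b, j)) (k div q) (k mod q))"
    using assms by (auto simp: scalar_prod_def atLeast0LessThan kron_index intro!: sum.cong)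
  also have "\<dots> = (\<Sum>a<p. \<Sum>b<q. A $$ (i div q', a) * B $$ (i mod q', b) * M $$ (a * q + b, j))"
    by (rule sum_pairs)
  finally show ?thesis .
qed

subsection \<open>Closing up an endomorphism of X \<otimes> X*\<close>

text \<open>On \<open>kron A B\<close> this is the transpose of B times A. As b acts on the dual by
  the transpose of S(b), an element a \<otimes> b of the tensor square is sent to S(b) a.\<close>

definition dual_trace :: "nat \<Rightarrow> complex mat \<Rightarrow> complex mat" where
  "dual_trace d M = mat d d (\<lambda>(b, a). \<Sum>p<d. M $$ (p * d + p, a * d + b))"

lemma dual_trace_carrier [simp]: "dual_trace d M \<in> carrier_mat d d"
  by (simp add: dual_trace_def)

lemma dual_trace_dim [simp]: "dim_row (dual_trace d M) = d" "dim_col (dual_trace d M) = d"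
  by (simp_all add: dual_trace_def)

lemma dual_trace_add:
  assumes "M \<in> carrier_mat (d * d) (d * d)" "N \<in> carrier_mat (d * d) (d * d)"
  shows "dual_trace d (M + N) = dual_trace d M + dual_trace d N"
  using assms by (auto simp: dual_trace_def pair_less sum.distrib intro!: eq_matI)

lemma dual_trace_smult:
  assumes "M \<in> carrier_mat (d * d) (d * d)"
  shows "dual_trace d (c \<cdot>\<^sub>m M) = c \<cdot>\<^sub>m dual_trace d M"
  using assms by (auto simp: dual_trace_def pair_less sum_distrib_left intro!: eq_matI)

lemma dual_trace_one: "dual_trace d (1\<^sub>m (d * d)) = 1\<^sub>m d"
proof (rule eq_matI, goal_cases)
  case (1 b a)
  then have "(\<Sum>p<d. 1\<^sub>m (d * d) $$ (p * d + p, a * d + b)) = (\<Sum>p<d. if p = a then (if a = b then 1 else 0) else 0)"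
  proof (intro sum.cong refl)
    fix p assume p: "p \<in> {..<d}"
    have "p = a \<and> p = b" if "p * d + p = a * d + b"
    proof -
      have "(p * d + p) div d = (a * d + b) div d" "(p * d + p) mod d = (a * d + b) mod d" using that by auto
      then show ?thesis using p 1 by auto
    qed
    then show "1\<^sub>m (d * d) $$ (p * d + p, a * d + b) = (if p = a then (if a = b then 1 else 0) else 0)"
      using p 1 by (auto simp: pair_less)
  qed
  then show ?case using 1 by (auto simp: dual_trace_def)
qed (auto simp: dual_trace_def)

text \<open>Each further factor of \<open>rmat_prod\<close> wraps around what has already been
  closed up, one leg on either side.\<close>

lemma dual_trace_mult_kron:
  assumes "M \<in> carrier_mat (d * d) (d * d)" "A \<in> carrier_mat d d" "B \<in> carrier_mat d d"
  shows "dual_trace d (M * kron A B) = B\<^sup>T * dual_trace d M * A"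
proof (rule eq_matI, goal_cases)
  case (1 b a)
  then have ab: "a < d" "b < d" using assms by auto
  have "dual_trace d (M * kron A B) $$ (b, a) =
    (\<Sum>p<d. \<Sum>a'<d. \<Sum>b'<d. M $$ (p * d + p, a' * d + b') * (A $$ (a', a) * B $$ (b', b)))"
    using ab by (simp add: dual_trace_def mult_kron_index[OF assms(1-3)] pair_less del: index_mult_mat)
  also have "\<dots> = (\<Sum>a'<d. \<Sum>p<d. \<Sum>b'<d. M $$ (p * d + p, a' * d + b') * (A $$ (a', a) * B $$ (b', b)))"
    by (rule sum.swap)
  also have "\<dots> = (\<Sum>a'<d. \<Sum>b'<d. \<Sum>p<d. M $$ (p * d + p, a' * d + b') * (A $$ (a', a) * B $$ (b', b)))"
    by (intro sum.cong refl sum.swap)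
  also have "\<dots> = (B\<^sup>T * dual_trace d M * A) $$ (b, a)"
    using assms ab by (simp add: dual_trace_def scalar_prod_def atLeast0LessThan sum_distrib_left
        sum_distrib_right algebra_simps)
  finally show ?case .
qed (use assms in \<open>auto simp: dual_trace_def\<close>)

text \<open>With M the action of R on X \<otimes> dual X and F the twist after f, the left side is
  the quantum trace of f. The flip fixes evaluation, and F \<otimes> 1 turns coevaluation into F
  read as a vector.\<close>

lemma dual_trace_value:
  assumes M: "M \<in> carrier_mat (d * d) (d * d)" and F: "F \<in> carrier_mat d d"
  shows "mat 1 (d * d) (\<lambda>(_, j). if j div d = j mod d then 1 else 0) *
      (flip_mat d d * M * (kron F (1\<^sub>m d) * mat (d * d) 1 (\<lambda>(i, _). if i div d = i mod d then 1 else 0))) =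
    mat 1 1 (\<lambda>_. mtrace (dual_trace d M * F))"
proof -
  let ?ev = "mat 1 (d * d) (\<lambda>(_, j). if j div d = j mod d then (1::complex) else 0)"
  let ?co = "mat (d * d) 1 (\<lambda>(i, _). if i div d = i mod d then (1::complex) else 0)"
  have co: "kron F (1\<^sub>m d) * ?co = mat (d * d) 1 (\<lambda>(i, _). F $$ (i div d, i mod d))" (is "_ = ?F")
  proof (rule eq_matI, goal_cases)
    case (1 i j)
    then have i: "i < d * d" "j = 0" by auto
    note dm = div_mod_less[OF i(1)]
    have "(kron F (1\<^sub>m d) * ?co) $$ (i, j) =
      (\<Sum>a<d. \<Sum>b<d. F $$ (i div d, a) * 1\<^sub>m d $$ (i mod d, b) * ?co $$ (a * d + b, j))"
      using F i by (intro kron_mult_index) auto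
    also have "\<dots> = (\<Sum>a<d. \<Sum>b<d. if b = i mod d then (if a = i mod d then F $$ (i div d, a) else 0) else 0)"
      using i dm by (intro sum.cong refl) (auto simp: pair_less)
    also have "\<dots> = F $$ (i div d, i mod d)" using dm by simp
    finally show ?case using 1 by simp
  qed (use F in auto)
  have ev: "?ev * flip_mat d d = ?ev"
  proof (rule eq_matI, goal_cases)
    case (1 i j)
    then have j: "i = 0" "j < d * d" by auto
    note dm = div_mod_less[OF j(2)]
    have "(?ev * flip_mat d d) $$ (i, j) = ?ev $$ (i, j mod d * d + j div d)"
      using j by (intro mult_flip_index) auto
    then show ?case using j dm by (auto simp: pair_less)
  qed auto
  have "?ev * (flip_mat d d * M * (kron F (1\<^sub>m d) * ?co)) = ?ev * (flip_mat d d * M * ?F)"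
    by (simp only: co)
  also have "\<dots> = ?ev * flip_mat d d * M * ?F"
    using M F assoc_mult_mat[of ?ev 1 "d * d" "flip_mat d d * M" "d * d" ?F 1]
      assoc_mult_mat[of ?ev 1 "d * d" "flip_mat d d" "d * d" M "d * d"]
    by simp
  also have "\<dots> = ?ev * M * ?F" by (simp only: ev)
  also have "\<dots> = mat 1 1 (\<lambda>_. mtrace (dual_trace d M * F))"
  proof (rule eq_matI, goal_cases)
    case (1 i j)
    then have ij: "i = 0" "j = 0" by auto
    have evM: "(?ev * M) $$ (0, k) = (\<Sum>p<d. M $$ (p * d + p, k))" if k: "k < d * d" for k
    proof -
      have "(?ev * M) $$ (0, k) =
          (\<Sum>l<d * d. (\<lambda>a b. if a = b then M $$ (a * d + b, k) else 0) (l div d) (l mod d))"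
        using M k by (auto simp: scalar_prod_def atLeast0LessThan intro!: sum.cong)
          (metis div_mult_mod_eq)
      also have "\<dots> = (\<Sum>a<d. \<Sum>b<d. if a = b then M $$ (a * d + b, k) else 0)" by (rule sum_pairs)
      finally show ?thesis by simp
    qed
    have "(?ev * M * ?F) $$ (i, j) = (\<Sum>k<d * d. (?ev * M) $$ (0, k) * F $$ (k div d, k mod d))"
      using ij M by (simp add: scalar_prod_def atLeast0LessThan)
    also have "\<dots> = (\<Sum>k<d * d. (\<lambda>a b. (\<Sum>p<d. M $$ (p * d + p, a * d + b)) * F $$ (a, b)) (k div d) (k mod d))"
      by (intro sum.cong refl) (simp add: evM)
    also have "\<dots> = (\<Sum>a<d. \<Sum>b<d. (\<Sum>p<d. M $$ (p * d + p, a * d + b)) * F $$ (a, b))"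
      by (rule sum_pairs)
    also have "\<dots> = (\<Sum>b<d. \<Sum>a<d. (\<Sum>p<d. M $$ (p * d + p, a * d + b)) * F $$ (a, b))"
      by (rule sum.swap)
    also have "\<dots> = mtrace (dual_trace d M * F)"
      using F by (simp add: mtrace_def dual_trace_def scalar_prod_def atLeast0LessThan)
    finally show ?case using ij by simp
  qed (use M in auto)
  finally show ?thesis .
qed

text \<open>Closing up the R-matrix gives the Drinfeld element \<open>u\<close>, so this is the formula \<open>u \<nu> = K\<close> for the
  pivotal element.\<close>

lemma (in dk_module) dual_trace_R:
  assumes "even n"
  shows "dual_trace (rdim X) (act2 X (dual_mod X) (R_matrix n)) * act X (ribbon_element n) = rgen X GK"
proof (rule emb_inj)
  let ?d = "rdim X" and ?Y = "dual_mod X"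
  interpret p: dk_module_pair n X ?Y
    using dual_module dk_module_axioms by (intro dk_module_pair.intro)
  let ?P = "rmat_prod X ?Y" and ?C = "rmat_cartan X ?Y"
  have P: "?P m \<in> carrier_mat (?d * ?d) (?d * ?d)" if "m \<le> n" for m
    using p.rmat_prod_carrier[OF that] by simp
  show "rgen X GK \<in> carrier_mat ?d ?d" by simp
  show "dual_trace ?d (act2 X ?Y (R_matrix n)) * act X (ribbon_element n) \<in> carrier_mat ?d ?d"
    using act_carrier by (intro square_mult_carrier) auto
  assume "?d > 0"
  then interpret pos_dk_module n X by unfold_locales
  have tr: "dual_trace ?d (?P m * kron A B) = B\<^sup>T * dual_trace ?d (?P m) * A"
    if "m \<le> n" "A \<in> carrier_mat ?d ?d" "B \<in> carrier_mat ?d ?d" for m A B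
    using that P by (intro dual_trace_mult_kron)
  have prod: "emb ?d (dual_trace ?d (?P m)) = ring.drinfeld_prod m" if "m \<le> n" for m
    using that
  proof (induction m)
    case 0
    show ?case by (simp add: dual_trace_one e.hom_one ring.drinfeld_prod_def)
  next
    case (Suc m)
    then have i: "Suc m \<in> {1..n}" by auto
    let ?x = "rgen X (GXi (Suc m))" and ?xb = "rgen X (GXibar (Suc m))" and ?kb = "rgen X GKbar"
    have kb: "?kb * ?kb = 1\<^sub>m ?d" using dk_rep by (simp add: dk_mat_def)
    have c: "?x \<in> carrier_mat ?d ?d" "?xb \<in> carrier_mat ?d ?d" "?kb \<in> carrier_mat ?d ?d" using i by auto
    \<comment> \<open>On the dual, the Kbar of the R-matrix meets the Kbar of the antipode and
      cancels it.\<close>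
    have "rgen ?Y (GXibar (Suc m)) * rgen ?Y GKbar = - (?xb\<^sup>T * ?kb\<^sup>T * ?kb\<^sup>T)"
      using i carrier_matD[OF c(3)] by (simp add: rgen_dual uminus_mult_left_mat)
    also have "?xb\<^sup>T * ?kb\<^sup>T * ?kb\<^sup>T = (?kb * ?kb * ?xb)\<^sup>T"
      using c by (simp add: transpose_mult[of _ ?d ?d _ ?d]
          assoc_mult_mat[of _ ?d ?d _ ?d _ ?d])
    finally have xbkb: "rgen ?Y (GXibar (Suc m)) * rgen ?Y GKbar = - (?xb\<^sup>T)"
      using c kb by simp
    have "dual_trace ?d (?P (Suc m)) =
        dual_trace ?d (?P m) + dual_trace ?d (?P m * kron ?x (- (?xb\<^sup>T)))"
      unfolding rmat_prod.simps xbkb using Suc.prems P[of m] c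
      by (intro dual_trace_add square_mult_carrier) auto
    also have "dual_trace ?d (?P m * kron ?x (- (?xb\<^sup>T))) = - (?xb * dual_trace ?d (?P m) * ?x)"
      using Suc.prems c carrier_matD[OF c(1)] carrier_matD[OF c(2)]
      by (subst tr) (auto simp: transpose_uminus uminus_mult_left_mat)
    finally show ?case
      using Suc c ring.drinfeld_prod_Suc[OF Suc.prems]
      by (simp add: e.hom_add e.hom_uminus e.hom_mult)
  qed
  let ?t = "dual_trace ?d (?P n)" and ?k = "rgen X GK" and ?kb = "rgen X GKbar"
  have c: "?k \<in> carrier_mat ?d ?d" "?kb \<in> carrier_mat ?d ?d" by auto
  \<comment> \<open>The minus sign of the Cartan part is written as a scalar, so that additivity and
    homogeneity of \<open>dual_trace\<close> suffice.\<close>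
  have PC: "?P n * ?C = ?P n * kron (1\<^sub>m ?d) (1\<^sub>m ?d) + ?P n * kron ?k (1\<^sub>m ?d) +
      ?P n * kron (1\<^sub>m ?d) (?kb\<^sup>T) + (- 1) \<cdot>\<^sub>m (?P n * kron ?k (?kb\<^sup>T))"
  proof -
    let ?D = "?d * ?d"
    have *: "M * (A + B + C - E) = M * A + M * B + M * C + (- 1) \<cdot>\<^sub>m (M * E)"
      if "M \<in> carrier_mat ?D ?D" "A \<in> carrier_mat ?D ?D" "B \<in> carrier_mat ?D ?D"
        "C \<in> carrier_mat ?D ?D" "E \<in> carrier_mat ?D ?D" for M A B C E :: "complex mat"
      using that by (auto simp: scalar_prod_def algebra_simps sum.distrib sum_subtractf intro!: eq_matI)
    show ?thesis
      using c P[OF le_refl] unfolding rmat_cartan_def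
      by (subst *) (auto simp: rgen_dual)
  qed
  have "dual_trace ?d (?P n * ?C) = ?t + ?t * ?k + ?kb * ?t + (- 1) \<cdot>\<^sub>m (?kb * ?t * ?k)"
    unfolding PC using c P[OF le_refl]
    by (simp add: dual_trace_add dual_trace_smult tr)
  moreover have "(- 1) \<cdot>\<^sub>m A = - A" for A :: "complex mat" by auto
  ultimately have tC: "emb ?d (dual_trace ?d (?P n * ?C)) = ring.drinfeld_prod n +
      ring.drinfeld_prod n * emb ?d ?k + emb ?d ?kb * ring.drinfeld_prod n - emb ?d ?kb * ring.drinfeld_prod n * emb ?d ?k"
    using c by (simp add: e.hom_add e.hom_uminus e.hom_mult prod)
  let ?s = "emb ?d ((1 / 2) \<cdot>\<^sub>m 1\<^sub>m ?d)"
  have "dual_trace ?d (act2 X ?Y (R_matrix n)) = (1 / 2) \<cdot>\<^sub>m dual_trace ?d (?P n * ?C)"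
    unfolding p.act2_R_matrix using P[of n] p.rmat_cartan_carrier
    by (intro dual_trace_smult square_mult_carrier) auto
  then have "emb ?d (dual_trace ?d (act2 X ?Y (R_matrix n))) = emb ?d (dual_trace ?d (?P n * ?C)) * ?s"
    using e.hom_smult[of "dual_trace ?d (?P n * ?C)" "1 / 2"]
      e.hom_scalar_commutes[of "dual_trace ?d (?P n * ?C)" "1 / 2"] by simp
  then have "emb ?d (dual_trace ?d (act2 X ?Y (R_matrix n)) * act X (ribbon_element n)) =
      emb ?d (dual_trace ?d (?P n * ?C)) * (?s * ?s) * (ring.twist_cartan * ring.twist_prod n)"
    using act_carrier by (simp add: e.hom_mult emb_ribbon_element mult.assoc)
  \<comment> \<open>One half comes from R and one from \<nu>; their product 1/4 cancels the 4 of
    \<open>ring.pivotal\<close>.\<close>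
  also have "?s * ?s = emb ?d ((1 / 4) \<cdot>\<^sub>m 1\<^sub>m ?d)"
    by (simp flip: e.hom_smult) (auto intro!: arg_cong[of _ _ "emb ?d"])
  also have "emb ?d (dual_trace ?d (?P n * ?C)) * \<dots> = \<dots> * emb ?d (dual_trace ?d (?P n * ?C))"
    by (rule e.hom_scalar_commutes[symmetric]) simp
  also have "\<dots> * (ring.twist_cartan * ring.twist_prod n) = emb ?d ((1 / 4) \<cdot>\<^sub>m 1\<^sub>m ?d) * (4 * emb ?d ?k)"
    unfolding tC using ring.pivotal[OF assms] by (simp add: mult.assoc)
  also have "4 * emb ?d ?k = emb ?d ((4 \<cdot>\<^sub>m ?k))"
  proof -
    have "4 \<cdot>\<^sub>m ?k = ?k + ?k + (?k + ?k)" by (auto simp: algebra_simps)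
    moreover have "4 * emb ?d ?k = emb ?d ?k + emb ?d ?k + (emb ?d ?k + emb ?d ?k)"
      using distrib_right[of 2 2 "emb ?d ?k"] by (simp add: mult_2)
    ultimately show ?thesis using c by (simp only: e.hom_add add_carrier_mat)
  qed
  also have "emb ?d ((1 / 4) \<cdot>\<^sub>m 1\<^sub>m ?d) * \<dots> = emb ?d ?k"
    using c by (simp flip: e.hom_smult) (auto intro!: arg_cong[of _ _ "emb ?d"])
  finally show "emb ?d (dual_trace ?d (act2 X ?Y (R_matrix n)) * act X (ribbon_element n)) = emb ?d ?k" .
qed


subsection \<open>Partial traces\<close>

definition ptrace_right :: "nat \<Rightarrow> nat \<Rightarrow> complex mat \<Rightarrow> complex mat" where
  "ptrace_right p q M = mat p p (\<lambda>(i, j). \<Sum>b<q. M $$ (i * q + b, j * q + b))"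

definition ptrace_left :: "nat \<Rightarrow> nat \<Rightarrow> complex mat \<Rightarrow> complex mat" where
  "ptrace_left p q M = mat q q (\<lambda>(i, j). \<Sum>a<p. M $$ (a * q + i, a * q + j))"

lemma ptrace_carrier [simp]: "ptrace_right p q M \<in> carrier_mat p p" "ptrace_left p q M \<in> carrier_mat q q"
  by (simp_all add: ptrace_right_def ptrace_left_def)

context
  fixes p q :: nat and M :: "complex mat"
  assumes M: "M \<in> carrier_mat (p * q) (p * q)"
begin

lemma mtrace_ptrace: "mtrace M = mtrace (ptrace_right p q M)" "mtrace M = mtrace (ptrace_left p q M)"
proof -
  have "mtrace M = (\<Sum>k<p * q. (\<lambda>a b. M $$ (a * q + b, a * q + b)) (k div q) (k mod q))"
    using M by (simp add: mtrace_def)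
  also have "\<dots> = (\<Sum>a<p. \<Sum>b<q. M $$ (a * q + b, a * q + b))" by (rule sum_pairs)
  finally have *: "mtrace M = (\<Sum>a<p. \<Sum>b<q. M $$ (a * q + b, a * q + b))" .
  then show "mtrace M = mtrace (ptrace_right p q M)"
    by (simp add: mtrace_def ptrace_right_def)
  show "mtrace M = mtrace (ptrace_left p q M)"
    unfolding * by (subst sum.swap) (simp add: mtrace_def ptrace_left_def)
qed

lemma kron_one_mult_index:
  assumes "i < p" "b < q" "j < p * q" "A \<in> carrier_mat p p" "B \<in> carrier_mat q q"
  shows "(kron A (1\<^sub>m q) * M) $$ (i * q + b, j) = (\<Sum>a<p. A $$ (i, a) * M $$ (a * q + b, j))"
    "(kron (1\<^sub>m p) B * M) $$ (i * q + b, j) = (\<Sum>c<q. B $$ (b, c) * M $$ (i * q + c, j))"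
    "(M * kron A (1\<^sub>m q)) $$ (j, i * q + b) = (\<Sum>a<p. M $$ (j, a * q + b) * A $$ (a, i))"
    "(M * kron (1\<^sub>m p) B) $$ (j, i * q + b) = (\<Sum>c<q. M $$ (j, i * q + c) * B $$ (c, b))"
proof -
  have l: "i * q + b < p * q" using assms pair_less by blast
  have 1: "(\<Sum>c<q. f c * 1\<^sub>m q $$ (b, c) * g c) = f b * g b"
    "(\<Sum>c<q. f c * (g c * 1\<^sub>m q $$ (c, b))) = f b * g b" for f g :: "nat \<Rightarrow> complex"
  proof -
    have e: "(\<Sum>c<q. f c * 1\<^sub>m q $$ (b, c) * g c) = (\<Sum>c<q. if c = b then f c * g c else 0)"
      "(\<Sum>c<q. f c * (g c * 1\<^sub>m q $$ (c, b))) = (\<Sum>c<q. if c = b then f c * g c else 0)"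
      by (intro sum.cong refl; use assms in auto)+
    show "(\<Sum>c<q. f c * 1\<^sub>m q $$ (b, c) * g c) = f b * g b"
      using assms by (subst e(1)) auto
    show "(\<Sum>c<q. f c * (g c * 1\<^sub>m q $$ (c, b))) = f b * g b"
      using assms by (subst e(2)) auto
  qed
  have 2: "(\<Sum>a<p. \<Sum>c<q. 1\<^sub>m p $$ (i, a) * f c * g a c) = (\<Sum>c<q. f c * g i c)"
    "(\<Sum>a<p. \<Sum>c<q. g a c * (1\<^sub>m p $$ (a, i) * f c)) = (\<Sum>c<q. g i c * f c)" for f and g :: "nat \<Rightarrow> nat \<Rightarrow> complex"
  proof -
    have e: "(\<Sum>a<p. \<Sum>c<q. 1\<^sub>m p $$ (i, a) * f c * g a c) = (\<Sum>a<p. if a = i then (\<Sum>c<q. f c * g a c) else 0)"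
      "(\<Sum>a<p. \<Sum>c<q. g a c * (1\<^sub>m p $$ (a, i) * f c)) = (\<Sum>a<p. if a = i then (\<Sum>c<q. g a c * f c) else 0)"
      by (intro sum.cong refl; use assms in auto)+
    show "(\<Sum>a<p. \<Sum>c<q. 1\<^sub>m p $$ (i, a) * f c * g a c) = (\<Sum>c<q. f c * g i c)"
      using assms by (subst e(1)) auto
    show "(\<Sum>a<p. \<Sum>c<q. g a c * (1\<^sub>m p $$ (a, i) * f c)) = (\<Sum>c<q. g i c * f c)"
      using assms by (subst e(2)) auto
  qed
  show "(kron A (1\<^sub>m q) * M) $$ (i * q + b, j) = (\<Sum>a<p. A $$ (i, a) * M $$ (a * q + b, j))"
    using assms by (subst kron_mult_index[OF M _ _ l]) (auto simp: 1 simp del: index_one_mat(1))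
  show "(kron (1\<^sub>m p) B * M) $$ (i * q + b, j) = (\<Sum>c<q. B $$ (b, c) * M $$ (i * q + c, j))"
    using assms by (subst kron_mult_index[OF M _ _ l]) (auto simp: 2 simp del: index_one_mat(1))
  show "(M * kron A (1\<^sub>m q)) $$ (j, i * q + b) = (\<Sum>a<p. M $$ (j, a * q + b) * A $$ (a, i))"
    using assms by (subst mult_kron_index[OF M _ _ _ l]) (auto simp: 1 simp del: index_one_mat(1))
  show "(M * kron (1\<^sub>m p) B) $$ (j, i * q + b) = (\<Sum>c<q. M $$ (j, i * q + c) * B $$ (c, b))"
    using assms by (subst mult_kron_index[OF M _ _ _ l]) (auto simp: 2 simp del: index_one_mat(1))
qed

lemma ptrace_right_mult:
  assumes A: "A \<in> carrier_mat p p"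
  shows "ptrace_right p q (kron A (1\<^sub>m q) * M) = A * ptrace_right p q M"
    and "ptrace_right p q (M * kron A (1\<^sub>m q)) = ptrace_right p q M * A"
proof -
  have "(\<Sum>b<q. \<Sum>a<p. A $$ (i, a) * M $$ (a * q + b, j * q + b)) =
      (\<Sum>a<p. A $$ (i, a) * (\<Sum>b<q. M $$ (a * q + b, j * q + b)))"
    "(\<Sum>b<q. \<Sum>a<p. M $$ (i * q + b, a * q + b) * A $$ (a, j)) =
      (\<Sum>a<p. (\<Sum>b<q. M $$ (i * q + b, a * q + b)) * A $$ (a, j))" for i j
    by (subst sum.swap, simp add: sum_distrib_left sum_distrib_right)+
  note * = this kron_one_mult_index[OF _ _ _ A one_carrier_mat]
  show "ptrace_right p q (kron A (1\<^sub>m q) * M) = A * ptrace_right p q M"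
    "ptrace_right p q (M * kron A (1\<^sub>m q)) = ptrace_right p q M * A"
    by (rule eq_matI; use A in \<open>simp add: ptrace_right_def * pair_less scalar_prod_def atLeast0LessThan
      del: index_mult_mat(1)\<close>; simp add: scalar_prod_def atLeast0LessThan)+
qed

lemma ptrace_right_commute:
  assumes B: "B \<in> carrier_mat q q"
  shows "ptrace_right p q (kron (1\<^sub>m p) B * M) = ptrace_right p q (M * kron (1\<^sub>m p) B)"
proof -
  have "(\<Sum>b<q. \<Sum>c<q. B $$ (b, c) * M $$ (i * q + c, j * q + b)) =
      (\<Sum>b<q. \<Sum>c<q. M $$ (i * q + b, j * q + c) * B $$ (c, b))" for i j
    by (subst sum.swap) (simp add: mult.commute)
  note * = this kron_one_mult_index[OF _ _ _ one_carrier_mat B]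
  show ?thesis
    by (rule eq_matI; simp add: ptrace_right_def * pair_less del: index_mult_mat(1))
qed

lemma ptrace_left_mult:
  assumes B: "B \<in> carrier_mat q q"
  shows "ptrace_left p q (kron (1\<^sub>m p) B * M) = B * ptrace_left p q M"
    and "ptrace_left p q (M * kron (1\<^sub>m p) B) = ptrace_left p q M * B"
proof -
  have "(\<Sum>b<p. \<Sum>a<q. B $$ (i, a) * M $$ (b * q + a, b * q + j)) =
      (\<Sum>a<q. B $$ (i, a) * (\<Sum>b<p. M $$ (b * q + a, b * q + j)))"
    "(\<Sum>b<p. \<Sum>a<q. M $$ (b * q + i, b * q + a) * B $$ (a, j)) =
      (\<Sum>a<q. (\<Sum>b<p. M $$ (b * q + i, b * q + a)) * B $$ (a, j))" for i j
    by (subst sum.swap, simp add: sum_distrib_left sum_distrib_right)+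
  note * = this kron_one_mult_index[OF _ _ _ one_carrier_mat B]
  show "ptrace_left p q (kron (1\<^sub>m p) B * M) = B * ptrace_left p q M"
    "ptrace_left p q (M * kron (1\<^sub>m p) B) = ptrace_left p q M * B"
    by (rule eq_matI; use B in \<open>simp add: ptrace_left_def * pair_less scalar_prod_def atLeast0LessThan
      del: index_mult_mat(1)\<close>; simp add: scalar_prod_def atLeast0LessThan)+
qed

lemma ptrace_left_commute:
  assumes A: "A \<in> carrier_mat p p"
  shows "ptrace_left p q (kron A (1\<^sub>m q) * M) = ptrace_left p q (M * kron A (1\<^sub>m q))"
proof -
  have "(\<Sum>b<p. \<Sum>c<p. A $$ (b, c) * M $$ (c * q + i, b * q + j)) =
      (\<Sum>b<p. \<Sum>c<p. M $$ (b * q + i, c * q + j) * A $$ (c, b))" for i j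
    by (subst sum.swap) (simp add: mult.commute)
  note * = this kron_one_mult_index[OF _ _ _ A one_carrier_mat]
  show ?thesis
    by (rule eq_matI; simp add: ptrace_left_def * pair_less del: index_mult_mat(1))
qed

end

section \<open>Module homomorphisms\<close>

lemma module_homD:
  assumes "f \<in> module_hom n X Y"
  shows "f \<in> carrier_mat (rdim Y) (rdim X)" "g \<in> gens n \<Longrightarrow> f * rgen X g = rgen Y g * f"
  using assms by (auto simp: module_hom_def)

lemma module_hom_comp:
  assumes "dk_module n X" "dk_module n Y" "dk_module n Z"
    and f: "f \<in> module_hom n X Y" and g: "g \<in> module_hom n Y Z"
  shows "g * f \<in> module_hom n X Z"
proof -
  interpret X: dk_module n X by fact
  interpret Y: dk_module n Y by fact
  interpret Z: dk_module n Z by fact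
  have "g * f * rgen X a = rgen Z a * (g * f)" if a: "a \<in> gens n" for a
  proof -
    note c = module_homD(1)[OF f] module_homD(1)[OF g] X.rgen_carrier[OF a] Y.rgen_carrier[OF a]
      Z.rgen_carrier[OF a]
    have "g * f * rgen X a = g * (f * rgen X a)" using c by simp
    also have "\<dots> = g * rgen Y a * f"
      unfolding module_homD(2)[OF f a] using c by simp
    also have "\<dots> = rgen Z a * (g * f)"
      unfolding module_homD(2)[OF g a] using c by simp
    finally show ?thesis .
  qed
  then show ?thesis
    using module_homD(1)[OF f] module_homD(1)[OF g] by (auto simp: module_hom_def)
qed

lemma module_hom_add:
  assumes "dk_module n X" "dk_module n Y" "f \<in> module_hom n X Y" "g \<in> module_hom n X Y"
  shows "f + g \<in> module_hom n X Y"
proof -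
  interpret X: dk_module n X by fact
  interpret Y: dk_module n Y by fact
  show ?thesis
    using assms(3,4) X.rgen_carrier Y.rgen_carrier
    by (auto simp: module_hom_def add_mult_distrib_mat[of _ "rdim Y" "rdim X" _ _ "rdim X"]
        mult_add_distrib_mat[of _ "rdim Y" "rdim Y" _ "rdim X"])
qed

lemma module_hom_smult:
  assumes "dk_module n X" "dk_module n Y" "f \<in> module_hom n X Y"
  shows "c \<cdot>\<^sub>m f \<in> module_hom n X Y"
proof -
  interpret X: dk_module n X by fact
  interpret Y: dk_module n Y by fact
  show ?thesis
    using assms(3) X.rgen_carrier Y.rgen_carrier
    by (auto simp: module_hom_def mult_smult_assoc_mat[of _ "rdim Y" "rdim X" _ "rdim X"]
        mult_smult_distrib[of _ "rdim Y" "rdim Y" _ "rdim X"])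
qed

lemma module_hom_one: "dk_module n X \<Longrightarrow> 1\<^sub>m (rdim X) \<in> module_hom n X X"
  using carrier_rep.rgen_carrier[OF dk_module.axioms(1)]
  by (auto simp: module_hom_def)

lemma module_hom_zero: "dk_module n X \<Longrightarrow> dk_module n Y \<Longrightarrow> 0\<^sub>m (rdim Y) (rdim X) \<in> module_hom n X Y"
  using carrier_rep.rgen_carrier[OF dk_module.axioms(1), of n X]
    carrier_rep.rgen_carrier[OF dk_module.axioms(1), of n Y]
  by (auto simp: module_hom_def)

lemma intertwine_kron:
  fixes A A' B B' f h :: "complex mat"
  assumes "f * A = A' * f" "h * B = B' * h" "f \<in> carrier_mat a' a" "h \<in> carrier_mat b' b"
    "A \<in> carrier_mat a a" "B \<in> carrier_mat b b" "A' \<in> carrier_mat a' a'" "B' \<in> carrier_mat b' b'"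
  shows "kron f h * kron A B = kron A' B' * kron f h"
  using assms by (simp add: kron_mult[of _ a' a _ b' b _ a _ b] kron_mult[of _ a' a' _ b' b' _ a _ b])

text \<open>Pairs M, M' that F intertwines are closed under ring operations, so naturality can
  follow the way in which an element is built from generators.\<close>

lemma intertwine_arith:
  fixes F M M' N N' :: "complex mat"
  assumes eq: "F * M = M' * F" "F * N = N' * F" and F: "F \<in> carrier_mat a' a"
    and c: "M \<in> carrier_mat a a" "N \<in> carrier_mat a a" "M' \<in> carrier_mat a' a'" "N' \<in> carrier_mat a' a'"
  shows "F * (M + N) = (M' + N') * F" "F * (M - N) = (M' - N') * F" "F * (M * N) = M' * N' * F"
proof -
  show "F * (M + N) = (M' + N') * F" "F * (M - N) = (M' - N') * F"
    using assms by (simp_all add: mult_add_distrib_mat[of _ a' a _ a] add_mult_distrib_mat[of _ a' a' _ _ a]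
        mult_minus_distrib_mat[of _ a' a _ a] minus_mult_distrib_mat[of _ a' a' _ _ a])
  have "F * (M * N) = M' * F * N"
    unfolding eq(1)[symmetric] using F c by (simp add: assoc_mult_mat[of _ a' a _ a _ a])
  also have "\<dots> = M' * (N' * F)"
    unfolding eq(2)[symmetric] using F c by (simp add: assoc_mult_mat[of _ a' a' _ a _ a])
  also have "\<dots> = M' * N' * F"
    using F c by (simp add: assoc_mult_mat[of _ a' a' _ a' _ a])
  finally show "F * (M * N) = M' * N' * F" .
qed

lemma module_hom_kron:
  assumes "dk_module n X" "dk_module n X'" "dk_module n Y" "dk_module n Y'"
    and f: "f \<in> module_hom n X X'" and h: "h \<in> module_hom n Y Y'"
  shows "kron f h \<in> module_hom n (tensor_mod X Y) (tensor_mod X' Y')"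
proof -
  interpret X: dk_module n X by fact
  interpret X': dk_module n X' by fact
  interpret Y: dk_module n Y by fact
  interpret Y': dk_module n Y' by fact
  interpret XY: dk_module_pair n X Y ..
  interpret XY': dk_module_pair n X' Y' ..
  let ?d = "rdim X" and ?d' = "rdim X'" and ?e = "rdim Y" and ?e' = "rdim Y'"
  note fc = module_homD(1)[OF f] and hc = module_homD(1)[OF h]
  have c: "kron f h \<in> carrier_mat (?d' * ?e') (?d * ?e)" using fc hc by simp
  note step = intertwine_kron[OF _ _ fc hc] and add = intertwine_arith(1)[OF _ _ c]
  have one: "h * 1\<^sub>m ?e = 1\<^sub>m ?e' * h" using hc by simp
  have "kron f h * rgen (tensor_mod X Y) g = rgen (tensor_mod X' Y') g * kron f h" if g: "g \<in> gens n" for g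
    using g
  proof (cases rule: gens_cases)
    case 1
    then show ?thesis
      by (simp add: XY.rgen_tensor XY'.rgen_tensor step module_homD(2)[OF f] module_homD(2)[OF h])
  next
    case 2
    then show ?thesis
      by (simp add: XY.rgen_tensor XY'.rgen_tensor step module_homD(2)[OF f] module_homD(2)[OF h])
  next
    case (3 i)
    show ?thesis
      unfolding 3(2) XY.rgen_tensor(3)[OF 3(1)] XY'.rgen_tensor(3)[OF 3(1)]
      by (intro add step one module_homD(2)[OF f] module_homD(2)[OF h] kron_carrier; use 3(1) in simp)
  next
    case (4 i)
    show ?thesis
      unfolding 4(2) XY.rgen_tensor(4)[OF 4(1)] XY'.rgen_tensor(4)[OF 4(1)]
      by (intro add step one module_homD(2)[OF f] module_homD(2)[OF h] kron_carrier; use 4(1) in simp)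
  qed
  then show ?thesis
    using c by (simp add: module_hom_def)
qed

lemma (in pos_dk_module) emb_gen_identities:
  assumes i: "i \<in> {1..n}"
  shows "emb (rdim X) (rgen X GKbar * (rgen X GK * rgen X (GXibar i) * rgen X GKbar)) =
      emb (rdim X) (rgen X (GXibar i) * rgen X GK)"
    "emb (rdim X) (rgen X GK * rgen X GKbar * rgen X (GXibar i)) =
      emb (rdim X) (rgen X (GXibar i) * (rgen X GK * rgen X GKbar))"
    "emb (rdim X) (rgen X GK * (rgen X GK * rgen X (GXi i) * rgen X GK)) =
      emb (rdim X) (rgen X (GXi i) * rgen X GK)"
  using i by (simp_all add: e.hom_mult mult.assoc ring.group_rules' ring.skew_rules')

text \<open>These evaluate the weights chosen in the partial trace arguments: each product absorbs
  one more group-like factor.\<close>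

lemma (in dk_module) gen_identities:
  shows "rgen X GK * rgen X GK = 1\<^sub>m (rdim X)" "rgen X GKbar * rgen X GKbar = 1\<^sub>m (rdim X)"
    "rgen X GKbar * rgen X GK = rgen X GK * rgen X GKbar"
    "rgen X GK * rgen X GKbar * rgen X GKbar = rgen X GK" "rgen X GKbar * (rgen X GK * rgen X GKbar) = rgen X GK"
    "i \<in> {1..n} \<Longrightarrow> rgen X GKbar * (rgen X GK * rgen X (GXibar i) * rgen X GKbar) = rgen X (GXibar i) * rgen X GK"
    "i \<in> {1..n} \<Longrightarrow> rgen X GK * rgen X GKbar * rgen X (GXibar i) = rgen X (GXibar i) * (rgen X GK * rgen X GKbar)"
    "i \<in> {1..n} \<Longrightarrow> rgen X GK * (rgen X GK * rgen X (GXi i) * rgen X GK) = rgen X (GXi i) * rgen X GK"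
proof -
  show group: "rgen X GK * rgen X GK = 1\<^sub>m (rdim X)" "rgen X GKbar * rgen X GKbar = 1\<^sub>m (rdim X)"
    "rgen X GKbar * rgen X GK = rgen X GK * rgen X GKbar"
    using dk_rep by (auto simp: dk_mat_def)
  show k: "rgen X GK * rgen X GKbar * rgen X GKbar = rgen X GK"
    using group(2) by (simp add: assoc_mult_mat[of _ "rdim X" "rdim X" _ "rdim X" _ "rdim X"])
  have "rgen X GKbar * (rgen X GK * rgen X GKbar) = rgen X GKbar * rgen X GK * rgen X GKbar"
    by (simp add: assoc_mult_mat[of _ "rdim X" "rdim X" _ "rdim X" _ "rdim X"])
  then show "rgen X GKbar * (rgen X GK * rgen X GKbar) = rgen X GK"
    unfolding group(3) k .
  assume i: "i \<in> {1..n}"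
  have e: "A = B" if "A \<in> carrier_mat (rdim X) (rdim X)" "B \<in> carrier_mat (rdim X) (rdim X)"
    "pos_dk_module n X \<Longrightarrow> emb (rdim X) A = emb (rdim X) B" for A B
    using that emb_inj[of A "rdim X" B] dk_module_axioms
    by (auto simp: pos_dk_module_def pos_dk_module_axioms_def)
  show "rgen X GKbar * (rgen X GK * rgen X (GXibar i) * rgen X GKbar) = rgen X (GXibar i) * rgen X GK"
    "rgen X GK * rgen X GKbar * rgen X (GXibar i) = rgen X (GXibar i) * (rgen X GK * rgen X GKbar)"
    "rgen X GK * (rgen X GK * rgen X (GXi i) * rgen X GK) = rgen X (GXi i) * rgen X GK"
    by (rule e; use i in \<open>simp add: pos_dk_module.emb_gen_identities\<close>)+
qed

lemma ptrace_add:
  assumes "M \<in> carrier_mat (p * q) (p * q)" "N \<in> carrier_mat (p * q) (p * q)"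
  shows "ptrace_right p q (M + N) = ptrace_right p q M + ptrace_right p q N"
    "ptrace_left p q (M + N) = ptrace_left p q M + ptrace_left p q N"
  using assms
  by (auto simp: ptrace_right_def ptrace_left_def pair_less sum.distrib intro!: eq_matI)

section \<open>Partial traces of module endomorphisms, weighted by K\<close>

context dk_module_pair
begin

context
  fixes g assumes g: "g \<in> module_hom n (tensor_mod X Y) (tensor_mod X Y)"
begin

private abbreviation (input) "d \<equiv> rdim X"
private abbreviation (input) "e \<equiv> rdim Y"
private abbreviation (input) "D \<equiv> rdim X * rdim Y"
private abbreviation (input) "T W \<equiv> ptrace_right d e (kron (1\<^sub>m d) W * g)"
private abbreviation (input) "U W \<equiv> ptrace_left d e (kron W (1\<^sub>m e) * g)"

private lemma gc: "g \<in> carrier_mat D D"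
  using module_homD(1)[OF g] by simp

text \<open>The factor acting on X leaves the partial trace, while the one acting on Y joins the
  weight W: directly when it precedes g, after cycling when it follows g.\<close>

private lemma right_left:
  assumes "a \<in> carrier_mat d d" "b \<in> carrier_mat e e" "W \<in> carrier_mat e e"
  shows "ptrace_right d e (kron (1\<^sub>m d) W * (kron a b * g)) = a * T (W * b)"
    and "ptrace_right d e (kron (1\<^sub>m d) W * (g * kron a b)) = T (b * W) * a"
proof -
  note km = kron_mult[of _ d d _ e e _ d _ e] and as = assoc_mult_mat[of _ D D _ D _ D]
  have "kron (1\<^sub>m d) W * (kron a b * g) = kron a (1\<^sub>m e) * (kron (1\<^sub>m d) (W * b) * g)"
    using assms gc by (simp add: km flip: as)
  then show "ptrace_right d e (kron (1\<^sub>m d) W * (kron a b * g)) = a * T (W * b)"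
    using assms gc by (simp add: ptrace_right_mult)
  have "kron (1\<^sub>m d) W * (g * kron a b) = (kron (1\<^sub>m d) W * g) * kron (1\<^sub>m d) b * kron a (1\<^sub>m e)"
    using assms gc by (simp add: km as)
  then have "ptrace_right d e (kron (1\<^sub>m d) W * (g * kron a b)) =
      ptrace_right d e ((kron (1\<^sub>m d) W * g) * kron (1\<^sub>m d) b) * a"
    using assms gc by (simp add: ptrace_right_mult)
  also have "ptrace_right d e ((kron (1\<^sub>m d) W * g) * kron (1\<^sub>m d) b) = T (b * W)"
    using assms gc by (simp add: km flip: ptrace_right_commute as)
  finally show "ptrace_right d e (kron (1\<^sub>m d) W * (g * kron a b)) = T (b * W) * a" .
qed

private lemma left_right:
  assumes "a \<in> carrier_mat d d" "b \<in> carrier_mat e e" "W \<in> carrier_mat d d"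
  shows "ptrace_left d e (kron W (1\<^sub>m e) * (kron a b * g)) = b * U (W * a)"
    and "ptrace_left d e (kron W (1\<^sub>m e) * (g * kron a b)) = U (a * W) * b"
proof -
  note km = kron_mult[of _ d d _ e e _ d _ e] and as = assoc_mult_mat[of _ D D _ D _ D]
  have "kron W (1\<^sub>m e) * (kron a b * g) = kron (1\<^sub>m d) b * (kron (W * a) (1\<^sub>m e) * g)"
    using assms gc by (simp add: km flip: as)
  then show "ptrace_left d e (kron W (1\<^sub>m e) * (kron a b * g)) = b * U (W * a)"
    using assms gc by (simp add: ptrace_left_mult)
  have "kron W (1\<^sub>m e) * (g * kron a b) = (kron W (1\<^sub>m e) * g) * kron a (1\<^sub>m e) * kron (1\<^sub>m d) b"
    using assms gc by (simp add: km as)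
  then have "ptrace_left d e (kron W (1\<^sub>m e) * (g * kron a b)) =
      ptrace_left d e ((kron W (1\<^sub>m e) * g) * kron a (1\<^sub>m e)) * b"
    using assms gc by (simp add: ptrace_left_mult)
  also have "ptrace_left d e ((kron W (1\<^sub>m e) * g) * kron a (1\<^sub>m e)) = U (a * W)"
    using assms gc by (simp add: km flip: ptrace_left_commute as)
  finally show "ptrace_left d e (kron W (1\<^sub>m e) * (g * kron a b)) = U (a * W) * b" .
qed

text \<open>Expresses that g commutes with \<Delta>(h) = h \<otimes> h. The weight is left free,
  because different generators require different weights to produce K in the end.\<close>

private lemma grouplike:
  assumes h: "h \<in> {GK, GKbar}"
  shows "W \<in> carrier_mat e e \<Longrightarrow> rgen X h * T (W * rgen Y h) = T (rgen Y h * W) * rgen X h"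
    and "V \<in> carrier_mat d d \<Longrightarrow> rgen Y h * U (V * rgen X h) = U (rgen X h * V) * rgen Y h"
proof -
  have t: "rgen (tensor_mod X Y) h = kron (rgen X h) (rgen Y h)" and hg: "h \<in> gens n"
    using h rgen_tensor by auto
  then have *: "g * kron (rgen X h) (rgen Y h) = kron (rgen X h) (rgen Y h) * g"
    using module_homD(2)[OF g hg] by simp
  note c = l.rgen_carrier[OF hg] r.rgen_carrier[OF hg]
  show "W \<in> carrier_mat e e \<Longrightarrow> rgen X h * T (W * rgen Y h) = T (rgen Y h * W) * rgen X h"
    using right_left[OF c, of W] by (simp add: *)
  show "V \<in> carrier_mat d d \<Longrightarrow> rgen Y h * U (V * rgen X h) = U (rgen X h * V) * rgen Y h"
    using left_right[OF c, of V] by (simp add: *)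
qed

text \<open>The analogue for \<Delta>(h) = h' \<otimes> h + h \<otimes> 1, where h' is the
  group-like that belongs to h.\<close>

private lemma primitive:
  assumes h: "(h, h') \<in> {(GXi i, GK), (GXibar i, GKbar)}" and i: "i \<in> {1..n}"
  shows "W \<in> carrier_mat e e \<Longrightarrow>
      rgen X h' * T (W * rgen Y h) + rgen X h * T W = T (rgen Y h * W) * rgen X h' + T W * rgen X h"
    and "V \<in> carrier_mat d d \<Longrightarrow>
      rgen Y h * U (V * rgen X h') + U (V * rgen X h) = U (rgen X h' * V) * rgen Y h + U (rgen X h * V)"
proof -
  let ?a = "kron (rgen X h') (rgen Y h)" and ?b = "kron (rgen X h) (1\<^sub>m e)"
  have t: "rgen (tensor_mod X Y) h = ?a + ?b" and hg: "h \<in> gens n" "h' \<in> gens n"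
    using h i rgen_tensor by auto
  note c = l.rgen_carrier[OF hg(1)] r.rgen_carrier[OF hg(1)] l.rgen_carrier[OF hg(2)]
  have *: "g * ?a + g * ?b = ?a * g + ?b * g"
    using module_homD(2)[OF g hg(1)] gc c
    by (simp add: t mult_add_distrib_mat[of _ D D _ D] add_mult_distrib_mat[of _ D D _ _ D])
  have **: "P * (g * ?a) + P * (g * ?b) = P * (?a * g) + P * (?b * g)" if "P \<in> carrier_mat D D" for P
  proof -
    have "P * (g * ?a + g * ?b) = P * (g * ?a) + P * (g * ?b)"
      "P * (?a * g + ?b * g) = P * (?a * g) + P * (?b * g)"
      using that gc c by (auto intro!: mult_add_distrib_mat[of _ D D _ D] simp:)
    then show ?thesis using * by simp
  qed
  show "rgen X h' * T (W * rgen Y h) + rgen X h * T W = T (rgen Y h * W) * rgen X h' + T W * rgen X h"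
    if W: "W \<in> carrier_mat e e"
  proof -
    have "ptrace_right d e (kron (1\<^sub>m d) W * (g * ?a)) + ptrace_right d e (kron (1\<^sub>m d) W * (g * ?b)) =
      ptrace_right d e (kron (1\<^sub>m d) W * (?a * g)) + ptrace_right d e (kron (1\<^sub>m d) W * (?b * g))"
      using **[of "kron (1\<^sub>m d) W"] W gc c by (simp flip: ptrace_add)
    then show ?thesis
      using W c by (simp add: right_left)
  qed
  show "rgen Y h * U (V * rgen X h') + U (V * rgen X h) = U (rgen X h' * V) * rgen Y h + U (rgen X h * V)"
    if V: "V \<in> carrier_mat d d"
  proof -
    have "ptrace_left d e (kron V (1\<^sub>m e) * (g * ?a)) + ptrace_left d e (kron V (1\<^sub>m e) * (g * ?b)) =
      ptrace_left d e (kron V (1\<^sub>m e) * (?a * g)) + ptrace_left d e (kron V (1\<^sub>m e) * (?b * g))"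
      using **[of "kron V (1\<^sub>m e)"] V gc c by (simp flip: ptrace_add)
    then show ?thesis
      using V c by (simp add: left_right)
  qed
qed

private lemma add_cancel_mat:
  assumes "A + B = A + (C :: complex mat)" "A \<in> carrier_mat p q" "B \<in> carrier_mat p q" "C \<in> carrier_mat p q"
  shows "B = C"
proof (rule eq_matI)
  fix i j assume "i < dim_row C" "j < dim_col C"
  then have "(A + B) $$ (i, j) = A $$ (i, j) + B $$ (i, j)" "(A + C) $$ (i, j) = A $$ (i, j) + C $$ (i, j)"
    using assms(2-4) by auto
  then show "B $$ (i, j) = C $$ (i, j)" using assms(1) by simp
qed (use assms in auto)

text \<open>K is the right weight because the square of the antipode is conjugation by K. For
  \<xi>_i and \<xi>bar_i the unwanted first summands of \<open>primitive\<close> are matched by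
  \<open>grouplike\<close> at a suitable weight and cancelled.\<close>

lemma ptrace_right_hom: "ptrace_right d e (kron (1\<^sub>m d) (rgen Y GK) * g) \<in> module_hom n X X"
proof -
  let ?k = "rgen Y GK" and ?kb = "rgen Y GKbar"
  have "T ?k * rgen X h = rgen X h * T ?k" if h: "h \<in> gens n" for h
    using h
  proof (cases rule: gens_cases)
    case 1
    then show ?thesis using grouplike(1)[of GK "1\<^sub>m e"]
      by simp
  next
    case 2
    \<comment> \<open>At weight K Kbar, one more Kbar on either side leaves K.\<close>
    have "?k * ?kb * ?kb = ?k" "?kb * (?k * ?kb) = ?k"
      by (rule r.gen_identities)+
    then show ?thesis using 2 grouplike(1)[of GKbar "?k * ?kb"] by simp
  next
    case (3 i)
    let ?x = "rgen Y (GXi i)"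
    have x: "?x \<in> carrier_mat e e" "rgen X (GXi i) \<in> carrier_mat d d" using 3 by auto
    \<comment> \<open>The weight W = K \<xi>_i K satisfies W K = K \<xi>_i and K W = \<xi>_i K, the
      two weights in the summands to be cancelled. For \<xi>bar_i the same is done with W = K
      \<xi>bar_i Kbar.\<close>
    have "?k * ?x * ?k * ?k = ?k * ?x" "?k * (?k * ?x * ?k) = ?x * ?k"
      using x r.gen_identities(1) r.gen_identities(8)[OF 3(1)]
      by (simp_all add: assoc_mult_mat[of _ e e _ e _ e])
    then have "rgen X GK * T (?k * ?x) = T (?x * ?k) * rgen X GK"
      using x grouplike(1)[of GK "?k * ?x * ?k"] by simp
    then have "T (?x * ?k) * rgen X GK + rgen X (GXi i) * T ?k = T (?x * ?k) * rgen X GK + T ?k * rgen X (GXi i)"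
      using primitive(1)[of "GXi i" GK i ?k] 3 by simp
    then show ?thesis
      unfolding 3 by (rule add_cancel_mat[symmetric, of _ _ _ d d]) (use x in simp_all)
  next
    case (4 i)
    let ?x = "rgen Y (GXibar i)"
    have x: "?x \<in> carrier_mat e e" "rgen X (GXibar i) \<in> carrier_mat d d" using 4 by auto
    have "?k * ?x * ?kb * ?kb = ?k * ?x" "?kb * (?k * ?x * ?kb) = ?x * ?k"
      using x r.gen_identities(2) r.gen_identities(6)[OF 4(1)]
      by (simp_all add: assoc_mult_mat[of _ e e _ e _ e])
    then have "rgen X GKbar * T (?k * ?x) = T (?x * ?k) * rgen X GKbar"
      using x grouplike(1)[of GKbar "?k * ?x * ?kb"] by simp
    then have "T (?x * ?k) * rgen X GKbar + rgen X (GXibar i) * T ?k =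
        T (?x * ?k) * rgen X GKbar + T ?k * rgen X (GXibar i)"
      using primitive(1)[of "GXibar i" GKbar i ?k] 4 by simp
    then show ?thesis
      unfolding 4 by (rule add_cancel_mat[symmetric, of _ _ _ d d]) (use x in simp_all)
  qed
  then show ?thesis by (simp add: module_hom_def)
qed

text \<open>Here the term to be cancelled is the one without a generator outside the trace; it
  cancels as soon as the weight commutes with the generator inside.\<close>

lemma ptrace_left_hom: "ptrace_left d e (kron (rgen X GK) (1\<^sub>m e) * g) \<in> module_hom n Y Y"
proof -
  let ?k = "rgen X GK" and ?kb = "rgen X GKbar"
  have kkb: "?k * ?kb * ?kb = ?k" "?kb * (?k * ?kb) = ?k"
    by (rule l.gen_identities)+
  have "U ?k * rgen Y h = rgen Y h * U ?k" if h: "h \<in> gens n" for h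
    using h
  proof (cases rule: gens_cases)
    case 1
    then show ?thesis using grouplike(2)[of GK "1\<^sub>m d"]
      by simp
  next
    case 2
    then show ?thesis using kkb grouplike(2)[of GKbar "?k * ?kb"] by simp
  next
    case (3 i)
    let ?x = "rgen X (GXi i)"
    have x: "?x \<in> carrier_mat d d" "rgen Y (GXi i) \<in> carrier_mat e e" using 3 by auto
    \<comment> \<open>The weight V must give K after multiplication by h' on either side and commute
      with h. This forces V = 1 for \<xi>_i and V = K Kbar for \<xi>bar_i; the latter commutes with
      \<xi>bar_i because both of its factors anticommute with it.\<close>
    have "rgen Y (GXi i) * U ?k + U ?x = U ?k * rgen Y (GXi i) + U ?x"
      using primitive(2)[of "GXi i" GK i "1\<^sub>m d"] 3 x
      by simp
    then have "U ?x + U ?k * rgen Y (GXi i) = U ?x + rgen Y (GXi i) * U ?k"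
      using x by (simp add: comm_add_mat[of "U ?x" e e])
    then show ?thesis
      unfolding 3 by (rule add_cancel_mat[of _ _ _ e e]) (use x in simp_all)
  next
    case (4 i)
    let ?x = "rgen X (GXibar i)"
    have x: "?x \<in> carrier_mat d d" "rgen Y (GXibar i) \<in> carrier_mat e e" using 4 by auto
    have "rgen Y (GXibar i) * U ?k + U (?k * ?kb * ?x) = U ?k * rgen Y (GXibar i) + U (?k * ?kb * ?x)"
      using primitive(2)[of "GXibar i" GKbar i "?k * ?kb"] 4 x kkb l.gen_identities(7)[OF 4(1)]
      by simp
    then have "U (?k * ?kb * ?x) + U ?k * rgen Y (GXibar i) = U (?k * ?kb * ?x) + rgen Y (GXibar i) * U ?k"
      using x by (simp add: comm_add_mat[of "U (?k * ?kb * ?x)" e e])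
    then show ?thesis
      unfolding 4 by (rule add_cancel_mat[of _ _ _ e e]) (use x in simp_all)
  qed
  then show ?thesis by (simp add: module_hom_def)
qed

text \<open>Trace in stages: Y is traced out first with weight K, and f \<otimes> 1 leaves the
  partial trace as f. What remains is a module endomorphism of X, so negligibility of f passes to f
  \<otimes> 1.\<close>

lemma mtrace_kron_one:
  assumes f: "f \<in> carrier_mat d d"
  shows "mtrace (rgen (tensor_mod X Y) GK * (kron f (1\<^sub>m e) * g)) =
    mtrace (rgen X GK * (f * ptrace_right d e (kron (1\<^sub>m d) (rgen Y GK) * g)))"
proof -
  note km = kron_mult[of _ d d _ e e _ d _ e] and as = assoc_mult_mat[of _ D D _ D _ D]
  have "rgen (tensor_mod X Y) GK * (kron f (1\<^sub>m e) * g) =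
    kron (rgen X GK * f) (1\<^sub>m e) * (kron (1\<^sub>m d) (rgen Y GK) * g)"
    using f gc by (simp add: rgen_tensor km flip: as)
  moreover have "mtrace M = mtrace (ptrace_right d e M)" if "M \<in> carrier_mat D D" for M
    using mtrace_ptrace(1)[OF that] .
  ultimately show ?thesis
    using f gc by (simp add: ptrace_right_mult assoc_mult_mat[of _ d d _ d _ d])
qed

lemma mtrace_one_kron:
  assumes f: "f \<in> carrier_mat e e"
  shows "mtrace (rgen (tensor_mod X Y) GK * (kron (1\<^sub>m d) f * g)) =
    mtrace (rgen Y GK * (f * ptrace_left d e (kron (rgen X GK) (1\<^sub>m e) * g)))"
proof -
  note km = kron_mult[of _ d d _ e e _ d _ e] and as = assoc_mult_mat[of _ D D _ D _ D]
  have "rgen (tensor_mod X Y) GK * (kron (1\<^sub>m d) f * g) =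
    kron (1\<^sub>m d) (rgen Y GK * f) * (kron (rgen X GK) (1\<^sub>m e) * g)"
    using f gc by (simp add: rgen_tensor km flip: as)
  moreover have "mtrace M = mtrace (ptrace_left d e M)" if "M \<in> carrier_mat D D" for M
    using mtrace_ptrace(2)[OF that] .
  ultimately show ?thesis
    using f gc by (simp add: ptrace_left_mult assoc_mult_mat[of _ e e _ e _ e])
qed

end

end

section \<open>One-dimensional modules\<close>

text \<open>Treats the unit (s = 1) and P (s = -1) together. The relations K^2 = 1 and 1 - K Kbar =
  0, valid where \<xi>_i and \<xi>bar_i vanish, amount to s * s = 1.\<close>

definition sign_mod :: "complex \<Rightarrow> mrep" where
  "sign_mod s = Rep 1 (\<lambda>g. mat 1 1 (\<lambda>_. case g of GK \<Rightarrow> s | GKbar \<Rightarrow> s | _ \<Rightarrow> 0))"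

lemma sign_mod_simps [simp]:
  "rdim (sign_mod s) = 1" "rgen (sign_mod s) GK = s \<cdot>\<^sub>m 1\<^sub>m 1" "rgen (sign_mod s) GKbar = s \<cdot>\<^sub>m 1\<^sub>m 1"
  "rgen (sign_mod s) (GXi i) = 0\<^sub>m 1 1" "rgen (sign_mod s) (GXibar i) = 0\<^sub>m 1 1"
  by (auto simp: sign_mod_def intro!: eq_matI)

lemma unit_mod_eq: "unit_mod = sign_mod 1"
proof -
  have "counit g = (case g of GK \<Rightarrow> 1 | GKbar \<Rightarrow> 1 | _ \<Rightarrow> 0)" for g by (cases g) auto
  then show ?thesis by (simp add: unit_mod_def sign_mod_def)
qed

lemma sign_module:
  assumes "s * s = 1"
  shows "dk_module n (sign_mod s)"
proof -
  have "dk_rep n (sign_mod s)"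
    using assms by (auto simp: dk_mat_def scalar_prod_def intro!: eq_matI)
  then show ?thesis
    using dk_rep_imp_carrier_rep by (simp add: dk_module_def dk_module_axioms_def)
qed

lemma unit_module: "dk_module n unit_mod"
  unfolding unit_mod_eq by (rule sign_module) simp

lemma kron_one_one: "kron (1\<^sub>m 1) A = A" "kron A (1\<^sub>m 1) = A"
  by (auto simp: kron_def intro!: eq_matI)

lemma kron_scalar_left: "kron (s \<cdot>\<^sub>m 1\<^sub>m 1) A = s \<cdot>\<^sub>m A" "kron A (s \<cdot>\<^sub>m 1\<^sub>m 1) = s \<cdot>\<^sub>m A"
  by (simp_all add: kron_smult_left kron_smult_right kron_one_one)

lemma smult_smult_mat: "a \<cdot>\<^sub>m (b \<cdot>\<^sub>m A) = (a * b :: complex) \<cdot>\<^sub>m A"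
  by (auto intro!: eq_matI)


section \<open>Quantum traces\<close>

text \<open>In the quotient, composites are controlled for classes of module morphisms, so
  evaluation must be one. The computation rests on evaluation after the transpose of A tensor B
  being the matrix A B read as a row.\<close>

lemma ev_hom:
  assumes "dk_module n X"
  shows "mat 1 (rdim X * rdim X) (\<lambda>(_, j). if j div rdim X = j mod rdim X then 1 else 0) \<in>
    module_hom n (tensor_mod (dual_mod X) X) unit_mod"
proof -
  interpret dk_module n X by fact
  interpret p: dk_module_pair n "dual_mod X" X
    using dual_module dk_module_axioms by (intro dk_module_pair.intro)
  let ?d = "rdim X"
  let ?ev = "mat 1 (?d * ?d) (\<lambda>(_, j). if j div ?d = j mod ?d then (1::complex) else 0)"
  define vec where "vec A = mat 1 (?d * ?d) (\<lambda>(_, j). A $$ (j div ?d, j mod ?d))" for A :: "complex mat"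
  have ev: "?ev * kron (A\<^sup>T) B = vec (A * B)" if "A \<in> carrier_mat ?d ?d" "B \<in> carrier_mat ?d ?d" for A B
  proof (rule eq_matI, goal_cases)
    case (1 i j)
    then have ij: "i = 0" "j < ?d * ?d" by (auto simp: vec_def)
    note dm = div_mod_less[OF ij(2)]
    have "(?ev * kron (A\<^sup>T) B) $$ (i, j) =
      (\<Sum>a<?d. \<Sum>b<?d. ?ev $$ (i, a * ?d + b) * (A\<^sup>T $$ (a, j div ?d) * B $$ (b, j mod ?d)))"
      using that ij by (intro mult_kron_index) auto
    also have "\<dots> = (\<Sum>a<?d. \<Sum>b<?d. if b = a then A $$ (j div ?d, a) * B $$ (b, j mod ?d) else 0)"
      using that ij dm by (intro sum.cong refl) (auto simp: pair_less)
    also have "\<dots> = (A * B) $$ (j div ?d, j mod ?d)"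
      using that dm by (simp add: scalar_prod_def atLeast0LessThan)
    finally show ?case using ij by (simp add: vec_def)
  qed (use that in \<open>auto simp: vec_def\<close>)
  have c: "kron A B \<in> carrier_mat (?d * ?d) (?d * ?d)" if "A \<in> carrier_mat ?d ?d" "B \<in> carrier_mat ?d ?d" for A B
    using that by simp
  have ev1: "?ev = vec (1\<^sub>m ?d)"
    by (auto simp: vec_def div_mod_less intro!: eq_matI)
  \<comment> \<open>A is the group-like and B the skew-primitive generator. On the dual B acts by
    minus the transpose of A B, so the two summands of the coproduct cancel.\<close>
  have skew: "?ev * (kron (A\<^sup>T) B + kron (- (B\<^sup>T * A\<^sup>T)) (1\<^sub>m ?d)) = 0\<^sub>m 1 (?d * ?d)"
    if AB: "A \<in> carrier_mat ?d ?d" "B \<in> carrier_mat ?d ?d" for A B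
  proof -
    have t: "- (B\<^sup>T * A\<^sup>T) = (- (A * B))\<^sup>T"
      using AB by (simp add: transpose_uminus transpose_mult[of _ ?d ?d _ ?d])
    have "?ev * (kron (A\<^sup>T) B + kron (- (B\<^sup>T * A\<^sup>T)) (1\<^sub>m ?d)) = vec (A * B) + vec (- (A * B) * 1\<^sub>m ?d)"
      unfolding t using AB
      by (subst mult_add_distrib_mat[of _ 1 "?d * ?d" _ "?d * ?d"])
        (auto simp: ev simp del: transpose_uminus)
    also have "\<dots> = 0\<^sub>m 1 (?d * ?d)"
      using AB by (auto simp: vec_def div_mod_less intro!: eq_matI)
    finally show ?thesis .
  qed
  have "?ev * rgen (tensor_mod (dual_mod X) X) g = rgen unit_mod g * ?ev" if g: "g \<in> gens n" for g
    using g
  proof (cases rule: gens_cases)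
    case 1
    have "?ev * kron ((rgen X GK)\<^sup>T) (rgen X GK) = ?ev"
      using gen_identities ev[of "rgen X GK" "rgen X GK"] by (simp add: ev1)
    then show ?thesis by (simp add: 1 p.rgen_tensor rgen_dual unit_mod_eq one_smult_mat left_mult_one_mat[of _ 1 "?d * ?d"])
  next
    case 2
    have "?ev * kron ((rgen X GKbar)\<^sup>T) (rgen X GKbar) = ?ev"
      using gen_identities ev[of "rgen X GKbar" "rgen X GKbar"] by (simp add: ev1)
    then show ?thesis by (simp add: 2 p.rgen_tensor rgen_dual unit_mod_eq one_smult_mat left_mult_one_mat[of _ 1 "?d * ?d"])
  next
    case (3 i)
    then show ?thesis using skew[of "rgen X GK" "rgen X (GXi i)"]
      by (simp add: p.rgen_tensor rgen_dual unit_mod_eq left_mult_zero_mat[of _ 1 "?d * ?d"])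
  next
    case (4 i)
    then show ?thesis using skew[of "rgen X GKbar" "rgen X (GXibar i)"]
      by (simp add: p.rgen_tensor rgen_dual unit_mod_eq left_mult_zero_mat[of _ 1 "?d * ?d"])
  qed
  then show ?thesis by (simp add: module_hom_def unit_mod_eq)
qed

lemma coev_hom:
  assumes "dk_module n X"
  shows "mat (rdim X * rdim X) 1 (\<lambda>(i, _). if i div rdim X = i mod rdim X then 1 else 0) \<in>
    module_hom n unit_mod (tensor_mod X (dual_mod X))"
proof -
  interpret dk_module n X by fact
  interpret p: dk_module_pair n X "dual_mod X"
    using dual_module dk_module_axioms by (intro dk_module_pair.intro)
  let ?d = "rdim X"
  let ?co = "mat (?d * ?d) 1 (\<lambda>(i, _). if i div ?d = i mod ?d then (1::complex) else 0)"
  define vec where "vec A = mat (?d * ?d) 1 (\<lambda>(i, _). A $$ (i div ?d, i mod ?d))" for A :: "complex mat"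
  have co: "kron A (B\<^sup>T) * ?co = vec (A * B)" if "A \<in> carrier_mat ?d ?d" "B \<in> carrier_mat ?d ?d" for A B
  proof (rule eq_matI, goal_cases)
    case (1 i j)
    then have ij: "j = 0" "i < ?d * ?d" by (auto simp: vec_def)
    note dm = div_mod_less[OF ij(2)]
    have "(kron A (B\<^sup>T) * ?co) $$ (i, j) =
      (\<Sum>a<?d. \<Sum>b<?d. A $$ (i div ?d, a) * B\<^sup>T $$ (i mod ?d, b) * ?co $$ (a * ?d + b, j))"
      using that ij by (intro kron_mult_index) auto
    also have "\<dots> = (\<Sum>a<?d. \<Sum>b<?d. if b = a then A $$ (i div ?d, a) * B $$ (b, i mod ?d) else 0)"
      using that ij dm by (intro sum.cong refl) (auto simp: pair_less)
    also have "\<dots> = (A * B) $$ (i div ?d, i mod ?d)"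
      using that dm by (simp add: scalar_prod_def atLeast0LessThan)
    finally show ?case using ij by (simp add: vec_def)
  qed (use that in \<open>auto simp: vec_def\<close>)
  have co1: "?co = vec (1\<^sub>m ?d)"
    by (auto simp: vec_def div_mod_less intro!: eq_matI)
  \<comment> \<open>The group-like of the coproduct now meets that of the antipode, and A A = 1
    leaves -B against B.\<close>
  have skew: "(kron A (- (B\<^sup>T * A\<^sup>T)) + kron B (1\<^sub>m ?d)) * ?co = 0\<^sub>m (?d * ?d) 1"
    if AB: "A \<in> carrier_mat ?d ?d" "B \<in> carrier_mat ?d ?d" "A * A = 1\<^sub>m ?d" for A B
  proof -
    have t: "- (B\<^sup>T * A\<^sup>T) = (- (A * B))\<^sup>T"
      using AB by (simp add: transpose_uminus transpose_mult[of _ ?d ?d _ ?d])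
    have AAB: "A * (A * B) = B"
      using AB by (simp flip: assoc_mult_mat[of _ ?d ?d _ ?d _ ?d])
    have "(kron A (- (B\<^sup>T * A\<^sup>T)) + kron B ((1\<^sub>m ?d)\<^sup>T)) * ?co = vec (A * - (A * B)) + vec (B * 1\<^sub>m ?d)"
      unfolding t using AB(1,2)
      by (subst add_mult_distrib_mat[of _ "?d * ?d" "?d * ?d" _ _ 1])
        (auto simp: co simp del: transpose_uminus transpose_one)
    also have "A * - (A * B) = - B" using AB AAB by (simp add: uminus_mult_right_mat)
    also have "vec (- B) + vec (B * 1\<^sub>m ?d) = 0\<^sub>m (?d * ?d) 1"
      using AB by (auto simp: vec_def div_mod_less intro!: eq_matI)
    finally show ?thesis by simp
  qed
  have "?co * rgen unit_mod g = rgen (tensor_mod X (dual_mod X)) g * ?co" if g: "g \<in> gens n" for g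
    using g
  proof (cases rule: gens_cases)
    case 1
    have "kron (rgen X GK) ((rgen X GK)\<^sup>T) * ?co = ?co"
      using gen_identities co[of "rgen X GK" "rgen X GK"] by (simp add: co1)
    then show ?thesis by (simp add: 1 p.rgen_tensor rgen_dual unit_mod_eq one_smult_mat right_mult_one_mat[of _ "?d * ?d" 1])
  next
    case 2
    have "kron (rgen X GKbar) ((rgen X GKbar)\<^sup>T) * ?co = ?co"
      using gen_identities co[of "rgen X GKbar" "rgen X GKbar"] by (simp add: co1)
    then show ?thesis by (simp add: 2 p.rgen_tensor rgen_dual unit_mod_eq one_smult_mat right_mult_one_mat[of _ "?d * ?d" 1])
  next
    case (3 i)
    then show ?thesis using skew[of "rgen X GK" "rgen X (GXi i)"] gen_identities(1)
      by (simp add: p.rgen_tensor rgen_dual unit_mod_eq right_mult_zero_mat[of _ "?d * ?d" 1])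
  next
    case (4 i)
    then show ?thesis using skew[of "rgen X GKbar" "rgen X (GXibar i)"] gen_identities(2)
      by (simp add: p.rgen_tensor rgen_dual unit_mod_eq right_mult_zero_mat[of _ "?d * ?d" 1])
  qed
  then show ?thesis by (simp add: module_hom_def unit_mod_eq)
qed

lemma qtrace_DK_mod:
  assumes X: "dk_module n X" and n: "even n" and f: "f \<in> carrier_mat (rdim X) (rdim X)"
  shows "qtrace (DK_mod n) X f = mat 1 1 (\<lambda>_. mtrace (rgen X GK * f))"
proof -
  interpret dk_module n X by fact
  let ?d = "rdim X"
  let ?M = "act2 X (dual_mod X) (R_matrix n)"
  have M: "?M \<in> carrier_mat (?d * ?d) (?d * ?d)" by (simp add: act2_eq_mat_ext)
  have "qtrace (DK_mod n) X f = mat 1 1 (\<lambda>_. mtrace (dual_trace ?d ?M * (act X (ribbon_element n) * f)))"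
    using dual_trace_value[OF M, of "act X (ribbon_element n) * f"] f act_carrier
    by (simp add: qtrace_def DK_mod_def Let_def)
  also have "dual_trace ?d ?M * (act X (ribbon_element n) * f) = rgen X GK * f"
    using f act_carrier dual_trace_R[OF n]
    by (simp flip: assoc_mult_mat[of _ ?d ?d _ ?d _ ?d])
  finally show ?thesis .
qed

section \<open>Negligible morphisms form a tensor ideal\<close>

locale even_dk =
  fixes n :: nat
  assumes even_n: "even n"
begin

abbreviation C where "C \<equiv> DK_mod n"
abbreviation N where "N X Y f \<equiv> negligible C X Y f"

lemma DK_mod_simps [simp]:
  "Obj C = {X. dk_module n X}" "Hom C = module_hom n" "Id C X = 1\<^sub>m (rdim X)" "Comp C X Y Z g f = g * f"
  "Zero C X Y = 0\<^sub>m (rdim Y) (rdim X)" "Add C X Y f h = f + h" "Scale C X Y c f = c \<cdot>\<^sub>m f"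
  "Unit C = unit_mod" "Tens C = tensor_mod" "TensM C X X' Y Y' f h = kron f h" "Dual C = dual_mod"
  by (auto simp: DK_mod_def dk_module_iff)

lemma negligible_iff:
  assumes "dk_module n X" "dk_module n Y"
  shows "N X Y f \<longleftrightarrow> f \<in> module_hom n X Y \<and> (\<forall>g\<in>module_hom n Y X. mtrace (rgen Y GK * (f * g)) = 0)"
proof -
  have "qtrace C Y (f * g) = 0\<^sub>m (rdim unit_mod) (rdim unit_mod) \<longleftrightarrow> mtrace (rgen Y GK * (f * g)) = 0"
    if "f \<in> module_hom n X Y" "g \<in> module_hom n Y X" for g
  proof -
    have "mat 1 1 (\<lambda>_. z) = 0\<^sub>m 1 1 \<longleftrightarrow> z = 0" for z :: complex
      by (auto simp: mat_eq_iff)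
    moreover have "f * g \<in> carrier_mat (rdim Y) (rdim Y)"
      using that by (auto dest!: module_homD(1))
    ultimately show ?thesis
      using qtrace_DK_mod[OF assms(2) even_n] by (simp add: unit_mod_eq)
  qed
  then show ?thesis by (auto simp: negligible_def)
qed

text \<open>A module morphism intertwines the actions of K, so the weight changes module when the
  ordinary trace is cycled.\<close>

lemma mtrace_cyclic:
  assumes "dk_module n X" "dk_module n Y" "f \<in> module_hom n X Y" "g \<in> module_hom n Y X"
  shows "mtrace (rgen Y GK * (f * g)) = mtrace (rgen X GK * (g * f))"
proof -
  interpret X: dk_module n X by fact
  interpret Y: dk_module n Y by fact
  note c = module_homD(1)[OF assms(3)] module_homD(1)[OF assms(4)]
  have "rgen Y GK * (f * g) = rgen Y GK * f * g" "f * (rgen X GK * g) = f * rgen X GK * g"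
    using c by (simp_all add: assoc_mult_mat[of _ "rdim Y" "rdim Y" _ "rdim X" _ "rdim Y"]
        assoc_mult_mat[of _ "rdim Y" "rdim X" _ "rdim X" _ "rdim Y"])
  then have "mtrace (rgen Y GK * (f * g)) = mtrace (f * (rgen X GK * g))"
    using module_homD(2)[OF assms(3), of GK] by simp
  also have "\<dots> = mtrace (rgen X GK * g * f)"
    using c by (intro mtrace_mult_commute) auto
  finally show ?thesis
    using c by (simp add: assoc_mult_mat[of _ "rdim X" "rdim X" _ "rdim Y" _ "rdim X"])
qed

context
  fixes X Y Z assumes modules: "dk_module n X" "dk_module n Y" "dk_module n Z"
begin

lemma negligible_comp_right:
  assumes f: "N Y Z f" and h: "h \<in> module_hom n X Y"
  shows "N X Z (f * h)"
proof -
  have fh: "f \<in> module_hom n Y Z" using f modules by (simp add: negligible_iff)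
  have "mtrace (rgen Z GK * (f * h * g)) = 0" if g: "g \<in> module_hom n Z X" for g
  proof -
    have "h * g \<in> module_hom n Z Y" using g h modules by (intro module_hom_comp)
    then have "mtrace (rgen Z GK * (f * (h * g))) = 0"
      using f modules by (simp add: negligible_iff)
    then show ?thesis
      using module_homD(1)[OF fh] module_homD(1)[OF h] module_homD(1)[OF g] by simp
  qed
  then show ?thesis
    using module_hom_comp[OF modules h fh] modules by (simp add: negligible_iff)
qed

text \<open>Cyclicity of the weighted trace moves h behind f and next to the test morphism
  g.\<close>

lemma negligible_comp_left:
  assumes f: "N X Y f" and h: "h \<in> module_hom n Y Z"
  shows "N X Z (h * f)"
proof -
  have fh: "f \<in> module_hom n X Y" using f modules by (simp add: negligible_iff)
  have "mtrace (rgen Z GK * (h * f * g)) = 0" if g: "g \<in> module_hom n Z X" for g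
  proof -
    have gh: "g * h \<in> module_hom n Y X" and fg: "f * g \<in> module_hom n Z Y"
      using g h fh modules by (auto intro: module_hom_comp)
    have "mtrace (rgen Z GK * (h * f * g)) = mtrace (rgen Z GK * (h * (f * g)))"
      using module_homD(1)[OF fh] module_homD(1)[OF h] module_homD(1)[OF g] by simp
    also have "\<dots> = mtrace (rgen Y GK * (f * g * h))"
      using h fg modules by (intro mtrace_cyclic)
    also have "\<dots> = mtrace (rgen Y GK * (f * (g * h)))"
      using module_homD(1)[OF fh] module_homD(1)[OF h] module_homD(1)[OF g] by simp
    also have "\<dots> = 0"
      using f gh modules by (simp add: negligible_iff)
    finally show ?thesis .
  qed
  then show ?thesis
    using module_hom_comp[OF modules fh h] modules by (simp add: negligible_iff)
qed

end

lemma negligible_kron: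
  assumes X: "dk_module n X" and Y: "dk_module n Y"
  shows "N X X f \<Longrightarrow> N (tensor_mod X Y) (tensor_mod X Y) (kron f (1\<^sub>m (rdim Y)))"
    and "N Y Y h \<Longrightarrow> N (tensor_mod X Y) (tensor_mod X Y) (kron (1\<^sub>m (rdim X)) h)"
proof -
  interpret dk_module_pair n X Y using X Y by (rule dk_module_pair.intro)
  note T = tensor_module
  show "N (tensor_mod X Y) (tensor_mod X Y) (kron f (1\<^sub>m (rdim Y)))" if f: "N X X f"
  proof -
    have fh: "f \<in> module_hom n X X" using f X by (simp add: negligible_iff)
    have "mtrace (rgen (tensor_mod X Y) GK * (kron f (1\<^sub>m (rdim Y)) * g)) = 0"
      if g: "g \<in> module_hom n (tensor_mod X Y) (tensor_mod X Y)" for g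
      using f X mtrace_kron_one[OF g module_homD(1)[OF fh]] ptrace_right_hom[OF g]
      by (simp add: negligible_iff)
    then show ?thesis
      using T module_hom_kron[OF X X Y Y fh module_hom_one[OF Y]] by (simp add: negligible_iff)
  qed
  show "N (tensor_mod X Y) (tensor_mod X Y) (kron (1\<^sub>m (rdim X)) h)" if h: "N Y Y h"
  proof -
    have hh: "h \<in> module_hom n Y Y" using h Y by (simp add: negligible_iff)
    have "mtrace (rgen (tensor_mod X Y) GK * (kron (1\<^sub>m (rdim X)) h * g)) = 0"
      if g: "g \<in> module_hom n (tensor_mod X Y) (tensor_mod X Y)" for g
      using h Y mtrace_one_kron[OF g module_homD(1)[OF hh]] ptrace_left_hom[OF g]
      by (simp add: negligible_iff)
    then show ?thesis
      using T module_hom_kron[OF X X Y Y module_hom_one[OF X] hh] by (simp add: negligible_iff)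
  qed
qed

lemma negligible_add:
  assumes XY: "dk_module n X" "dk_module n Y" and f: "N X Y f" and h: "N X Y h"
  shows "N X Y (f + h)"
proof -
  have fh: "f \<in> module_hom n X Y" "h \<in> module_hom n X Y"
    using f h XY by (simp_all add: negligible_iff)
  note fc = module_homD(1)[OF fh(1)] and hc = module_homD(1)[OF fh(2)]
  interpret Y: dk_module n Y by fact
  have "mtrace (rgen Y GK * ((f + h) * g)) = 0" if g: "g \<in> module_hom n Y X" for g
  proof -
    note gc = module_homD(1)[OF g]
    have "rgen Y GK * ((f + h) * g) = rgen Y GK * (f * g) + rgen Y GK * (h * g)"
      using fc hc gc by (simp add: add_mult_distrib_mat[of _ "rdim Y" "rdim X" _ _ "rdim Y"]
          mult_add_distrib_mat[of _ "rdim Y" "rdim Y" _ "rdim Y"] mult_carrier_mat[of _ "rdim Y" "rdim X"])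
    then show ?thesis
      using f h g XY fc hc gc
      by (simp add: negligible_iff mtrace_add[of _ "rdim Y"] mult_carrier_mat[of _ "rdim Y" "rdim X"])
  qed
  then show ?thesis using XY fh by (simp add: negligible_iff module_hom_add)
qed

lemma negligible_smult:
  assumes XY: "dk_module n X" "dk_module n Y" and f: "N X Y f"
  shows "N X Y (c \<cdot>\<^sub>m f)"
proof -
  have fh: "f \<in> module_hom n X Y" using f XY by (simp add: negligible_iff)
  interpret Y: dk_module n Y by fact
  note fc = module_homD(1)[OF fh]
  have "mtrace (rgen Y GK * (c \<cdot>\<^sub>m f * g)) = 0" if g: "g \<in> module_hom n Y X" for g
  proof -
    note gc = module_homD(1)[OF g]
    have "rgen Y GK * (c \<cdot>\<^sub>m f * g) = c \<cdot>\<^sub>m (rgen Y GK * (f * g))"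
      using fc gc by (simp add: mult_smult_assoc_mat[of _ "rdim Y" "rdim X" _ "rdim Y"]
          mult_smult_distrib[of _ "rdim Y" "rdim Y" _ "rdim Y"] mult_carrier_mat[of _ "rdim Y" "rdim X"])
    then show ?thesis
      using f g XY fc gc
      by (simp add: negligible_iff mtrace_smult[of _ "rdim Y"] mult_carrier_mat[of _ "rdim Y" "rdim X"])
  qed
  then show ?thesis using XY fh by (simp add: negligible_iff module_hom_smult)
qed

lemma negligible_zero:
  assumes XY: "dk_module n X" "dk_module n Y"
  shows "N X Y (0\<^sub>m (rdim Y) (rdim X))"
proof -
  interpret Y: dk_module n Y by fact
  have "0\<^sub>m (rdim Y) (rdim X) \<in> module_hom n X Y"
    by (rule module_hom_zero[OF XY])
  moreover have "mtrace (rgen Y GK * (0\<^sub>m (rdim Y) (rdim X) * g)) = 0" if "g \<in> module_hom n Y X" for g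
    using module_homD(1)[OF that]
    by (simp add: left_mult_zero_mat[of _ "rdim X" "rdim Y"] mtrace_def)
  ultimately show ?thesis using XY by (simp add: negligible_iff)
qed

end

context even_dk
begin

section \<open>The semi-simplification\<close>

abbreviation cls where "cls \<equiv> neg_class C"
abbreviation S where "S \<equiv> semisimplification C"

lemma cls_def: "cls X Y f = {g \<in> module_hom n X Y. N X Y (g + (- 1) \<cdot>\<^sub>m f)}"
  by (simp add: neg_class_def Diff_def)

lemma S_simps [simp]:
  "Obj S = {X. dk_module n X \<and> quasi_dominated C X}"
  "Hom S X Y = cls X Y ` module_hom n X Y"
  "Id S X = cls X X (1\<^sub>m (rdim X))"
  "Zero S X Y = cls X Y (0\<^sub>m (rdim Y) (rdim X))"
  "Unit S = unit_mod" "Tens S = tensor_mod" "Dual S = dual_mod"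
  "Twist S X = cls X X (act X (ribbon_element n))"
  "Braid S X Y = cls (tensor_mod X Y) (tensor_mod Y X) (Braid C X Y)"
  "Ev S X = cls (tensor_mod (dual_mod X) X) unit_mod (Ev C X)"
  "Coev S X = cls unit_mod (tensor_mod X (dual_mod X)) (Coev C X)"
  by (simp_all add: semisimplification_def) (simp add: DK_mod_def)

context
  fixes X Y assumes XY: "dk_module n X" "dk_module n Y"
begin

lemma cls_self:
  assumes "f \<in> module_hom n X Y"
  shows "f \<in> cls X Y f"
proof -
  have "f + (- 1) \<cdot>\<^sub>m f = 0\<^sub>m (rdim Y) (rdim X)"
    using module_homD(1)[OF assms] by auto
  then show ?thesis
    using assms negligible_zero[OF XY] by (simp add: cls_def)
qed

lemma cls_eqI:
  assumes f: "f \<in> module_hom n X Y" and g: "g \<in> module_hom n X Y" and fg: "N X Y (g + (- 1) \<cdot>\<^sub>m f)"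
  shows "cls X Y g = cls X Y f"
proof -
  note fc = module_homD(1)[OF f] and gc = module_homD(1)[OF g]
  have "N X Y (h + (- 1) \<cdot>\<^sub>m g) \<longleftrightarrow> N X Y (h + (- 1) \<cdot>\<^sub>m f)" if h: "h \<in> module_hom n X Y" for h
  proof
    note hc = module_homD(1)[OF h]
    assume "N X Y (h + (- 1) \<cdot>\<^sub>m g)"
    then have "N X Y (h + (- 1) \<cdot>\<^sub>m g + (g + (- 1) \<cdot>\<^sub>m f))"
      using fg by (rule negligible_add[OF XY])
    also have "h + (- 1) \<cdot>\<^sub>m g + (g + (- 1) \<cdot>\<^sub>m f) = h + (- 1) \<cdot>\<^sub>m f"
      using fc gc hc by (auto intro!: eq_matI)
    finally show "N X Y (h + (- 1) \<cdot>\<^sub>m f)" .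
  next
    note hc = module_homD(1)[OF h]
    assume "N X Y (h + (- 1) \<cdot>\<^sub>m f)"
    then have "N X Y (h + (- 1) \<cdot>\<^sub>m f + (- 1) \<cdot>\<^sub>m (g + (- 1) \<cdot>\<^sub>m f))"
      by (rule negligible_add[OF XY _ negligible_smult[OF XY fg]])
    also have "h + (- 1) \<cdot>\<^sub>m f + (- 1) \<cdot>\<^sub>m (g + (- 1) \<cdot>\<^sub>m f) = h + (- 1) \<cdot>\<^sub>m g"
      using fc gc hc by (auto intro!: eq_matI)
    finally show "N X Y (h + (- 1) \<cdot>\<^sub>m g)" .
  qed
  then show ?thesis by (auto simp: cls_def)
qed

lemma cls_member:
  assumes "f \<in> module_hom n X Y" "g \<in> cls X Y f"
  shows "g \<in> module_hom n X Y" "cls X Y g = cls X Y f" "N X Y (g + (- 1) \<cdot>\<^sub>m f)"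
  using assms cls_eqI by (auto simp: cls_def)

lemma cls_eqD:
  assumes "f \<in> module_hom n X Y" "g \<in> module_hom n X Y" "cls X Y g = cls X Y f"
  shows "N X Y (g + (- 1) \<cdot>\<^sub>m f)"
  using cls_self[OF assms(2)] assms(1,3) cls_member(3) by blast

end

lemma diff_mult_left:
  assumes "g \<in> carrier_mat a b" "g' \<in> carrier_mat a b" "f \<in> carrier_mat b c"
  shows "g' * f + (- 1) \<cdot>\<^sub>m (g * f) = (g' + (- 1 :: complex) \<cdot>\<^sub>m g) * f"
  using assms by (simp add: add_mult_distrib_mat[of _ a b _ _ c] mult_smult_assoc_mat[of _ a b _ c])

lemma diff_mult_right:
  assumes "g \<in> carrier_mat a b" "f \<in> carrier_mat b c" "f' \<in> carrier_mat b c"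
  shows "g * f' + (- 1) \<cdot>\<^sub>m (g * f) = g * (f' + (- 1 :: complex) \<cdot>\<^sub>m f)"
  using assms by (simp add: mult_add_distrib_mat[of _ a b _ c] mult_smult_distrib[of _ a b _ c])

text \<open>The union over representatives is a single class: g' f' - g f = (g' - g) f' + g (f' - f)
  is negligible, and the classes are nonempty.\<close>

lemma comp_cls:
  assumes m: "dk_module n X" "dk_module n Y" "dk_module n Z"
    and f: "f \<in> module_hom n X Y" and g: "g \<in> module_hom n Y Z"
  shows "Comp S X Y Z (cls Y Z g) (cls X Y f) = cls X Z (g * f)"
proof -
  have "cls X Z (g' * f') = cls X Z (g * f)" if g': "g' \<in> cls Y Z g" and f': "f' \<in> cls X Y f" for g' f'
  proof -
    note gh = cls_member[OF m(2,3) g g'] and fh = cls_member[OF m(1,2) f f']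
    note c = module_homD(1)[OF f] module_homD(1)[OF g] module_homD(1)[OF fh(1)] module_homD(1)[OF gh(1)]
    have "N X Z (g' * f' + (- 1) \<cdot>\<^sub>m (g * f'))"
      unfolding diff_mult_left[OF c(2,4,3)] using gh(3) fh(1) by (rule negligible_comp_right[OF m])
    then have "cls X Z (g' * f') = cls X Z (g * f')"
      using m gh fh g by (intro cls_eqI module_hom_comp[of n X Y Z])
    moreover have "N X Z (g * f' + (- 1) \<cdot>\<^sub>m (g * f))"
      unfolding diff_mult_right[OF c(2,1,3)] using fh(3) g by (rule negligible_comp_left[OF m])
    then have "cls X Z (g * f') = cls X Z (g * f)"
      using m gh fh f g by (intro cls_eqI module_hom_comp[of n X Y Z])
    ultimately show ?thesis by simp
  qed
  then have "(\<Union>g'\<in>cls Y Z g. \<Union>f'\<in>cls X Y f. cls X Z (g' * f')) =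
      (\<Union>g'\<in>cls Y Z g. \<Union>f'\<in>cls X Y f. cls X Z (g * f))"
    by (intro SUP_cong refl)
  moreover have "g \<in> cls Y Z g" "f \<in> cls X Y f"
    using m f g by (auto intro: cls_self)
  then have "(\<Union>g'\<in>cls Y Z g. \<Union>f'\<in>cls X Y f. cls X Z (g * f)) = cls X Z (g * f)"
    by blast
  ultimately show ?thesis
    by (simp add: semisimplification_def)
qed

lemma kron_diff:
  assumes "A \<in> carrier_mat a a" "A' \<in> carrier_mat a a" "B \<in> carrier_mat b b" "B' \<in> carrier_mat b b"
  shows "kron A' B + (- 1 :: complex) \<cdot>\<^sub>m kron A B = kron (A' + (- 1) \<cdot>\<^sub>m A) B"
    and "kron A B' + (- 1 :: complex) \<cdot>\<^sub>m kron A B = kron A (B' + (- 1) \<cdot>\<^sub>m B)"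
  using assms
  by (simp_all add: kron_add_left[of _ a a] kron_add_right[of _ b b] kron_smult_left kron_smult_right)

text \<open>Stated for endomorphisms, the form that \<open>qtrace\<close> uses. A difference (f' -
  f) \<otimes> g' is ((f' - f) \<otimes> 1)(1 \<otimes> g'), so closure under tensoring with
  identities and under composition is enough.\<close>

lemma kron_cls:
  assumes m: "dk_module n X" "dk_module n Y"
    and f: "f \<in> module_hom n X X" and g: "g \<in> module_hom n Y Y"
  shows "TensM S X X Y Y (cls X X f) (cls Y Y g) = cls (tensor_mod X Y) (tensor_mod X Y) (kron f g)"
proof -
  let ?T = "tensor_mod X Y"
  interpret dk_module_pair n X Y using m by (rule dk_module_pair.intro)
  note T = tensor_module
  let ?d = "rdim X" and ?e = "rdim Y"
  note km = kron_mult[of _ ?d ?d _ ?e ?e _ ?d _ ?e]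
  have "cls ?T ?T (kron f' g') = cls ?T ?T (kron f g)" if f': "f' \<in> cls X X f" and g': "g' \<in> cls Y Y g" for f' g'
  proof -
    note gh = cls_member[OF m(2) m(2) g g'] and fh = cls_member[OF m(1) m(1) f f']
    note c = module_homD(1)[OF f] module_homD(1)[OF g] module_homD(1)[OF fh(1)] module_homD(1)[OF gh(1)]
    have k: "kron a b \<in> module_hom n ?T ?T" if "a \<in> module_hom n X X" "b \<in> module_hom n Y Y" for a b
      using that m by (intro module_hom_kron)
    have "kron (f' + (- 1) \<cdot>\<^sub>m f) g' = kron (f' + (- 1) \<cdot>\<^sub>m f) (1\<^sub>m ?e) * kron (1\<^sub>m ?d) g'"
      using c by (simp add: km)
    then have "N ?T ?T (kron f' g' + (- 1) \<cdot>\<^sub>m kron f g')"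
      unfolding kron_diff(1)[OF c(1,3,4,4)]
      using negligible_comp_right[OF T T T negligible_kron(1)[OF m fh(3)] k[OF module_hom_one[OF m(1)] gh(1)]]
      by simp
    then have 1: "cls ?T ?T (kron f' g') = cls ?T ?T (kron f g')"
      using T f fh(1) gh(1) by (intro cls_eqI k)
    have "kron f (g' + (- 1) \<cdot>\<^sub>m g) = kron f (1\<^sub>m ?e) * kron (1\<^sub>m ?d) (g' + (- 1) \<cdot>\<^sub>m g)"
      using c by (simp add: km)
    then have "N ?T ?T (kron f g' + (- 1) \<cdot>\<^sub>m kron f g)"
      unfolding kron_diff(2)[OF c(1,1,2,4)]
      using negligible_comp_left[OF T T T negligible_kron(2)[OF m gh(3)] k[OF f module_hom_one[OF m(2)]]]
      by simp
    then have 2: "cls ?T ?T (kron f g') = cls ?T ?T (kron f g)"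
      using T f g gh(1) by (intro cls_eqI k)
    from 1 2 show ?thesis by simp
  qed
  then have "(\<Union>f'\<in>cls X X f. \<Union>g'\<in>cls Y Y g. cls ?T ?T (kron f' g')) =
      (\<Union>f'\<in>cls X X f. \<Union>g'\<in>cls Y Y g. cls ?T ?T (kron f g))"
    by (intro SUP_cong refl)
  moreover have "g \<in> cls Y Y g" "f \<in> cls X X f"
    using m f g by (auto intro: cls_self)
  then have "(\<Union>f'\<in>cls X X f. \<Union>g'\<in>cls Y Y g. cls ?T ?T (kron f g)) = cls ?T ?T (kron f g)"
    by blast
  ultimately show ?thesis
    by (simp add: semisimplification_def)
qed

lemma braid_eq: "Braid C X Y = flip_mat (rdim X) (rdim Y) * act2 X Y (R_matrix n)"
  by (simp add: DK_mod_def)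

lemma braid_hom:
  "dk_module n X \<Longrightarrow> dk_module n Y \<Longrightarrow> Braid C X Y \<in> module_hom n (tensor_mod X Y) (tensor_mod Y X)"
  unfolding braid_eq by (rule dk_module_pair.braid_hom) (rule dk_module_pair.intro)

lemma tensor_module: "dk_module n X \<Longrightarrow> dk_module n Y \<Longrightarrow> dk_module n (tensor_mod X Y)"
  by (rule dk_module_pair.tensor_module) (rule dk_module_pair.intro)

text \<open>Each ingredient of \<open>qtrace\<close> in the quotient is the class of the
  corresponding module morphism, and so is every partial composite; hence the whole is the class of
  the quantum trace before the quotient.\<close>

lemma qtrace_cls:
  assumes X: "dk_module n X" and f: "f \<in> module_hom n X X"
  shows "qtrace S X (cls X X f) = cls unit_mod unit_mod (mat 1 1 (\<lambda>_. mtrace (rgen X GK * f)))"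
proof -
  let ?D = "dual_mod X" and ?I = unit_mod and ?t = "act X (ribbon_element n)"
  have D: "dk_module n ?D" using X by (rule dk_module.dual_module)
  note I = unit_module[of n]
  note P = tensor_module[OF X D] and Q = tensor_module[OF D X]
  have t: "?t \<in> module_hom n X X" using X by (rule dk_module.twist_hom)
  then have tf: "?t * f \<in> module_hom n X X" using X f by (intro module_hom_comp)
  have one: "1\<^sub>m (rdim ?D) \<in> module_hom n ?D ?D" using D by (rule module_hom_one)
  have k: "kron (?t * f) (1\<^sub>m (rdim ?D)) \<in> module_hom n (tensor_mod X ?D) (tensor_mod X ?D)"
    by (rule module_hom_kron[OF X X D D tf one])
  have co: "Coev C X \<in> module_hom n ?I (tensor_mod X ?D)" and ev: "Ev C X \<in> module_hom n (tensor_mod ?D X) ?I"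
    using coev_hom[OF X] ev_hom[OF X] by (simp_all add: DK_mod_def)
  note b = braid_hom[OF X D]
  note kc = module_hom_comp[OF I P P co k]
  note bkc = module_hom_comp[OF I P Q kc b]
  have "qtrace S X (cls X X f) = cls ?I ?I (Ev C X * (Braid C X ?D * (kron (?t * f) (1\<^sub>m (rdim ?D)) * Coev C X)))"
    unfolding qtrace_def Let_def
    using comp_cls[OF X X X f t] kron_cls[OF X D tf one] comp_cls[OF I P P co k] comp_cls[OF I P Q kc b]
      comp_cls[OF I Q I bkc ev]
    by simp
  also have "Ev C X * (Braid C X ?D * (kron (?t * f) (1\<^sub>m (rdim ?D)) * Coev C X)) = qtrace C X f"
    by (simp add: qtrace_def Let_def) (simp add: DK_mod_def)
  finally show ?thesis
    using qtrace_DK_mod[OF X even_n module_homD(1)[OF f]] by simp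
qed

lemma scalar_hom: "mat 1 1 (\<lambda>_. z) \<in> module_hom n unit_mod unit_mod"
proof -
  have "mat 1 1 (\<lambda>_. z) = z \<cdot>\<^sub>m 1\<^sub>m (rdim unit_mod)" by (auto simp: unit_mod_eq intro!: eq_matI)
  then show ?thesis
    using module_hom_smult[OF unit_module unit_module module_hom_one[OF unit_module]] by simp
qed

text \<open>A scalar endomorphism of the unit with nonzero scalar is not negligible, as its trace is
  that scalar. So different scalars stay different in the quotient and the description in
  \<open>scalar_of\<close> picks out z.\<close>

lemma scalar_of_cls: "scalar_of S (cls unit_mod unit_mod (mat 1 1 (\<lambda>_. z))) = z"
proof -
  let ?I = unit_mod
  note I = unit_module[of n]
  have scale: "Scale S ?I ?I c (Id S ?I) = cls ?I ?I (mat 1 1 (\<lambda>_. c))" for c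
  proof -
    let ?one = "1\<^sub>m (rdim ?I)"
    note one = module_hom_one[OF I]
    have c1: "c \<cdot>\<^sub>m ?one = mat 1 1 (\<lambda>_. c)" by (auto simp: unit_mod_eq intro!: eq_matI)
    have "cls ?I ?I (c \<cdot>\<^sub>m f) = cls ?I ?I (c \<cdot>\<^sub>m ?one)" if f: "f \<in> cls ?I ?I ?one" for f
    proof (rule cls_eqI[OF I I])
      note fh = cls_member[OF I I one f]
      show "c \<cdot>\<^sub>m ?one \<in> module_hom n ?I ?I" "c \<cdot>\<^sub>m f \<in> module_hom n ?I ?I"
        using one fh(1) I by (auto intro: module_hom_smult)
      have "c \<cdot>\<^sub>m f + - 1 \<cdot>\<^sub>m (c \<cdot>\<^sub>m ?one) = c \<cdot>\<^sub>m (f + - 1 \<cdot>\<^sub>m ?one)"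
        using module_homD(1)[OF fh(1)] by (auto simp: algebra_simps intro!: eq_matI)
      then show "N ?I ?I (c \<cdot>\<^sub>m f + - 1 \<cdot>\<^sub>m (c \<cdot>\<^sub>m ?one))"
        using negligible_smult[OF I I fh(3)] by simp
    qed
    then have "(\<Union>f\<in>cls ?I ?I ?one. cls ?I ?I (c \<cdot>\<^sub>m f)) =
        (\<Union>f\<in>cls ?I ?I ?one. cls ?I ?I (c \<cdot>\<^sub>m ?one))"
      by (intro SUP_cong refl)
    also have "\<dots> = cls ?I ?I (c \<cdot>\<^sub>m ?one)"
      using cls_self[OF I I one] by blast
    finally show ?thesis
      unfolding c1[symmetric] by (simp add: semisimplification_def)
  qed
  have eq: "cls ?I ?I (mat 1 1 (\<lambda>_. z)) = cls ?I ?I (mat 1 1 (\<lambda>_. c)) \<longleftrightarrow> z = c" for c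
  proof
    assume "cls ?I ?I (mat 1 1 (\<lambda>_. z)) = cls ?I ?I (mat 1 1 (\<lambda>_. c))"
    then have "N ?I ?I (mat 1 1 (\<lambda>_. z) + (- 1) \<cdot>\<^sub>m mat 1 1 (\<lambda>_. c))"
      by (intro cls_eqD[OF I I] scalar_hom)
    also have "mat 1 1 (\<lambda>_. z) + (- 1) \<cdot>\<^sub>m mat 1 1 (\<lambda>_. c) = mat 1 1 (\<lambda>_. z - c)"
      by (auto intro!: eq_matI)
    finally have "mtrace (rgen ?I GK * (mat 1 1 (\<lambda>_. z - c) * 1\<^sub>m (rdim ?I))) = 0"
      using module_hom_one[OF I] I by (simp add: negligible_iff)
    then show "z = c"
      by (simp add: unit_mod_eq mtrace_def one_smult_mat scalar_prod_def)
  qed simp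
  show ?thesis
    unfolding scalar_of_def S_simps(5) scale eq by simp
qed

section \<open>Hopf links in the quotient\<close>

definition double_braid where
  "double_braid X Y = Braid C Y X * Braid C X Y"

lemma double_braid_hom:
  "dk_module n X \<Longrightarrow> dk_module n Y \<Longrightarrow> double_braid X Y \<in> module_hom n (tensor_mod X Y) (tensor_mod X Y)"
  unfolding double_braid_def
  by (rule module_hom_comp[OF tensor_module tensor_module tensor_module braid_hom braid_hom])

lemma hopf_link_S:
  assumes X: "dk_module n X" and Y: "dk_module n Y"
  shows "hopf_link S X Y = mtrace (rgen (tensor_mod X Y) GK * double_braid X Y)"
proof -
  note T = tensor_module[OF X Y] and T' = tensor_module[OF Y X]
  show ?thesis
    using comp_cls[OF T T' T braid_hom[OF X Y] braid_hom[OF Y X]]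
      qtrace_cls[OF T double_braid_hom[OF X Y]]
    by (simp add: hopf_link_def scalar_of_cls double_braid_def)
qed

end

section \<open>Naturality of the braiding\<close>

text \<open>Morphisms intertwine the generators and therefore everything built from them; the
  induction follows the factors of R.\<close>

lemma act2_R_natural:
  assumes m: "dk_module n X" "dk_module n X'" "dk_module n Y" "dk_module n Y'"
    and f: "f \<in> module_hom n X X'" and h: "h \<in> module_hom n Y Y'"
  shows "act2 X' Y' (R_matrix n) * kron f h = kron f h * act2 X Y (R_matrix n)"
proof -
  interpret X: dk_module n X by fact
  interpret X': dk_module n X' by fact
  interpret Y: dk_module n Y by fact
  interpret Y': dk_module n Y' by fact
  interpret p: dk_module_pair n X Y ..
  interpret p': dk_module_pair n X' Y' ..
  let ?d = "rdim X" and ?d' = "rdim X'" and ?e = "rdim Y" and ?e' = "rdim Y'"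
  let ?D = "?d * ?e" and ?D' = "?d' * ?e'"
  note fc = module_homD(1)[OF f] and hc = module_homD(1)[OF h]
  have c: "kron f h \<in> carrier_mat ?D' ?D" using fc hc by simp
  note step = intertwine_kron[OF _ _ fc hc] and arith = intertwine_arith[OF _ _ c]
  have one: "f * 1\<^sub>m ?d = 1\<^sub>m ?d' * f" "h * 1\<^sub>m ?e = 1\<^sub>m ?e' * h" using fc hc by simp_all
  have gen: "f * rgen X g = rgen X' g * f" "h * rgen Y g = rgen Y' g * h" if "g \<in> gens n" for g
    using module_homD(2)[OF f that] module_homD(2)[OF h that] by simp_all
  have prod: "kron f h * rmat_prod X Y m = rmat_prod X' Y' m * kron f h" if "m \<le> n" for m
    using that
  proof (induction m)
    case 0
    show ?case using c by (simp add: left_mult_one_mat[of _ ?D' ?D] right_mult_one_mat[of _ ?D' ?D])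
  next
    case (Suc m)
    then have i: "Suc m \<in> {1..n}" by auto
    have "h * (rgen Y (GXibar (Suc m)) * rgen Y GKbar) = rgen Y' (GXibar (Suc m)) * rgen Y' GKbar * h"
      using hc i by (intro intertwine_arith(3) gen(2)) auto
    then have "kron f h * kron (rgen X (GXi (Suc m))) (rgen Y (GXibar (Suc m)) * rgen Y GKbar) =
        kron (rgen X' (GXi (Suc m))) (rgen Y' (GXibar (Suc m)) * rgen Y' GKbar) * kron f h"
      using i gen(1)[of "GXi (Suc m)"] by (intro step) auto
    then show ?case
      unfolding rmat_prod.simps
      using Suc i p.rmat_prod_carrier[of m] p'.rmat_prod_carrier[of m]
      by (intro arith) auto
  qed
  have cartan: "kron f h * rmat_cartan X Y = rmat_cartan X' Y' * kron f h"
    unfolding rmat_cartan_def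
    by (intro arith step one gen; simp add: minus_carrier_mat)
  have "kron f h * (rmat_prod X Y n * rmat_cartan X Y) = rmat_prod X' Y' n * rmat_cartan X' Y' * kron f h"
    using p.rmat_prod_carrier[of n] p'.rmat_prod_carrier[of n] p.rmat_cartan_carrier p'.rmat_cartan_carrier
    by (intro arith prod cartan) auto
  then show ?thesis
    unfolding p.act2_R_matrix p'.act2_R_matrix
    using c p.rmat_prod_carrier[of n] p'.rmat_prod_carrier[of n] p.rmat_cartan_carrier p'.rmat_cartan_carrier
    by (simp add: mult_smult_assoc_mat[of _ ?D' ?D' _ ?D] mult_smult_distrib[of _ ?D' ?D _ ?D])
qed

context even_dk
begin

lemma braid_carrier: "Braid C X Y \<in> carrier_mat (rdim Y * rdim X) (rdim X * rdim Y)"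
  unfolding braid_eq act2_eq_mat_ext by (intro mult_carrier_mat[of _ _ "rdim X * rdim Y"]) auto

lemma braid_natural:
  assumes m: "dk_module n X" "dk_module n X'" "dk_module n Y" "dk_module n Y'"
    and f: "f \<in> module_hom n X X'" and h: "h \<in> module_hom n Y Y'"
  shows "Braid C X' Y' * kron f h = kron h f * Braid C X Y"
proof -
  let ?d = "rdim X" and ?d' = "rdim X'" and ?e = "rdim Y" and ?e' = "rdim Y'"
  let ?D = "?d * ?e" and ?D' = "?d' * ?e'"
  note fc = module_homD(1)[OF f] and hc = module_homD(1)[OF h]
  have c: "kron f h \<in> carrier_mat ?D' ?D" "kron h f \<in> carrier_mat (?e' * ?d') (?e * ?d)" using fc hc by simp_all
  have R: "act2 X Y (R_matrix n) \<in> carrier_mat ?D ?D" "act2 X' Y' (R_matrix n) \<in> carrier_mat ?D' ?D'"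
    by (simp_all add: act2_eq_mat_ext)
  have "Braid C X' Y' * kron f h = flip_mat ?d' ?e' * (kron f h * act2 X Y (R_matrix n))"
    unfolding braid_eq using c R act2_R_natural[OF m f h]
    by (simp add: assoc_mult_mat[of _ "?e' * ?d'" ?D' _ ?D' _ ?D])
  also have "\<dots> = kron h f * flip_mat ?d ?e * act2 X Y (R_matrix n)"
    using c R flip_kron[OF fc hc] by (simp flip: assoc_mult_mat[of _ "?e' * ?d'" ?D' _ ?D _ ?D])
  also have "\<dots> = kron h f * Braid C X Y"
    unfolding braid_eq using c R by (simp add: assoc_mult_mat[of _ "?e' * ?d'" "?e * ?d" _ ?D _ ?D])
  finally show ?thesis .
qed

lemma double_braid_natural:
  assumes m: "dk_module n X" "dk_module n X'" "dk_module n Z" and f: "f \<in> module_hom n X X'"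
  shows "double_braid X' Z * kron f (1\<^sub>m (rdim Z)) = kron f (1\<^sub>m (rdim Z)) * double_braid X Z"
proof -
  let ?d = "rdim X" and ?d' = "rdim X'" and ?e = "rdim Z"
  let ?D = "?d * ?e" and ?D' = "?d' * ?e"
  note fc = module_homD(1)[OF f] and one = module_hom_one[OF m(3)]
  note b = braid_carrier[of X Z] braid_carrier[of Z X] braid_carrier[of X' Z] braid_carrier[of Z X']
  have c: "kron f (1\<^sub>m ?e) \<in> carrier_mat ?D' ?D" "kron (1\<^sub>m ?e) f \<in> carrier_mat (?e * ?d') (?e * ?d)"
    using fc by simp_all
  have "double_braid X' Z * kron f (1\<^sub>m ?e) = Braid C Z X' * (Braid C X' Z * kron f (1\<^sub>m ?e))"
    unfolding double_braid_def using c b by (simp add: assoc_mult_mat[of _ ?D' "?e * ?d'" _ ?D' _ ?D])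
  also have "\<dots> = Braid C Z X' * kron (1\<^sub>m ?e) f * Braid C X Z"
    unfolding braid_natural[OF m(1,2,3,3) f one]
    using c b by (simp add: assoc_mult_mat[of _ ?D' "?e * ?d'" _ "?e * ?d" _ ?D])
  also have "\<dots> = kron f (1\<^sub>m ?e) * double_braid X Z"
    unfolding braid_natural[OF m(3,3,1,2) one f] double_braid_def
    using c b by (simp add: assoc_mult_mat[of _ ?D' ?D _ "?e * ?d" _ ?D])
  finally show ?thesis .
qed

text \<open>(h - 1) \<otimes> 1 is negligible by the tensor ideal property, so its pairing with b
  vanishes.\<close>

lemma trace_kron_negligible:
  assumes m: "dk_module n X" "dk_module n Z" and h: "h \<in> module_hom n X X"
    and N: "N X X (h + (- 1) \<cdot>\<^sub>m 1\<^sub>m (rdim X))"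
    and b: "b \<in> module_hom n (tensor_mod X Z) (tensor_mod X Z)"
  shows "mtrace (rgen (tensor_mod X Z) GK * (kron h (1\<^sub>m (rdim Z)) * b)) =
    mtrace (rgen (tensor_mod X Z) GK * b)"
proof -
  let ?T = "tensor_mod X Z" and ?D = "rdim X * rdim Z"
  let ?k = "rgen ?T GK" and ?h = "kron h (1\<^sub>m (rdim Z))"
  note T = tensor_module[OF m]
  note hc = module_homD(1)[OF h] and bc = module_homD(1)[OF b, simplified]
  have kc: "?k \<in> carrier_mat ?D ?D"
    using carrier_rep.rgen_carrier[OF dk_module.axioms(1)[OF T], of GK] by simp
  have hc': "?h \<in> carrier_mat ?D ?D" using hc by simp
  have 1: "kron (h + (- 1) \<cdot>\<^sub>m 1\<^sub>m (rdim X)) (1\<^sub>m (rdim Z)) = ?h + (- 1) \<cdot>\<^sub>m 1\<^sub>m ?D"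
    using hc by (simp add: kron_add_left[of _ "rdim X" "rdim X"] kron_smult_left kron_one)
  have "0 = mtrace (?k * (kron (h + (- 1) \<cdot>\<^sub>m 1\<^sub>m (rdim X)) (1\<^sub>m (rdim Z)) * b))"
    using negligible_kron(1)[OF m N] T b by (simp add: negligible_iff)
  also have "?k * (kron (h + (- 1) \<cdot>\<^sub>m 1\<^sub>m (rdim X)) (1\<^sub>m (rdim Z)) * b) = ?k * (?h * b) + (- 1) \<cdot>\<^sub>m (?k * b)"
    unfolding 1 using hc' bc kc
    by (simp add: add_mult_distrib_mat[of _ ?D ?D _ _ ?D] mult_add_distrib_mat[of _ ?D ?D _ ?D]
        mult_smult_assoc_mat[of _ ?D ?D _ ?D] mult_smult_distrib[of _ ?D ?D _ ?D])
  also have "mtrace \<dots> = mtrace (?k * (?h * b)) - mtrace (?k * b)"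
    using hc' bc kc by (simp add: mtrace_add[of _ ?D] mtrace_smult[of _ ?D])
  finally show ?thesis by simp
qed

text \<open>With f and g inverse up to negligible morphisms, g f may be inserted next to the double
  braiding b. Naturality moves f across b, cyclicity moves g to the other end, and f g is then
  removed again.\<close>

lemma hopf_link_iso:
  assumes m: "dk_module n X" "dk_module n X'" "dk_module n Z" and iso: "isomorphic S X X'"
  shows "hopf_link S X Z = hopf_link S X' Z"
proof -
  obtain f g where f: "f \<in> module_hom n X X'" and g: "g \<in> module_hom n X' X"
    and "Comp S X X' X (cls X' X g) (cls X X' f) = Id S X" "Comp S X' X X' (cls X X' f) (cls X' X g) = Id S X'"
    using iso by (auto simp: isomorphic_def is_iso_def)
  then have eq: "cls X X (g * f) = cls X X (1\<^sub>m (rdim X))" "cls X' X' (f * g) = cls X' X' (1\<^sub>m (rdim X'))"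
    using m by (simp_all add: comp_cls)
  note gf = module_hom_comp[OF m(1,2,1) f g] and fg = module_hom_comp[OF m(2,1,2) g f]
  have N: "N X X (g * f + (- 1) \<cdot>\<^sub>m 1\<^sub>m (rdim X))" "N X' X' (f * g + (- 1) \<cdot>\<^sub>m 1\<^sub>m (rdim X'))"
    using eq gf fg m by (auto intro!: cls_eqD module_hom_one)
  let ?T = "tensor_mod X Z" and ?T' = "tensor_mod X' Z" and ?b = "double_braid X Z" and ?b' = "double_braid X' Z"
  let ?d = "rdim X" and ?d' = "rdim X'" and ?e = "rdim Z"
  let ?f = "kron f (1\<^sub>m ?e)" and ?g = "kron g (1\<^sub>m ?e)" and ?D = "?d * ?e" and ?D' = "?d' * ?e"
  note T = tensor_module[OF m(1,3)] and T' = tensor_module[OF m(2,3)]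
  note b = double_braid_hom[OF m(1,3)] and b' = double_braid_hom[OF m(2,3)]
  have fh: "?f \<in> module_hom n ?T ?T'" and gh: "?g \<in> module_hom n ?T' ?T"
    using m f g by (auto intro!: module_hom_kron module_hom_one)
  note c = module_homD(1)[OF f] module_homD(1)[OF g] module_homD(1)[OF fh, simplified]
    module_homD(1)[OF gh, simplified] module_homD(1)[OF b, simplified] module_homD(1)[OF b', simplified]
  have k: "kron (g * f) (1\<^sub>m ?e) = ?g * ?f" "kron (f * g) (1\<^sub>m ?e) = ?f * ?g"
    using c by (simp_all add: kron_mult[of _ ?d ?d' _ ?e ?e _ ?d _ ?e] kron_mult[of _ ?d' ?d _ ?e ?e _ ?d' _ ?e])
  have b'f: "?b' * ?f \<in> module_hom n ?T ?T'" by (rule module_hom_comp[OF T T' T' fh b'])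
  have fgh: "?f * ?g \<in> module_hom n ?T' ?T'" by (rule module_hom_comp[OF T' T T' gh fh])
  have "hopf_link S X Z = mtrace (rgen ?T GK * ?b)" by (rule hopf_link_S[OF m(1,3)])
  also have "\<dots> = mtrace (rgen ?T GK * (?g * ?f * ?b))"
    using trace_kron_negligible[OF m(1,3) gf N(1) b] by (simp add: k)
  also have "?g * ?f * ?b = ?g * (?b' * ?f)"
    using c double_braid_natural[OF m f] by (simp add: assoc_mult_mat[of _ ?D ?D' _ ?D _ ?D])
  also have "mtrace (rgen ?T GK * (?g * (?b' * ?f))) = mtrace (rgen ?T' GK * (?b' * ?f * ?g))"
    by (rule mtrace_cyclic[OF T' T gh b'f])
  also have "?b' * ?f * ?g = ?b' * (?f * ?g)"
    using c by (simp add: assoc_mult_mat[of _ ?D' ?D' _ ?D _ ?D'])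
  also have "mtrace (rgen ?T' GK * (?b' * (?f * ?g))) = mtrace (rgen ?T' GK * (?f * ?g * ?b'))"
    by (rule mtrace_cyclic[OF T' T' b' fgh])
  also have "\<dots> = mtrace (rgen ?T' GK * ?b')"
    using trace_kron_negligible[OF m(2,3) fg N(2) b'] by (simp add: k)
  also have "\<dots> = hopf_link S X' Z" by (rule hopf_link_S[OF m(2,3), symmetric])
  finally show ?thesis .
qed

end


section \<open>One-dimensional modules in the semi-simplification\<close>

lemma flip_one: "flip_mat 1 d = 1\<^sub>m d" "flip_mat d 1 = 1\<^sub>m d"
  by (auto simp: flip_mat_def intro!: eq_matI)

lemma rgen_tensor_sign:
  assumes X: "dk_module n X" and s: "s * s = 1"
  shows "g \<in> gens n \<Longrightarrow> rgen (tensor_mod X (sign_mod s)) g = (if g \<in> {GK, GKbar} then s \<cdot>\<^sub>m rgen X g else rgen X g)"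
    and "rgen (tensor_mod (sign_mod s) X) GK = s \<cdot>\<^sub>m rgen X GK"
    and "g \<in> gens n \<Longrightarrow> rgen (tensor_mod unit_mod X) g = rgen X g"
proof -
  interpret l: dk_module_pair n X "sign_mod s"
    using X sign_module[OF s] by (rule dk_module_pair.intro)
  interpret r: dk_module_pair n "sign_mod s" X
    using sign_module[OF s] X by (rule dk_module_pair.intro)
  interpret u: dk_module_pair n unit_mod X
    using unit_module X by (rule dk_module_pair.intro)
  show "rgen (tensor_mod X (sign_mod s)) g = (if g \<in> {GK, GKbar} then s \<cdot>\<^sub>m rgen X g else rgen X g)"
    if "g \<in> gens n"
    using that carrier_matD[OF l.l.rgen_carrier[OF that]] carrier_matD[OF l.l.rgen_carriers(1)]
      carrier_matD[OF l.l.rgen_carriers(2)]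
    by (cases rule: gens_cases) (simp_all add: l.rgen_tensor kron_scalar_left kron_zero_right kron_one_one
        left_add_zero_mat[of _ "rdim X" "rdim X"])
  show "rgen (tensor_mod (sign_mod s) X) GK = s \<cdot>\<^sub>m rgen X GK"
    by (simp add: r.rgen_tensor kron_scalar_left)
  show "rgen (tensor_mod unit_mod X) g = rgen X g" if "g \<in> gens n"
    using that unfolding unit_mod_eq
    by (cases rule: gens_cases) (simp_all add: u.rgen_tensor[unfolded unit_mod_eq] kron_scalar_left kron_zero_left
       one_smult_mat kron_one_one right_add_zero_mat[of _ "rdim X" "rdim X"])
qed

text \<open>Only the Cartan part (1 + a + b - a b) / 2 survives on a one-dimensional module. It
  equals 1 when a or b is 1, equals b when a = -1, and equals a when b = -1.\<close>

lemma act2_R_sign: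
  assumes X: "dk_module n X"
  shows "act2 unit_mod X (R_matrix n) = 1\<^sub>m (rdim X)" "act2 X unit_mod (R_matrix n) = 1\<^sub>m (rdim X)"
    "act2 (sign_mod (- 1)) X (R_matrix n) = rgen X GKbar" "act2 X (sign_mod (- 1)) (R_matrix n) = rgen X GK"
proof -
  interpret X: dk_module n X by fact
  have left: "act2 (sign_mod s) X (R_matrix n) = (1 / 2) \<cdot>\<^sub>m rmat_cartan (sign_mod s) X"
    and right: "act2 X (sign_mod s) (R_matrix n) = (1 / 2) \<cdot>\<^sub>m rmat_cartan X (sign_mod s)" if s: "s * s = 1" for s
  proof -
    interpret l: dk_module_pair n X "sign_mod s"
      using X sign_module[OF s] by (rule dk_module_pair.intro)
    interpret r: dk_module_pair n "sign_mod s" X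
      using sign_module[OF s] X by (rule dk_module_pair.intro)
    have "rmat_prod X (sign_mod s) m = 1\<^sub>m (rdim X)" if "m \<le> n" for m
      using that
    proof (induction m)
      case (Suc m)
      then show ?case
        using carrier_matD[OF X.rgen_carriers(3)[of "Suc m"]]
        by (simp add: kron_zero_right)
    qed simp
    then show "act2 X (sign_mod s) (R_matrix n) = (1 / 2) \<cdot>\<^sub>m rmat_cartan X (sign_mod s)"
      unfolding l.act2_R_matrix using l.rmat_cartan_carrier
      by simp
    have "rmat_prod (sign_mod s) X m = 1\<^sub>m (rdim X)" if "m \<le> n" for m
      using that
    proof (induction m)
      case (Suc m)
      then show ?case
        using carrier_matD[OF X.rgen_carriers(4)[of "Suc m"]] carrier_matD[OF X.rgen_carriers(2)]
        by (simp add: kron_zero_left)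
    qed simp
    then show "act2 (sign_mod s) X (R_matrix n) = (1 / 2) \<cdot>\<^sub>m rmat_cartan (sign_mod s) X"
      unfolding r.act2_R_matrix using r.rmat_cartan_carrier
      by simp
  qed
  note c = carrier_matD[OF X.rgen_carriers(1)] carrier_matD[OF X.rgen_carriers(2)]
  show "act2 unit_mod X (R_matrix n) = 1\<^sub>m (rdim X)" "act2 X unit_mod (R_matrix n) = 1\<^sub>m (rdim X)"
    using left[of 1] right[of 1] c unfolding unit_mod_eq
    by (auto simp: rmat_cartan_def kron_scalar_left kron_one_one one_smult_mat intro!: eq_matI)
  show "act2 (sign_mod (- 1)) X (R_matrix n) = rgen X GKbar" "act2 X (sign_mod (- 1)) (R_matrix n) = rgen X GK"
    using left[of "- 1"] right[of "- 1"] c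
    by (auto simp: rmat_cartan_def kron_scalar_left kron_one_one intro!: eq_matI)
qed

lemma (in dk_module) mtrace_group:
  assumes "n \<ge> 1"
  shows "mtrace (rgen X GKbar) = mtrace (rgen X GK)"
proof -
  let ?d = "rdim X" and ?k = "rgen X GK" and ?kb = "rgen X GKbar" and ?x = "rgen X (GXi 1)" and ?y = "rgen X (GXibar 1)"
  have i: "1 \<in> {1..n}" using assms by simp
  note c = rgen_carriers(1,2) rgen_carriers(3,4)[OF i] and as = assoc_mult_mat[of _ ?d ?d _ ?d _ ?d]
  have r: "?x * ?y + ?y * ?x + ?k * ?kb = 1\<^sub>m ?d" "?k * ?x + ?x * ?k = 0\<^sub>m ?d ?d" "?k * ?k = 1\<^sub>m ?d"
    using dk_rep i by (auto simp: dk_mat_def)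
  have "?k * (?x * ?y) + ?k * (?y * ?x) + ?k * (?k * ?kb) = ?k * (?x * ?y + ?y * ?x + ?k * ?kb)"
    using c by (simp add: mult_add_distrib_mat[of _ ?d ?d _ ?d])
  also have "\<dots> = ?k" unfolding r(1) by simp
  also have "?k * (?k * ?kb) = ?kb"
    using c r(3) by (simp flip: as)
  finally have "mtrace (?k * (?x * ?y)) + mtrace (?k * (?y * ?x)) + mtrace ?kb = mtrace ?k"
    using c by (simp add: mtrace_add[of _ ?d, symmetric])
  moreover have "mtrace (?k * (?y * ?x)) = mtrace (?x * ?k * ?y)"
    using c mtrace_mult_commute[of "?k * ?y" ?d ?d ?x] by (simp add: as)
  moreover have "mtrace (?k * (?x * ?y)) + mtrace (?x * ?k * ?y) = 0"
  proof -
    have "?k * (?x * ?y) + ?x * ?k * ?y = (?k * ?x + ?x * ?k) * ?y"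
      using c by (simp add: as add_mult_distrib_mat[of _ ?d ?d _ _ ?d])
    also have "\<dots> = 0\<^sub>m ?d ?d" unfolding r(2) using c by simp
    finally have "mtrace (?k * (?x * ?y) + ?x * ?k * ?y) = 0" by (simp add: mtrace_def)
    then show ?thesis using c by (simp add: as mtrace_add[of _ ?d])
  qed
  ultimately show ?thesis by simp
qed

context even_dk
begin

lemma hopf_link_sign:
  assumes Z: "dk_module n Z" and n: "n \<ge> 1"
  shows "hopf_link S (sign_mod (- 1)) Z = - hopf_link S unit_mod Z"
proof -
  interpret dk_module n Z by fact
  have s: "dk_module n (sign_mod (- 1))" by (rule sign_module) simp
  let ?d = "rdim Z" and ?k = "rgen Z GK" and ?kb = "rgen Z GKbar"
  have "double_braid unit_mod Z = 1\<^sub>m ?d"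
    unfolding double_braid_def braid_eq act2_R_sign[OF Z] by (simp add: unit_mod_eq flip_one)
  then have u: "hopf_link S unit_mod Z = mtrace ?k"
    by (simp add: hopf_link_S[OF unit_module Z] rgen_tensor_sign(3)[OF Z, of 1])
  have "double_braid (sign_mod (- 1)) Z = ?k * ?kb"
    unfolding double_braid_def braid_eq act2_R_sign[OF Z]
    by (simp add: flip_one)
  moreover have "(- 1) \<cdot>\<^sub>m ?k * (?k * ?kb) = (- 1) \<cdot>\<^sub>m ?kb"
    using gen_identities(1)
    by (simp add: mult_smult_assoc_mat[of _ ?d ?d _ ?d] flip: assoc_mult_mat[of _ ?d ?d _ ?d _ ?d])
  ultimately have "hopf_link S (sign_mod (- 1)) Z = - mtrace ?kb"
    by (simp add: hopf_link_S[OF s Z] rgen_tensor_sign(2)[OF Z, of "- 1"] mtrace_smult[of _ ?d])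
  then show ?thesis using u mtrace_group[OF n] by simp
qed

section \<open>One-dimensional modules are simple before and after passing to the quotient\<close>

context
  fixes s :: complex
  assumes s: "s * s = 1"
begin

lemma sign_hom_scalar:
  fixes f :: "complex mat"
  assumes "f \<in> carrier_mat 1 1"
  shows "f = f $$ (0, 0) \<cdot>\<^sub>m 1\<^sub>m 1"
  using assms by (auto intro!: eq_matI)

text \<open>For a monomorphism \<open>f : Y \<rightarrow> \<chi>\<close> to a one-dimensional module, the two maps \<open>y' \<otimes> y \<mapsto> f(y') y\<close>
  and \<open>y' \<otimes> y \<mapsto> f(y) y'\<close> from \<open>Y \<otimes> \<chi> \<otimes> Y\<close> to \<open>Y\<close> have the same composite with \<open>f\<close>; since they then
  agree, \<open>Y\<close> has dimension at most one unless \<open>f = 0\<close>.\<close>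

lemma mono_to_sign:
  assumes Y: "dk_module n Y" and mono: "is_mono C Y (sign_mod s) f" and f0: "f \<noteq> 0\<^sub>m 1 (rdim Y)"
  shows "rdim Y = 1"
proof -
  let ?P = "sign_mod s" and ?d = "rdim Y"
  note P = sign_module[OF s, of n]
  note YP = tensor_module[OF Y P] and YPY = tensor_module[OF tensor_module[OF Y P] Y]
  interpret Y: dk_module n Y by fact
  have fh: "f \<in> module_hom n Y ?P" using mono by (simp add: is_mono_def)
  note fc = module_homD(1)[OF fh, simplified]
  \<comment> \<open>The module \<open>sign_mod s\<close> is its own tensor inverse, so f is also a
    morphism from Y \<otimes> \<open>sign_mod s\<close> to the unit. The middle tensor factor is
    there to make both test maps below module morphisms into Y.\<close>
  have "f * rgen (tensor_mod Y ?P) g = rgen unit_mod g * f" if g: "g \<in> gens n" for g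
  proof -
    have *: "f * rgen Y g = rgen ?P g * f" by (rule module_homD(2)[OF fh g])
    have ss: "s \<cdot>\<^sub>m (s \<cdot>\<^sub>m f) = f" by (simp add: smult_smult_mat s one_smult_mat)
    show ?thesis
      using g
    proof (cases rule: gens_cases)
      case 1
      then show ?thesis using * fc ss
        by (simp add: rgen_tensor_sign(1)[OF Y s] unit_mod_eq one_smult_mat mult_smult_distrib[of _ 1 ?d _ ?d]
            mult_smult_assoc_mat[of _ 1 1 _ ?d])
    next
      case 2
      then show ?thesis using * fc ss
        by (simp add: rgen_tensor_sign(1)[OF Y s] unit_mod_eq one_smult_mat mult_smult_distrib[of _ 1 ?d _ ?d]
            mult_smult_assoc_mat[of _ 1 1 _ ?d])
    qed (use * in \<open>simp_all add: rgen_tensor_sign(1)[OF Y s] unit_mod_eq\<close>)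
  qed
  then have f': "f \<in> module_hom n (tensor_mod Y ?P) unit_mod"
    using fc by (simp add: module_hom_def unit_mod_eq)
  let ?g = "kron f (1\<^sub>m ?d)" and ?h = "kron (1\<^sub>m ?d) f"
  have "?g \<in> module_hom n (tensor_mod (tensor_mod Y ?P) Y) (tensor_mod unit_mod Y)"
    by (rule module_hom_kron[OF YP unit_module Y Y f' module_hom_one[OF Y]])
  then have g: "?g \<in> module_hom n (tensor_mod (tensor_mod Y ?P) Y) Y"
    using rgen_tensor_sign(3)[OF Y, of 1] by (simp add: module_hom_def unit_mod_eq)
  have "?h \<in> module_hom n (tensor_mod (tensor_mod Y ?P) Y) (tensor_mod (tensor_mod Y ?P) ?P)"
    using module_hom_kron[OF YP YP Y P module_hom_one[OF YP] fh] by simp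
  moreover have "rgen (tensor_mod (tensor_mod Y ?P) ?P) g = rgen Y g" if "g \<in> gens n" for g
    using that by (simp add: rgen_tensor_sign(1)[OF YP s] rgen_tensor_sign(1)[OF Y s] smult_smult_mat s one_smult_mat)
  ultimately have h: "?h \<in> module_hom n (tensor_mod (tensor_mod Y ?P) Y) Y"
    by (simp add: module_hom_def)
  \<comment> \<open>Both composites with f are f \<otimes> f.\<close>
  have "f * ?g = kron (1\<^sub>m 1) f * kron f (1\<^sub>m ?d)" by (simp add: kron_one_one)
  also have "\<dots> = kron f f" using fc by (simp add: kron_mult[of _ 1 1 _ 1 ?d _ ?d _ ?d])
  also have "\<dots> = kron f (1\<^sub>m 1) * kron (1\<^sub>m ?d) f" using fc by (simp add: kron_mult[of _ 1 ?d _ 1 1 _ ?d _ ?d])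
  also have "\<dots> = f * ?h" by (simp add: kron_one_one)
  finally have "?g = ?h"
    using mono g h YPY by (simp add: is_mono_def)
  obtain a where a: "a < ?d" "f $$ (0, a) \<noteq> 0"
    using f0 fc by (auto simp: mat_eq_iff)
  \<comment> \<open>Column a * ?d + b compares f(e_a) e_b with f(e_b) e_a. For b different from a
    their b-th entries are f(e_a), which is nonzero, and 0.\<close>
  have uni: "b = a" if b: "b < ?d" for b
  proof (rule ccontr)
    assume "b \<noteq> a"
    have l: "a * ?d + b < ?d * ?d" using a b by (simp add: pair_less)
    have "?g $$ (b, a * ?d + b) = f $$ (0, a)"
      using a b l fc by (subst kron_index) auto
    moreover have "?h $$ (b, a * ?d + b) = 0"
      using a b l fc \<open>b \<noteq> a\<close> by (subst kron_index) auto
    ultimately show False using \<open>?g = ?h\<close> a by simp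
  qed
  show ?thesis
  proof (rule ccontr)
    assume "?d \<noteq> 1"
    then have "0 < ?d" "1 < ?d" using a by linarith+
    then show False using uni[of 0] uni[of 1] by simp
  qed
qed

lemma sign_simple: "simple_obj C (sign_mod s)"
proof -
  let ?P = "sign_mod s"
  note P = sign_module[OF s, of n]
  have "is_iso C Y ?P f" if Y: "dk_module n Y" and mono: "is_mono C Y ?P f" and f0: "f \<noteq> 0\<^sub>m 1 (rdim Y)" for Y f
  proof -
    have d: "rdim Y = 1" using mono_to_sign[OF that] .
    interpret Y: dk_module n Y by fact
    have fh: "f \<in> module_hom n Y ?P" using mono by (simp add: is_mono_def)
    define c where "c = f $$ (0, 0)"
    have f: "f = c \<cdot>\<^sub>m 1\<^sub>m 1"
      unfolding c_def using module_homD(1)[OF fh] d by (intro sign_hom_scalar) simp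
    have c0: "c \<noteq> 0" using f0 d by (auto simp: f)
    let ?g = "inverse c \<cdot>\<^sub>m 1\<^sub>m 1"
    have "?g * rgen ?P x = rgen Y x * ?g" if x: "x \<in> gens n" for x
    proof -
      have px: "rgen ?P x \<in> carrier_mat 1 1"
        using carrier_rep.rgen_carrier[OF dk_module.axioms(1)[OF P] x] by simp
      have yx: "rgen Y x \<in> carrier_mat 1 1" using Y.rgen_carrier[OF x] d by simp
      have "c \<cdot>\<^sub>m rgen Y x = c \<cdot>\<^sub>m rgen ?P x"
        using module_homD(2)[OF fh x] px yx unfolding f
        by (simp add: mult_smult_assoc_mat[of _ 1 1 _ 1] mult_smult_distrib[of _ 1 1 _ 1])
      then have "inverse c \<cdot>\<^sub>m (c \<cdot>\<^sub>m rgen Y x) = inverse c \<cdot>\<^sub>m (c \<cdot>\<^sub>m rgen ?P x)" by simp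
      then have "rgen Y x = rgen ?P x" using c0 by (simp add: smult_smult_mat one_smult_mat)
      then show ?thesis
        using px by (simp add: mult_smult_assoc_mat[of _ 1 1 _ 1] mult_smult_distrib[of _ 1 1 _ 1])
    qed
    then have "?g \<in> module_hom n ?P Y" using d by (simp add: module_hom_def)
    moreover have "?g * f = 1\<^sub>m 1" "f * ?g = 1\<^sub>m 1"
      unfolding f using c0 by (auto simp: scalar_prod_def intro!: eq_matI)
    ultimately show ?thesis
      using fh d by (auto simp: is_iso_def)
  qed
  moreover have "1\<^sub>m 1 \<noteq> (0\<^sub>m 1 1 :: complex mat)" by (auto simp: mat_eq_iff)
  ultimately show ?thesis
    using P by (auto simp: simple_obj_def)
qed

text \<open>A simple object is dominated by itself, with both morphisms the identity.\<close>

lemma sign_quasi_dominated: "quasi_dominated C (sign_mod s)"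
proof -
  let ?P = "sign_mod s"
  note P = sign_module[OF s, of n]
  have "1\<^sub>m 1 + (- 1) \<cdot>\<^sub>m (1\<^sub>m 1 * 1\<^sub>m 1 + 0\<^sub>m 1 1) = (0\<^sub>m 1 1 :: complex mat)" by auto
  then have "N ?P ?P (1\<^sub>m 1 + (- 1) \<cdot>\<^sub>m (1\<^sub>m 1 * 1\<^sub>m 1 + 0\<^sub>m 1 1))"
    using negligible_zero[OF P P] by simp
  then show ?thesis
    unfolding quasi_dominated_def using sign_simple module_hom_one[OF P]
    by (intro exI[of _ "[(?P, 1\<^sub>m 1, 1\<^sub>m 1)]"]) (simp add: Diff_def)
qed

text \<open>A nonzero F in the quotient has a representative f that is not negligible, so f g is a
  nonzero scalar for some g, and rescaling gives a section h. From f (h f) = f and F being monic, h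
  f is the identity in the quotient. The identity of the module itself survives because its quantum
  dimension is s.\<close>

lemma sign_simple_S: "simple_obj S (sign_mod s)"
proof -
  let ?P = "sign_mod s"
  note P = sign_module[OF s, of n]
  have s0: "s \<noteq> 0" using s by auto
  have tr: "mtrace (rgen ?P GK * f) = s * f $$ (0, 0)" if "f \<in> carrier_mat 1 1" for f
    using that by (simp add: mtrace_def scalar_prod_def One_nat_def)
  have nz: "Id S ?P \<noteq> Zero S ?P ?P"
  proof
    assume "Id S ?P = Zero S ?P ?P"
    then have "cls ?P ?P (1\<^sub>m 1) = cls ?P ?P (0\<^sub>m 1 1)" by simp
    then have "N ?P ?P (1\<^sub>m 1 + (- 1) \<cdot>\<^sub>m 0\<^sub>m 1 1)"
      using module_hom_one[OF P] module_hom_zero[OF P P] by (intro cls_eqD[OF P P]) simp_all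
    then have "\<forall>g\<in>module_hom n ?P ?P. mtrace (rgen ?P GK * ((1\<^sub>m 1 + (- 1) \<cdot>\<^sub>m 0\<^sub>m 1 1) * g)) = 0"
      unfolding negligible_iff[OF P P] by (rule conjunct2)
    from bspec[OF this, of "1\<^sub>m 1"]
    have "mtrace (rgen ?P GK * ((1\<^sub>m 1 + (- 1) \<cdot>\<^sub>m 0\<^sub>m 1 1) * 1\<^sub>m 1)) = 0"
      using module_hom_one[OF P] by simp
    then show False using s0 by (subst (asm) tr) auto
  qed
  have iso: "is_iso S Y ?P F"
    if Y: "Y \<in> Obj S" and mono: "is_mono S Y ?P F" and F0: "F \<noteq> Zero S Y ?P" for Y F
  proof -
    have Ym: "dk_module n Y" using Y by simp
    obtain f where f: "f \<in> module_hom n Y ?P" "F = cls Y ?P f"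
      using mono by (auto simp: is_mono_def)
    note fc = module_homD(1)[OF f(1), simplified]
    have "\<not> N Y ?P f"
    proof
      assume "N Y ?P f"
      moreover have "f + (- 1) \<cdot>\<^sub>m 0\<^sub>m 1 (rdim Y) = f" using fc by auto
      ultimately have "cls Y ?P f = cls Y ?P (0\<^sub>m 1 (rdim Y))"
        using f module_hom_zero[OF Ym P] by (intro cls_eqI[OF Ym P]) simp_all
      then show False using F0 f by simp
    qed
    then obtain g where g: "g \<in> module_hom n ?P Y" "mtrace (rgen ?P GK * (f * g)) \<noteq> 0"
      using f(1) Ym P by (auto simp: negligible_iff)
    note gc = module_homD(1)[OF g(1), simplified]
    define c where "c = (f * g) $$ (0, 0)"
    have fgc: "f * g \<in> carrier_mat 1 1" using fc gc by simp
    then have fg: "f * g = c \<cdot>\<^sub>m 1\<^sub>m 1" unfolding c_def by (rule sign_hom_scalar)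
    have c0: "c \<noteq> 0" using g(2) tr[OF fgc] by (auto simp: c_def)
    define h where "h = inverse c \<cdot>\<^sub>m g"
    have h: "h \<in> module_hom n ?P Y" unfolding h_def using g(1) by (rule module_hom_smult[OF P Ym])
    note hc = module_homD(1)[OF h, simplified]
    have fh: "f * h = 1\<^sub>m 1"
      unfolding h_def using fc gc fg c0
      by (simp add: mult_smult_distrib[of _ 1 "rdim Y" _ 1] smult_smult_mat one_smult_mat)
    note hf = module_hom_comp[OF Ym P Ym f(1) h]
    have "f * (h * f) = f"
      using fh fc hc by (simp add: left_mult_one_mat[of _ 1 "rdim Y"] flip: assoc_mult_mat[of _ 1 "rdim Y" _ 1 _ "rdim Y"])
    then have "Comp S Y Y ?P F (cls Y Y (h * f)) = Comp S Y Y ?P F (cls Y Y (1\<^sub>m (rdim Y)))"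
      unfolding f(2) using comp_cls[OF Ym Ym P hf f(1)] comp_cls[OF Ym Ym P module_hom_one[OF Ym] f(1)] fc by simp
    moreover have "cls Y Y (h * f) \<in> Hom S Y Y" "cls Y Y (1\<^sub>m (rdim Y)) \<in> Hom S Y Y"
      using hf module_hom_one[OF Ym] by auto
    ultimately have "cls Y Y (h * f) = cls Y Y (1\<^sub>m (rdim Y))"
      using mono Y unfolding is_mono_def by blast
    then have "Comp S Y ?P Y (cls ?P Y h) F = Id S Y" "Comp S ?P Y ?P F (cls ?P Y h) = Id S ?P"
      unfolding f(2) using comp_cls[OF Ym P Ym f(1) h] comp_cls[OF P Ym P h f(1)] fh by simp_all
    moreover have "cls ?P Y h \<in> Hom S ?P Y" "F \<in> Hom S Y ?P" using h f by auto
    ultimately show ?thesis unfolding is_iso_def by blast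
  qed
  show ?thesis
    unfolding simple_obj_def using P sign_quasi_dominated nz iso by auto
qed

end

end

text \<open>Opposite rows of A stay opposite in A B = 1, against the entry 1 at (i, i). The case i =
  j, where the row is zero, is included, so the two indices below may be taken as they come.\<close>

lemma not_invertible_rows:
  fixes A :: "complex mat"
  assumes A: "A \<in> carrier_mat m m" and ij: "i < m" "j < m"
    and rows: "\<And>l. l < m \<Longrightarrow> A $$ (i, l) = - A $$ (j, l)"
  shows "\<not> invertible_mat A"
proof
  assume "invertible_mat A"
  then obtain B where AB: "A * B = 1\<^sub>m m" and BA: "B * A = 1\<^sub>m (dim_row B)"
    using A by (auto simp: invertible_mat_def inverts_mat_def)
  have B: "dim_col B = m" using AB by (metis index_mult_mat(3) index_one_mat(3))
  have Bd: "dim_row B = m" using BA A by (metis carrier_matD(2) index_mult_mat(3) index_one_mat(3))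
  have "(A * B) $$ (i, i) = - (A * B) $$ (j, i)"
    using A B Bd ij rows by (simp add: scalar_prod_def sum_negf)
  then show False
    unfolding AB using ij by (auto split: if_splits)
qed

theorem proposition7p2p6:
  fixes n :: nat
  assumes "n \<ge> 2" and "even n"
  shows "\<not> modular (semisimplification (DK_mod n))"
proof
  assume "modular (semisimplification (DK_mod n))"
  then obtain Xs where reps: "simple_representatives (semisimplification (DK_mod n)) Xs"
    and inv: "invertible_mat (S_matrix (semisimplification (DK_mod n)) Xs)"
    by (auto simp: modular_def)
  interpret even_dk n by unfold_locales fact
  have obj: "dk_module n X" if "X \<in> set Xs" for X
    using reps that by (auto simp: simple_representatives_def simple_obj_def)
  have u: "simple_obj S unit_mod" and p: "simple_obj S (sign_mod (- 1))"
    unfolding unit_mod_eq by (rule sign_simple_S, simp)+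
  have "\<exists>Y\<in>set Xs. isomorphic S X Y" if "simple_obj S X" for X
    using reps that by (simp only: simple_representatives_def)
  from this[OF u] this[OF p] obtain U V where "U \<in> set Xs" "isomorphic S unit_mod U"
    "V \<in> set Xs" "isomorphic S (sign_mod (- 1)) V"
    by blast
  then obtain i j where i: "i < length Xs" "isomorphic S unit_mod (Xs ! i)"
    and j: "j < length Xs" "isomorphic S (sign_mod (- 1)) (Xs ! j)"
    by (metis in_set_conv_nth)
  \<comment> \<open>Invariance under isomorphism in the quotient carries the relation between P and
    the unit over to their representatives in the list.\<close>
  have "hopf_link S (Xs ! j) Z = - hopf_link S (Xs ! i) Z" if Z: "Z \<in> set Xs" for Z
    using hopf_link_iso[OF unit_module obj obj[OF Z] i(2)] hopf_link_iso[OF sign_module obj obj[OF Z] j(2)]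
      hopf_link_sign[OF obj[OF Z]] i j assms(1) by simp
  then have "\<not> invertible_mat (S_matrix S Xs)"
    using i j by (intro not_invertible_rows[of _ "length Xs" j i]) (auto simp: S_matrix_def)
  then show False using inv by simp
qed

end
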